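(* Let $W_t=(X_t,Y_t,Z_t)$, $t=0,1,2,\dots$, be the self-interacting random walk in $\mathbb{Z}^3$ started from $W_0=0$ that evolves as follows. If time $t$ is the first visit of $W$ to the vertex $W_t$ (that is, $W_t\notin\{W_0,\dots,W_{t-1}\}$), then, conditionally on $(W_0,\dots,W_t)$, $W_{t+1}-W_t$ is uniformly distributed on $\{(0,0,1),(0,0,-1)\}$; otherwise, conditionally on $(W_0,\dots,W_t)$, $W_{t+1}-W_t$ is uniformly distributed on $\{(1,0,0),(-1,0,0),(0,1,0),(0,-1,0)\}$. Then $W$ is transient, i.e. $\|W_t\|\to\infty$ as $t\to\infty$ almost surely.
   Context: Time $t=0$ counts as the first visit to $W_0$. *)

theory Defs
  imports "HOL-Probability.Probability"
begin

type_synonym site = "int \<times> int \<times> int"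

definition real_site :: "site \<Rightarrow> real \<times> real \<times> real" where
  "real_site = (\<lambda>(x, y, z). (of_int x, of_int y, of_int z))"

definition first_visit :: "(nat \<Rightarrow> site) \<Rightarrow> nat \<Rightarrow> bool" where
  "first_visit w t \<longleftrightarrow> w t \<notin> w ` {..<t}"

definition vertical_steps :: "site set" where
  "vertical_steps = {(0, 0, 1), (0, 0, -1)}"

definition horizontal_steps :: "site set" where
  "horizontal_steps = {(1, 0, 0), (-1, 0, 0), (0, 1, 0), (0, -1, 0)}"

definition step_law :: "(nat \<Rightarrow> site) \<Rightarrow> nat \<Rightarrow> site pmf" where
  "step_law w t =
     pmf_of_set (if first_visit w t then vertical_steps else horizontal_steps)"

(* Since the state space is countable, conditioning on (W_0, ..., W_t) means elementary
   conditioning on each history (w_0, ..., w_t) of positive probability. The values w s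
   for s > t of the function w play no role. *)
locale self_interacting_walk = prob_space M
  for M :: "'a measure" and W :: "nat \<Rightarrow> 'a \<Rightarrow> site" +
  assumes measurable_walk: "\<And>t. W t \<in> measurable M (count_space UNIV)"
    and start: "AE \<omega> in M. W 0 \<omega> = 0"
    and conditional_step:
      "\<And>t w v. \<P>(\<omega> in M. \<forall>s\<le>t. W s \<omega> = w s) > 0 \<Longrightarrow>
         \<P>(\<omega> in M. W (Suc t) \<omega> - W t \<omega> = v \<bar> \<forall>s\<le>t. W s \<omega> = w s) = pmf (step_law w t) v"

end

theory Submission
  imports Defs "HOL-Real_Asymp.Real_Asymp"
begin

text \<open>
  The horizontal steps of the walk form a planar simple random walk \<open>S\<close>. Given \<open>S\<close>, the height is a
  martingale that makes a fair unit step at every first visit, in particular whenever \<open>S\<close> enters a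
  new column; how often it moves otherwise depends on its own past. Let \<open>n \<in> [2\<^sup>k, 2\<^sup>k\<^sup>+\<^sup>1)\<close> be the
  first such time at which \<open>S\<close> visits the column of the target, and consider windows
  \<open>[n - b\<^sub>j, n - b\<^sub>j\<^sub>+\<^sub>1]\<close> with \<open>b\<^sub>j = 2 ^ (k - 1 - \<kappa> j)\<close>, where \<open>j\<close> runs up to \<open>\<kappa>\<^sup>6\<close> and
  \<open>\<kappa>\<close> is about \<open>k\<close> to the power \<open>1 / 8\<close>. Typically \<open>S\<close> enters at least a constant times
  \<open>b\<^sub>j / (k \<kappa>)\<close> new columns during the window, while the total number of vertical steps is of order
  \<open>b\<^sub>j\<close>. A simple random walk that makes at least \<open>N\<close> and at most \<open>N'\<close> steps ends at a distance
  of order \<open>sqrt N\<close> with probability at least a constant times \<open>sqrt (N / N')\<close>, no matter how the number of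
  steps depends on it. From that distance the height does not come back in the remaining time, which
  is smaller by a factor \<open>2 ^ \<kappa>\<close>. So the target is hit with probability at most about
  \<open>exp (- c \<kappa>)\<close>.

  The exceptional \<open>S\<close> are those with too few new columns in half of the windows. A window fails only
  if it has few distinct sites or if many of its sites were visited long before, with probability
  \<open>O (1 / \<kappa>)\<close> and \<open>O (\<kappa>\<^sup>7 / k) = O (1 / \<kappa>)\<close>. That \<open>n\<close> is the first visit of the block forces the last
  steps before \<open>n\<close> to avoid the column, which costs an independent factor \<open>O (1 / k)\<close>. Later visits to the
  column are harmless unless they occur long after \<open>n\<close>, which again has probability \<open>O (1 / (k \<kappa>))\<close>.
  This is summable in \<open>k\<close>.
\<close>

section \<open>Histories of the walk\<close>

text \<open>A history is the list of increments with the most recent one first; \<open>visited\<close> omits its endpoint.\<close>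

fun visited :: "site list \<Rightarrow> site set" where
  "visited [] = {}"
| "visited (m # l) = insert (sum_list l) (visited l)"

definition fresh :: "site list \<Rightarrow> bool" where
  "fresh l \<longleftrightarrow> sum_list l \<notin> visited l"

definition moves :: "site list \<Rightarrow> site set" where
  "moves l = (if fresh l then vertical_steps else horizontal_steps)"

fun valid :: "site list \<Rightarrow> bool" where
  "valid [] \<longleftrightarrow> True"
| "valid (m # l) \<longleftrightarrow> valid l \<and> m \<in> moves l"

text \<open>A history has its newest increment first, so the oldest \<open>s\<close> increments are
  the suffix of length \<open>s\<close>.\<close>

definition path_of :: "site list \<Rightarrow> nat \<Rightarrow> site" where
  "path_of l s = sum_list (drop (length l - s) l)"

fun history :: "(nat \<Rightarrow> 'a \<Rightarrow> site) \<Rightarrow> nat \<Rightarrow> 'a \<Rightarrow> site list" where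
  "history W 0 \<omega> = []"
| "history W (Suc t) \<omega> = (W (Suc t) \<omega> - W t \<omega>) # history W t \<omega>"

lemma finite_moves [simp]: "finite (moves l)"
  by (simp add: moves_def vertical_steps_def horizontal_steps_def)

lemma moves_nonempty [simp]: "moves l \<noteq> {}"
  by (simp add: moves_def vertical_steps_def horizontal_steps_def)

lemma length_history [simp]: "length (history W t \<omega>) = t"
  by (induction t) auto

lemma sum_list_history: "W 0 \<omega> = 0 \<Longrightarrow> sum_list (history W t \<omega>) = W t \<omega>"
  by (induction t) auto

lemma path_of_Cons: "s \<le> length l \<Longrightarrow> path_of (m # l) s = path_of l s"
  by (simp add: path_of_def Suc_diff_le)

lemma path_of_length [simp]: "path_of l (length l) = sum_list l"
  by (simp add: path_of_def)

lemma path_of_image: "path_of l ` {..<length l} = visited l"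
proof (induction l)
  case (Cons m l)
  have "path_of (m # l) ` {..<length (m # l)} = insert (path_of (m # l) (length l)) (path_of (m # l) ` {..<length l})"
    by (simp add: lessThan_Suc)
  also have "path_of (m # l) ` {..<length l} = path_of l ` {..<length l}"
    by (intro image_cong) (auto simp: path_of_Cons)
  also have "path_of (m # l) (length l) = sum_list l"
    by (simp add: path_of_Cons)
  finally show ?case using Cons by simp
qed simp

lemma first_visit_path_of: "first_visit (path_of l) (length l) \<longleftrightarrow> fresh l"
  unfolding first_visit_def fresh_def path_of_image by simp

text \<open>The locale conditions on positions while the proof works with increments; this
  equivalence makes \<open>conditional_step\<close> a statement about cylinders of
  increments.\<close>

lemma path_of_iff_history:
  "(\<forall>s\<le>length l. W s \<omega> = path_of l s) \<longleftrightarrow> W 0 \<omega> = 0 \<and> history W (length l) \<omega> = l"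
proof (induction l)
  case Nil
  then show ?case by (auto simp: path_of_def)
next
  case (Cons m l)
  have "(\<forall>s\<le>length (m # l). W s \<omega> = path_of (m # l) s) \<longleftrightarrow>
        (\<forall>s\<le>length l. W s \<omega> = path_of l s) \<and> W (Suc (length l)) \<omega> = m + sum_list l"
    by (auto simp: le_Suc_eq path_of_Cons path_of_length[of "m # l", simplified])
  also have "\<dots> \<longleftrightarrow> (W 0 \<omega> = 0 \<and> history W (length l) \<omega> = l) \<and> W (Suc (length l)) \<omega> = m + sum_list l"
    using Cons by simp
  also have "\<dots> \<longleftrightarrow> W 0 \<omega> = 0 \<and> history W (length (m # l)) \<omega> = m # l"
    using sum_list_history[of W \<omega> "length l"] by auto
  finally show ?case .
qed

section \<open>Cylinder probabilities and a hitting bound from supermartingales\<close>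

context self_interacting_walk
begin

lemma history_measurable [measurable]: "history W t \<in> measurable M (count_space UNIV)"
proof (induction t)
  case (Suc t)
  note measurable_walk [measurable]
  note Suc [measurable]
  \<comment> \<open>Fixing one of the countably many values of \<open>W t\<close> leaves a function
    of \<open>W (Suc t)\<close> alone.\<close>
  have *: "(\<lambda>\<omega>. W (Suc t) \<omega> - W t \<omega>) \<in> measurable M (count_space UNIV)"
    by (rule measurable_compose_countable[where g = "W t"]) 
       (auto intro!: measurable_walk measurable_compose[OF measurable_walk])
  have "(\<lambda>\<omega>. (W (Suc t) \<omega> - W t \<omega>) # history W t \<omega>) \<in> measurable M (count_space UNIV)"
    by (rule measurable_compose_countable[where g = "history W t"])
       (auto intro!: Suc measurable_compose[OF *])
  then show ?case by simp
qed simp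

definition cylinder :: "site list \<Rightarrow> 'a set" where
  "cylinder l = {\<omega> \<in> space M. W 0 \<omega> = 0 \<and> history W (length l) \<omega> = l}"

lemma cylinder_sets [measurable]: "cylinder l \<in> sets M"
proof -
  note measurable_walk [measurable]
  show ?thesis unfolding cylinder_def by measurable
qed

lemma cylinder_eq: "cylinder l = {\<omega> \<in> space M. \<forall>s\<le>length l. W s \<omega> = path_of l s}"
  unfolding cylinder_def path_of_iff_history by simp

lemma prob_cylinder_Nil: "prob (cylinder []) = 1"
proof -
  have "AE \<omega> in M. \<omega> \<in> cylinder []"
    using start AE_space by eventually_elim (auto simp: cylinder_def)
  then show ?thesis by (simp add: prob_eq_1)
qed

text \<open>If the cylinder of \<open>l\<close> is null, so is the smaller cylinder of
  \<open>v # l\<close>; otherwise the cylinder of \<open>l\<close> is an admissible conditioning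
  event for \<open>conditional_step\<close>.\<close>

lemma prob_cylinder_Cons:
  "prob (cylinder (v # l)) = prob (cylinder l) * pmf (pmf_of_set (moves l)) v"
proof (cases "prob (cylinder l) = 0")
  case True
  have "cylinder (v # l) \<subseteq> cylinder l"
    by (auto simp: cylinder_def)
  then have "prob (cylinder (v # l)) \<le> prob (cylinder l)"
    by (intro finite_measure_mono) auto
  with True show ?thesis using measure_nonneg[of M "cylinder (v # l)"] by simp
next
  case False
  let ?t = "length l"
  have pos: "\<P>(\<omega> in M. \<forall>s\<le>?t. W s \<omega> = path_of l s) > 0"
    using False zero_less_measure_iff unfolding cylinder_eq by blast
  have "{\<omega> \<in> space M. W (Suc ?t) \<omega> - W ?t \<omega> = v \<and> (\<forall>s\<le>?t. W s \<omega> = path_of l s)} = cylinder (v # l)"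
    unfolding path_of_iff_history cylinder_def by auto
  with conditional_step[OF pos, of v]
  have "prob (cylinder (v # l)) / prob (cylinder l) = pmf (step_law (path_of l) ?t) v"
    by (simp add: cond_prob_def cylinder_eq)
  also have "step_law (path_of l) ?t = pmf_of_set (moves l)"
    by (simp add: step_law_def first_visit_path_of moves_def)
  finally show ?thesis using False by (simp add: field_simps)
qed

text \<open>Optional stopping on entering \<open>E\<close>. The induction runs over the number
  \<open>d\<close> of steps still allowed, with the cylinder of an arbitrary valid history as
  starting point; the bound is uniform in \<open>d\<close>, so \<open>d\<close> can tend to
  infinity.\<close>

lemma supermartingale_hitting_bound:
  assumes nonneg: "\<And>l. valid l \<Longrightarrow> 0 \<le> f l"
    and super: "\<And>l. valid l \<Longrightarrow> (\<Sum>v\<in>moves l. f (v # l)) / card (moves l) \<le> f l"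
    and hit: "\<And>l. valid l \<Longrightarrow> l \<in> E \<Longrightarrow> 1 \<le> f l"
  shows "prob {\<omega> \<in> space M. W 0 \<omega> = 0 \<and> (\<exists>t. history W t \<omega> \<in> E)} \<le> f []"
proof -
  define D where "D d l = {\<omega> \<in> cylinder l. \<exists>i\<le>d. history W (length l + i) \<omega> \<in> E}" for d l
  have D_sets [measurable]: "D d l \<in> sets M" for d l
  proof -
    have "D d l = {\<omega> \<in> space M. \<omega> \<in> cylinder l \<and> (\<exists>i\<le>d. history W (length l + i) \<omega> \<in> E)}"
      by (auto simp: D_def cylinder_def)
    also have "\<dots> \<in> sets M" by measurable
    finally show ?thesis .
  qed
  have D_sub: "D d l \<subseteq> cylinder l" for d l by (auto simp: D_def)
  have main: "prob (D d l) \<le> prob (cylinder l) * f l" if "valid l" for d l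
    using that
  proof (induction d arbitrary: l)
    case 0
    show ?case
    proof (cases "l \<in> E")
      case True
      have "prob (D 0 l) \<le> prob (cylinder l) * 1"
        using D_sub by (auto intro!: finite_measure_mono)
      also have "\<dots> \<le> prob (cylinder l) * f l"
        using hit[OF 0 True] by (intro mult_left_mono) auto
      finally show ?thesis .
    next
      case False
      then have "D 0 l = {}" by (auto simp: D_def cylinder_def)
      then show ?thesis using nonneg[OF 0] by simp
    qed
  next
    case (Suc d)
    show ?case
    proof (cases "l \<in> E")
      case True
      have "prob (D (Suc d) l) \<le> prob (cylinder l) * 1"
        using D_sub by (auto intro!: finite_measure_mono)
      also have "\<dots> \<le> prob (cylinder l) * f l"
        using hit[OF Suc.prems True] by (intro mult_left_mono) auto
      finally show ?thesis .
    next
      case False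
      let ?U = "\<Union>v\<in>moves l. cylinder (v # l)"
      have U_sets [measurable]: "?U \<in> sets M" by (intro sets.finite_UN) auto
      have "?U \<subseteq> cylinder l" by (auto simp: cylinder_def)
      have "prob ?U = (\<Sum>v\<in>moves l. prob (cylinder (v # l)))"
      proof (rule finite_measure_finite_Union)
        show "disjoint_family_on (\<lambda>v. cylinder (v # l)) (moves l)"
          by (auto simp: disjoint_family_on_def cylinder_def)
      qed auto
      also have "\<dots> = prob (cylinder l) * (\<Sum>v\<in>moves l. pmf (pmf_of_set (moves l)) v)"
        by (simp add: prob_cylinder_Cons sum_distrib_left)
      also have "(\<Sum>v\<in>moves l. pmf (pmf_of_set (moves l)) v) = 1"
        by (simp add: sum_pmf_eq_1)
      \<comment> \<open>Increments outside \<open>moves l\<close> have total conditional probability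
        zero, so this part of the cylinder can be discarded.\<close>
      finally have "prob (cylinder l - ?U) = 0"
        using finite_measure_Diff[of "cylinder l" ?U] \<open>?U \<subseteq> cylinder l\<close> by simp
      have "D (Suc d) l \<subseteq> (cylinder l - ?U) \<union> (\<Union>v\<in>moves l. D d (v # l))"
      proof
        fix \<omega> assume w: "\<omega> \<in> D (Suc d) l"
        then obtain i where i: "i \<le> Suc d" "history W (length l + i) \<omega> \<in> E"
          and c: "\<omega> \<in> cylinder l" by (auto simp: D_def)
        have "i \<noteq> 0" using i False c by (auto simp: cylinder_def intro: ccontr)
        then obtain i' where i': "i = Suc i'" by (cases i) auto
        show "\<omega> \<in> (cylinder l - ?U) \<union> (\<Union>v\<in>moves l. D d (v # l))"
        proof (cases "\<omega> \<in> ?U")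
          case True
          then obtain v where "v \<in> moves l" "\<omega> \<in> cylinder (v # l)" by blast
          then have "\<omega> \<in> D d (v # l)" using i i' by (auto simp: D_def)
          then show ?thesis using \<open>v \<in> moves l\<close> by blast
        qed (use c in auto)
      qed
      then have "prob (D (Suc d) l) \<le> prob ((cylinder l - ?U) \<union> (\<Union>v\<in>moves l. D d (v # l)))"
        by (intro finite_measure_mono) auto
      also have "\<dots> \<le> prob (cylinder l - ?U) + prob (\<Union>v\<in>moves l. D d (v # l))"
        by (intro measure_Un_le) auto
      also have "\<dots> \<le> 0 + (\<Sum>v\<in>moves l. prob (D d (v # l)))"
        using \<open>prob (cylinder l - ?U) = 0\<close> by (intro add_mono measure_UNION_le) auto
      also have "\<dots> \<le> (\<Sum>v\<in>moves l. prob (cylinder (v # l)) * f (v # l))"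
        using Suc by (auto intro!: sum_mono)
      also have "\<dots> = prob (cylinder l) * ((\<Sum>v\<in>moves l. f (v # l)) / card (moves l))"
        by (auto simp: prob_cylinder_Cons sum_distrib_left sum_divide_distrib intro!: sum.cong)
      also have "\<dots> \<le> prob (cylinder l) * f l"
        using super[OF Suc.prems] by (intro mult_left_mono) auto
      finally show ?thesis .
    qed
  qed
  have eq: "{\<omega> \<in> space M. W 0 \<omega> = 0 \<and> (\<exists>t. history W t \<omega> \<in> E)} = (\<Union>d. D d [])"
    by (auto simp: D_def cylinder_def)
  have "incseq (\<lambda>d. D d [])"
    unfolding incseq_def D_def by (blast intro: order_trans)
  then have "(\<lambda>d. prob (D d [])) \<longlonglongrightarrow> prob (\<Union>d. D d [])"
    by (intro finite_Lim_measure_incseq) auto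
  moreover have "prob (D d []) \<le> f []" for d
    using main[of "[]" d] prob_cylinder_Nil by simp
  ultimately show ?thesis unfolding eq by (intro LIMSEQ_le_const2) auto
qed

end

section \<open>Planar simple random walk\<close>

definition walks :: "nat \<Rightarrow> site list set" where
  "walks n = {s. set s \<subseteq> horizontal_steps \<and> length s = n}"

text \<open>The expectation for planar simple random walk of \<open>n\<close> steps, written as a
  finite average over equally likely step sequences.\<close>

definition mean :: "nat \<Rightarrow> (site list \<Rightarrow> real) \<Rightarrow> real" where
  "mean n f = (\<Sum>s\<in>walks n. f s) / 4 ^ n"

abbreviation loc :: "site list \<Rightarrow> nat \<Rightarrow> site" where
  "loc s t \<equiv> sum_list (take t s)"

lemma finite_horizontal_steps [simp]: "finite horizontal_steps"
  by (simp add: horizontal_steps_def)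

lemma card_horizontal_steps [simp]: "card horizontal_steps = 4"
  by (simp add: horizontal_steps_def)

lemma finite_walks [simp]: "finite (walks n)"
  unfolding walks_def by (rule finite_lists_length_eq) simp

lemma card_walks: "card (walks n) = 4 ^ n"
  unfolding walks_def by (subst card_lists_length_eq) auto

lemma walks_0 [simp]: "walks 0 = {[]}"
  by (auto simp: walks_def)

lemma length_walks: "s \<in> walks n \<Longrightarrow> length s = n"
  by (simp add: walks_def)

lemma walks_Suc: "walks (Suc n) = (\<lambda>(d, s). d # s) ` (horizontal_steps \<times> walks n)"
  by (force simp: walks_def length_Suc_conv)

lemma walks_append: "u \<in> walks m \<Longrightarrow> w \<in> walks n \<Longrightarrow> u @ w \<in> walks (m + n)"
  by (auto simp: walks_def)

lemma mean_0 [simp]: "mean 0 f = f []"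
  by (simp add: mean_def)

lemma mean_Suc: "mean (Suc n) f = (\<Sum>d\<in>horizontal_steps. mean n (\<lambda>s. f (d # s))) / 4"
proof -
  have inj: "inj_on (\<lambda>(d, s). d # s) (horizontal_steps \<times> walks n)"
    by (auto simp: inj_on_def)
  have "(\<Sum>s\<in>walks (Suc n). f s) = (\<Sum>d\<in>horizontal_steps. \<Sum>s\<in>walks n. f (d # s))"
    unfolding walks_Suc sum.cartesian_product
    by (subst sum.reindex[OF inj]) (auto intro!: sum.cong)
  then show ?thesis by (simp add: mean_def sum_divide_distrib mult.commute)
qed

lemma mean_append: "mean (m + n) f = mean m (\<lambda>u. mean n (\<lambda>w. f (u @ w)))"
  by (induction m arbitrary: f) (simp_all add: mean_Suc)

lemma mean_split: "m \<le> n \<Longrightarrow> mean n f = mean m (\<lambda>u. mean (n - m) (\<lambda>w. f (u @ w)))"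
  using mean_append[of m "n - m" f] by simp

lemma mean_mono: "(\<And>s. s \<in> walks n \<Longrightarrow> f s \<le> g s) \<Longrightarrow> mean n f \<le> mean n g"
  unfolding mean_def by (intro divide_right_mono sum_mono) auto

lemma mean_cong: "(\<And>s. s \<in> walks n \<Longrightarrow> f s = g s) \<Longrightarrow> mean n f = mean n g"
  unfolding mean_def by (auto intro!: sum.cong)

lemma mean_nonneg: "(\<And>s. s \<in> walks n \<Longrightarrow> 0 \<le> f s) \<Longrightarrow> 0 \<le> mean n f"
  unfolding mean_def by (intro divide_nonneg_nonneg sum_nonneg) auto

lemma mean_add: "mean n (\<lambda>s. f s + g s) = mean n f + mean n g"
  by (simp add: mean_def sum.distrib add_divide_distrib)

lemma mean_sum: "mean n (\<lambda>s. \<Sum>i\<in>I. f i s) = (\<Sum>i\<in>I. mean n (f i))"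
  unfolding mean_def by (subst sum.swap) (simp add: sum_divide_distrib)

lemma mean_cmult: "mean n (\<lambda>s. c * f s) = c * mean n f"
  by (simp add: mean_def sum_distrib_left)

lemma mean_multc: "mean n (\<lambda>s. f s * c) = mean n f * c"
  by (simp add: mean_def sum_distrib_right)

lemma mean_const [simp]: "mean n (\<lambda>s. c) = c"
  by (simp add: mean_def card_walks)

lemma mean_le_1: "(\<And>s. s \<in> walks n \<Longrightarrow> f s \<le> 1) \<Longrightarrow> mean n f \<le> 1"
  using mean_mono[of n f "\<lambda>_. 1"] by simp

lemma mean_take: "m \<le> n \<Longrightarrow> mean n (\<lambda>s. f (take m s)) = mean m f"
  by (subst mean_split[of m]) (auto intro!: mean_cong simp: length_walks)

lemma mean_prefix:
  assumes "m \<le> n" "\<And>s. s \<in> walks n \<Longrightarrow> g s = f (take m s)"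
  shows "mean n g = mean m f"
  using assms mean_take[of m n f] by (metis (no_types, lifting) mean_cong)

text \<open>Time reversal: reversing permutes the equally likely step sequences.\<close>

lemma mean_rev: "mean n (\<lambda>s. f (rev s)) = mean n f"
proof -
  have "rev ` walks n = walks n"
  proof
    show "walks n \<subseteq> rev ` walks n"
    proof
      fix s assume "s \<in> walks n"
      then have "rev s \<in> walks n" by (simp add: walks_def)
      then show "s \<in> rev ` walks n" by (metis image_eqI rev_rev_ident)
    qed
  qed (auto simp: walks_def)
  then have "(\<Sum>s\<in>walks n. f (rev s)) = (\<Sum>s\<in>walks n. f s)"
    using sum.reindex[of rev "walks n" f] by (simp add: o_def inj_on_def)
  then show ?thesis by (simp add: mean_def)
qed

text \<open>The Markov property at time \<open>m\<close>: a bound for the continuation after each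
  \<open>u\<close>, of the form \<open>g u\<close> times a constant, comes out of the average over
  \<open>u\<close>.\<close>

lemma mean_split_le:
  assumes "m \<le> n" "\<And>u. u \<in> walks m \<Longrightarrow> mean (n - m) (\<lambda>w. f (u @ w)) \<le> g u * c"
  shows "mean n f \<le> mean m g * c"
proof -
  have "mean n f \<le> mean m (\<lambda>u. g u * c)"
    unfolding mean_split[OF assms(1)] by (intro mean_mono assms(2))
  then show ?thesis by (simp add: mean_multc)
qed

lemma mean_split_eq:
  assumes "m \<le> n"
    "\<And>u w. u \<in> walks m \<Longrightarrow> w \<in> walks (n - m) \<Longrightarrow> f (u @ w) = g u * h w"
  shows "mean n f = mean m g * mean (n - m) h"
proof -
  have "mean n f = mean m (\<lambda>u. mean (n - m) (\<lambda>w. g u * h w))"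
    unfolding mean_split[OF assms(1)] by (intro mean_cong assms(2))
  then show ?thesis by (simp add: mean_cmult mean_multc)
qed

lemma loc_rev: "t \<le> length s \<Longrightarrow> loc (rev s) t = sum_list s - loc s (length s - t)"
proof -
  assume "t \<le> length s"
  have "sum_list s = loc s (length s - t) + sum_list (drop (length s - t) s)"
    by (metis append_take_drop_id sum_list_append)
  moreover have "loc (rev s) t = sum_list (drop (length s - t) s)"
    by (simp add: take_rev sum_list_rev)
  ultimately show ?thesis by simp
qed

section \<open>Point probabilities of the planar walk through one-dimensional walks\<close>

fun line_prob :: "nat \<Rightarrow> int \<Rightarrow> real" where
  "line_prob 0 u = of_bool (u = 0)"
| "line_prob (Suc n) u = (line_prob n (u - 1) + line_prob n (u + 1)) / 2"

text \<open>The coordinates \<open>a + b\<close> and \<open>a - b\<close> of the planar walk are independent simple walks.\<close>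

lemma point_prob_eq:
  "mean n (\<lambda>s. of_bool (sum_list s = (a, b, c))) = of_bool (c = 0) * line_prob n (a + b) * line_prob n (a - b)"
proof (induction n arbitrary: a b c)
  case 0
  have "((0::site) = (a, b, c)) \<longleftrightarrow> c = 0 \<and> a + b = 0 \<and> a - b = 0"
    by (auto simp: zero_prod_def)
  then show ?case by auto
next
  case (Suc n)
  have shift: "(d + sum_list s = (a, b, c)) \<longleftrightarrow> sum_list s = (a, b, c) - d" for d and s :: "site list"
    by (auto simp: algebra_simps)
  show ?case
    unfolding mean_Suc sum_list.Cons shift
    by (simp add: horizontal_steps_def Suc) (simp add: algebra_simps add_divide_distrib)
qed

lemma line_prob_outside: "int n < \<bar>u\<bar> \<Longrightarrow> line_prob n u = 0"
  by (induction n arbitrary: u) auto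

lemma line_prob_parity: "odd (int n + u) \<Longrightarrow> line_prob n u = 0"
  by (induction n arbitrary: u) auto

lemma line_prob_binomial: "line_prob n (2 * int k - int n) = (n choose k) / 2 ^ n"
proof (induction n arbitrary: k)
  case (Suc n)
  show ?case
  proof (cases k)
    case 0
    have "line_prob n (- int n - 2) = 0" by (rule line_prob_outside) auto
    moreover have "line_prob n (- int n) = 1 / 2 ^ n" using Suc[of 0] by simp
    ultimately show ?thesis using 0 by (simp add: algebra_simps)
  next
    case (Suc k')
    have "2 * int k - int (Suc n) - 1 = 2 * int k' - int n"
      "2 * int k - int (Suc n) + 1 = 2 * int (Suc k') - int n"
      using Suc by auto
    then show ?thesis
      using Suc.IH[of k'] Suc.IH[of "Suc k'"] Suc
      by (simp only: line_prob.simps binomial_Suc_Suc of_nat_add power_Suc) (simp add: field_simps)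
  qed
qed (auto)

text \<open>The probability that a one-dimensional simple walk is back at its start at time
  \<open>2 * m\<close>.\<close>

definition central :: "nat \<Rightarrow> real" where
  "central m = (2 * m choose m) / 4 ^ m"

lemma central_Suc: "central (Suc m) = central m * (2 * m + 1) / (2 * m + 2)"
proof -
  have 1: "real (2 * m choose m) = fact (2 * m) / (fact m * fact m)" for m
    by (subst binomial_fact) (auto simp: mult_2)
  have 3: "fact (2 * Suc m) = (2 * real m + 2) * (2 * real m + 1) * fact (2 * m)"
    using fact_Suc[of "Suc (2 * m)", where 'a = real] fact_Suc[of "2 * m", where 'a = real]
    by (simp add: add.commute)
  have 4: "fact (Suc m) = (real m + 1) * fact m"
    by simp
  have "(2 * real m + 2) * (2 * real m + 1) * F / ((real m + 1) * f * ((real m + 1) * f)) / (4 * P) =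
      F / (f * f) / P * (2 * real m + 1) / (2 * real m + 2)" if "f > 0" "P > 0" for F f P :: real
    using that by (simp add: divide_simps) (simp add: algebra_simps)
  from this[of "fact m" "4 ^ m" "fact (2 * m)"] show ?thesis
    unfolding central_def 1 3 4 by (simp add: add.commute)
qed

text \<open>The induction step along \<open>central_Suc\<close> is the inequality
  \<open>(2 * m + 1) * (2 * m + 3) \<le> (2 * m + 2)\<^sup>2\<close>.\<close>

lemma central_upper: "(central m)\<^sup>2 \<le> 1 / (2 * real m + 1)"
proof (induction m)
  case (Suc m)
  have "(central (Suc m))\<^sup>2 = (central m)\<^sup>2 * ((2 * real m + 1) / (2 * real m + 2))\<^sup>2"
    by (simp add: central_Suc power_mult_distrib power_divide add.commute)
  also have "\<dots> \<le> 1 / (2 * real m + 1) * ((2 * real m + 1) / (2 * real m + 2))\<^sup>2"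
    by (intro mult_right_mono Suc.IH) auto
  also have "\<dots> \<le> 1 / (2 * real (Suc m) + 1)"
    by (simp add: divide_simps power2_eq_square) (simp add: algebra_simps)
  finally show ?case .
qed (simp add: central_def)

text \<open>The induction step amounts to
  \<open>4 * (m + 1) * (m + 2) \<le> (2 * m + 3)\<^sup>2\<close>.\<close>

lemma central_lower: "1 / (4 * Suc m) \<le> (central (Suc m))\<^sup>2"
proof (induction m)
  case (Suc m)
  have "1 / (4 * Suc (Suc m)) \<le> 1 / (4 * Suc m) * ((2 * Suc m + 1) / (2 * Suc m + 2))\<^sup>2"
    by (simp add: divide_simps power2_eq_square) (simp add: algebra_simps)
  also have "\<dots> \<le> (central (Suc m))\<^sup>2 * ((2 * Suc m + 1) / (2 * Suc m + 2))\<^sup>2"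
    by (intro mult_right_mono Suc) auto
  also have "\<dots> = (central (Suc (Suc m)))\<^sup>2"
    unfolding central_Suc[of "Suc m"] by (simp add: power_mult_distrib power_divide)
  finally show ?case .
qed (simp add: central_def power2_eq_square)

lemma line_prob_nonneg: "0 \<le> line_prob n u"
  by (induction n arbitrary: u) auto

lemma line_prob_upper: "(line_prob n u)\<^sup>2 \<le> 1 / (real n + 1)"
proof (cases "even (int n + u) \<and> \<bar>u\<bar> \<le> int n")
  case False
  then have "line_prob n u = 0" using line_prob_outside line_prob_parity by (metis not_le)
  then show ?thesis by simp
next
  case True
  define k where "k = nat ((u + int n) div 2)"
  have k: "u = 2 * int k - int n" unfolding k_def using True by auto
  have "line_prob n u = (n choose k) / 2 ^ n" unfolding k line_prob_binomial ..
  also have "\<dots> \<le> (n choose (n div 2)) / 2 ^ n"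
    by (intro divide_right_mono) (auto simp: binomial_maximum)
  also have "\<dots> \<le> central ((n + 1) div 2)"
  proof (cases "even n")
    case True
    then obtain m where "n = 2 * m" by auto
    then show ?thesis by (simp add: central_def power_mult)
  next
    case False
    then obtain m where m: "n = 2 * m + 1" by (elim oddE)
    \<comment> \<open>An odd time is compared with the next even one, whose central coefficient is
      exactly twice as large, as is the power of 2 below it.\<close>
    have "(2 * Suc m choose Suc m) = 2 * (n choose (n div 2))"
      using central_binomial_odd[of n] False by (simp add: m)
    then show ?thesis by (simp add: central_def m power_mult)
  qed
  finally have "(line_prob n u)\<^sup>2 \<le> (central ((n + 1) div 2))\<^sup>2"
    using line_prob_nonneg by (intro power_mono)
  also have "\<dots> \<le> 1 / (2 * real ((n + 1) div 2) + 1)"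
    by (rule central_upper)
  also have "\<dots> \<le> 1 / (real n + 1)"
  proof -
    have "n \<le> 2 * ((n + 1) div 2)" by auto
    then have "real n \<le> 2 * real ((n + 1) div 2)" by linarith
    then show ?thesis by (intro divide_left_mono) auto
  qed
  finally show ?thesis .
qed

text \<open>The product from \<open>point_prob_eq\<close> is at most the mean of the two squares,
  and each square is bounded by \<open>line_prob_upper\<close>.\<close>

lemma point_prob_le: "mean n (\<lambda>s. of_bool (sum_list s = x)) \<le> 1 / (real n + 1)"
proof -
  obtain a b c where x: "x = (a, b, c)" by (cases x)
  have "mean n (\<lambda>s. of_bool (sum_list s = x)) \<le> line_prob n (a + b) * line_prob n (a - b)"
    unfolding x point_prob_eq using line_prob_nonneg by auto
  also have "\<dots> \<le> ((line_prob n (a + b))\<^sup>2 + (line_prob n (a - b))\<^sup>2) / 2"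
    using sum_squares_bound[of "line_prob n (a + b)" "line_prob n (a - b)"] by simp
  also have "\<dots> \<le> (1 / (real n + 1) + 1 / (real n + 1)) / 2"
    using line_prob_upper[of n "a + b"] line_prob_upper[of n "a - b"] by (intro divide_right_mono add_mono) auto
  also have "(1 / (real n + 1) + 1 / (real n + 1)) / 2 = 1 / (real n + 1)" by (simp add: divide_simps)
  finally show ?thesis .
qed

lemma return_prob_ge: "1 / (4 * Suc m) \<le> mean (2 * Suc m) (\<lambda>s. of_bool (sum_list s = 0))"
proof -
  have "line_prob (2 * Suc m) 0 = central (Suc m)"
    using line_prob_binomial[of "2 * Suc m" "Suc m"]
    by (simp only: central_def power_mult) (simp del: line_prob.simps binomial_Suc_Suc)
  then show ?thesis
    unfolding zero_prod_def point_prob_eq using central_lower[of m] by (simp del: line_prob.simps add: power2_eq_square)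
qed

text \<open>The expected number of visits to the origin up to time \<open>m\<close>, the truncated
  Green function at the origin.\<close>

definition green :: "nat \<Rightarrow> real" where
  "green m = (\<Sum>t\<le>m. mean t (\<lambda>s. of_bool (sum_list s = 0)))"

lemma harmonic_dyadic_ge: "real b / 2 \<le> (\<Sum>i\<in>{1..2 ^ b}. 1 / real i)"
proof (induction b)
  case (Suc b)
  have "{1..2 ^ Suc b} = {1..2 ^ b} \<union> {2 ^ b + 1..2 ^ Suc b :: nat}" by auto
  then have "(\<Sum>i\<in>{1..2 ^ Suc b}. 1 / real i) =
      (\<Sum>i\<in>{1..2 ^ b}. 1 / real i) + (\<Sum>i\<in>{2 ^ b + 1..2 ^ Suc b}. 1 / real i)"
    by (simp only:) (rule sum.union_disjoint, auto)
  moreover have "(\<Sum>i\<in>{2 ^ b + 1..2 ^ Suc b :: nat}. 1 / real (2 ^ Suc b)) \<le> (\<Sum>i\<in>{2 ^ b + 1..2 ^ Suc b}. 1 / real i)"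
    by (intro sum_mono divide_left_mono) (auto simp del: of_nat_power)
  moreover have "(\<Sum>i\<in>{2 ^ b + 1..2 ^ Suc b :: nat}. 1 / real (2 ^ Suc b)) = 1 / 2"
    by (simp add: field_simps)
  ultimately show ?case using Suc by simp
qed simp

lemma sum_inverse_dyadic_le: "i \<le> l \<Longrightarrow> (\<Sum>t\<in>{2 ^ i..<2 ^ l}. 1 / (real t + 1)) \<le> real l - real i"
proof (induction l rule: dec_induct)
  case (step l)
  have "{2 ^ i..<2 ^ Suc l} = {2 ^ i..<2 ^ l} \<union> {2 ^ l..<2 ^ Suc l :: nat}"
    using step by (intro ivl_disj_un_two(3)[symmetric] power_increasing) auto
  then have "(\<Sum>t\<in>{2 ^ i..<2 ^ Suc l}. 1 / (real t + 1)) =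
      (\<Sum>t\<in>{2 ^ i..<2 ^ l}. 1 / (real t + 1)) + (\<Sum>t\<in>{2 ^ l..<2 ^ Suc l}. 1 / (real t + 1))"
    by (simp only:) (rule sum.union_disjoint, auto)
  moreover have "(\<Sum>t\<in>{2 ^ l..<2 ^ Suc l}. 1 / (real t + 1)) \<le> (\<Sum>t\<in>{2 ^ l..<2 ^ Suc l :: nat}. 1 / 2 ^ l)"
  proof (intro sum_mono divide_left_mono)
    fix t :: nat assume "t \<in> {2 ^ l..<2 ^ Suc l}"
    then have "real (2 ^ l) \<le> real t" by (simp del: of_nat_power)
    then have "(2::real) ^ l \<le> real t" by (simp only: of_nat_power of_nat_numeral)
    then show "(2::real) ^ l \<le> real t + 1" by linarith
  qed auto
  ultimately show ?case using step by simp
qed simp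

lemma sum_inverse_dyadic_le': "(\<Sum>t<2 ^ l. 1 / (real t + 1)) \<le> real l + 1"
proof -
  have "{..<2 ^ l} = insert 0 {2 ^ 0..<2 ^ l :: nat}" by (auto simp: Suc_le_eq)
  then show ?thesis using sum_inverse_dyadic_le[of 0 l] by (simp only:) simp
qed

lemma green_pos: "1 \<le> green m"
proof -
  have "(\<Sum>t\<in>{0}. mean t (\<lambda>s. of_bool (sum_list s = 0))) \<le> green m"
    unfolding green_def by (intro sum_mono2) (auto intro!: mean_nonneg)
  then show ?thesis by simp
qed

text \<open>The even times \<open>2 * i\<close> contribute at least \<open>1 / (4 * i)\<close> each,
  which is half the logarithmic growth of the harmonic sum over 4; the visit at time 0 makes up for
  the exponent lost by \<open>2 * i \<le> 2 ^ a\<close>.\<close>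

lemma green_ge: "real a / 8 \<le> green (2 ^ a)"
proof (cases a)
  case 0
  then show ?thesis using green_pos[of 1] by simp
next
  case (Suc b)
  let ?p = "\<lambda>t. mean t (\<lambda>s. of_bool (sum_list s = 0))"
  let ?h = "\<lambda>i::nat. 2 * i"
  have "real b / 2 / 4 \<le> (\<Sum>i\<in>{1..2 ^ b}. 1 / real i) / 4"
    using harmonic_dyadic_ge[of b] by simp
  also have "\<dots> = (\<Sum>i\<in>{1..2 ^ b}. 1 / (4 * real i))"
    by (simp add: sum_divide_distrib mult.commute)
  also have "\<dots> \<le> (\<Sum>i\<in>{1..2 ^ b}. ?p (2 * i))"
  proof (rule sum_mono)
    fix i :: nat assume "i \<in> {1..2 ^ b}"
    then obtain m where "i = Suc m" by (cases i) auto
    then show "1 / (4 * real i) \<le> ?p (2 * i)" using return_prob_ge[of m] by simp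
  qed
  also have "\<dots> = (\<Sum>t\<in>?h ` {1..2 ^ b}. ?p t)"
    by (subst sum.reindex) (auto simp: inj_on_def)
  finally have "real b / 8 \<le> (\<Sum>t\<in>?h ` {1..2 ^ b}. ?p t)" by simp
  moreover have "green (2 ^ a) \<ge> (\<Sum>t\<in>insert 0 (?h ` {1..2 ^ b}). ?p t)"
    unfolding green_def by (intro sum_mono2) (auto simp: Suc intro!: mean_nonneg)
  moreover have "(\<Sum>t\<in>insert 0 (?h ` {1..2 ^ b}). ?p t) = 1 + (\<Sum>t\<in>?h ` {1..2 ^ b}. ?p t)"
    by (subst sum.insert) auto
  ultimately show ?thesis using Suc by simp
qed

lemma mean_at: "t \<le> n \<Longrightarrow> mean n (\<lambda>s. f (loc s t)) = mean t (\<lambda>s. f (sum_list s))"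
  by (rule mean_prefix) auto

lemma expected_visits_eq_green: 
  "b \<le> n \<Longrightarrow> mean n (\<lambda>s. \<Sum>r\<le>b. of_bool (loc s r = 0)) = green b"
  unfolding mean_sum green_def by (intro sum.cong refl mean_at) auto

text \<open>From its first visit to \<open>y\<close> on, the walk makes on average \<open>green b\<close> visits to \<open>y\<close> within
  time \<open>b\<close>.\<close>

lemma hitting_prob_green:
  assumes "a \<le> b" "b \<le> L"
  shows "mean L (\<lambda>s. of_bool (\<exists>t\<in>{a..b}. loc s t = y)) * green b \<le> (\<Sum>t\<in>{a..2 * b}. 1 / (real t + 1))"
proof -
  define first where "first i s \<longleftrightarrow> loc s i = y \<and> (\<forall>t\<in>{a..<i}. loc s t \<noteq> y)" for i and s :: "site list"
  define vis where "vis s = (\<Sum>t\<in>{a..2 * b}. of_bool (loc s t = y) :: real)" for s :: "site list"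
  have hit_eq: "of_bool (\<exists>t\<in>{a..b}. loc s t = y) = (\<Sum>i\<in>{a..b}. of_bool (first i s) :: real)" for s
  proof (cases "\<exists>t\<in>{a..b}. loc s t = y")
    case True
    define i where "i = (LEAST t. t \<in> {a..b} \<and> loc s t = y)"
    have i: "i \<in> {a..b} \<and> loc s i = y"
      unfolding i_def by (rule LeastI_ex) (use True in blast)
    have min: "i \<le> t" if "t \<in> {a..b}" "loc s t = y" for t
      unfolding i_def using that by (intro Least_le) auto
    have "first j s \<longleftrightarrow> j = i" if "j \<in> {a..b}" for j
    proof
      assume "first j s"
      then have "i \<le> j" "\<not> i < j" using min[of j] that i by (auto simp: first_def)
      then show "j = i" by simp
    next
      assume "j = i"
      have "loc s t \<noteq> y" if "t \<in> {a..<i}" for t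
        using that min[of t] i by (auto simp: not_le[symmetric])
      then show "first j s" using i \<open>j = i\<close> by (auto simp: first_def)
    qed
    then have "(\<Sum>j\<in>{a..b}. of_bool (first j s) :: real) = (\<Sum>j\<in>{a..b}. of_bool (j = i))"
      by (intro sum.cong) auto
    also have "\<dots> = 1" using i by (simp add: of_bool_def)
    finally show ?thesis using True by simp
  next
    case False
    then have "(\<Sum>i\<in>{a..b}. of_bool (first i s) :: real) = 0"
      by (intro sum.neutral) (auto simp: first_def)
    then show ?thesis using False by simp
  qed
  have step: "mean (2 * b) (\<lambda>s. of_bool (first i s)) * green b
      \<le> mean (2 * b) (\<lambda>s. of_bool (first i s) * vis s)" if i: "i \<in> {a..b}" for i
  proof -
    have "mean (2 * b) (\<lambda>s. of_bool (first i s)) = mean i (\<lambda>u. of_bool (first i u))"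
      by (rule mean_prefix) (use i in \<open>auto simp: first_def min_def\<close>)
    moreover have "mean (2 * b - i) (\<lambda>w. \<Sum>r\<le>b. of_bool (loc w r = 0)) = green b"
      using i by (intro expected_visits_eq_green) auto
    moreover have "mean (2 * b) (\<lambda>s. of_bool (first i s) * (\<Sum>r\<le>b. of_bool (loc (drop i s) r = 0))) =
        mean i (\<lambda>u. of_bool (first i u)) * mean (2 * b - i) (\<lambda>w. \<Sum>r\<le>b. of_bool (loc w r = 0))"
      by (rule mean_split_eq) (use i in \<open>auto simp: first_def length_walks\<close>)
    moreover have "mean (2 * b) (\<lambda>s. of_bool (first i s) * (\<Sum>r\<le>b. of_bool (loc (drop i s) r = 0)))
        \<le> mean (2 * b) (\<lambda>s. of_bool (first i s) * vis s)"
    proof (rule mean_mono)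
      fix s assume "s \<in> walks (2 * b)"
      have "(\<Sum>r\<le>b. of_bool (loc (drop i s) r = 0)) \<le> vis s" if f: "first i s"
      proof -
        have "loc s (i + r) = y \<longleftrightarrow> loc (drop i s) r = 0" for r
          using f by (simp add: first_def take_add)
        then have "(\<Sum>r\<le>b. of_bool (loc (drop i s) r = 0)) = (\<Sum>r\<le>b. of_bool (loc s (i + r) = y) :: real)"
          by simp
        also have "\<dots> = (\<Sum>t\<in>(\<lambda>r. i + r) ` {..b}. of_bool (loc s t = y))"
          by (subst sum.reindex) auto
        also have "\<dots> \<le> vis s"
          unfolding vis_def using i by (intro sum_mono2) auto
        finally show ?thesis .
      qed
      then show "of_bool (first i s) * (\<Sum>r\<le>b. of_bool (loc (drop i s) r = 0)) \<le> of_bool (first i s) * vis s"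
        by (auto simp: of_bool_def)
    qed
    ultimately show ?thesis by simp
  qed
  \<comment> \<open>The event depends only on the first \<open>b\<close> steps, so the length may be
    taken as \<open>2 * b\<close>; after a first visit by time \<open>b\<close> there are then
    \<open>b\<close> more steps in which to count returns.\<close>
  have "mean L (\<lambda>s. of_bool (\<exists>t\<in>{a..b}. loc s t = y)) = mean (2 * b) (\<lambda>s. of_bool (\<exists>t\<in>{a..b}. loc s t = y))"
  proof -
    have eq: "(\<exists>t\<in>{a..b}. loc (take b s) t = y) \<longleftrightarrow> (\<exists>t\<in>{a..b}. loc s t = y)" for s
      by (auto simp: min_def)
    have "mean n (\<lambda>s. of_bool (\<exists>t\<in>{a..b}. loc s t = y)) = mean b (\<lambda>s. of_bool (\<exists>t\<in>{a..b}. loc s t = y))"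
      if "b \<le> n" for n
      using that by (intro mean_prefix) (simp_all add: eq)
    from this[of L] this[of "2 * b"] show ?thesis using assms by simp
  qed
  also have "\<dots> * green b = (\<Sum>i\<in>{a..b}. mean (2 * b) (\<lambda>s. of_bool (first i s)) * green b)"
    unfolding hit_eq mean_sum sum_distrib_right ..
  also have "\<dots> \<le> (\<Sum>i\<in>{a..b}. mean (2 * b) (\<lambda>s. of_bool (first i s) * vis s))"
    by (intro sum_mono step)
  also have "\<dots> = mean (2 * b) (\<lambda>s. of_bool (\<exists>t\<in>{a..b}. loc s t = y) * vis s)"
    unfolding hit_eq mean_sum[symmetric] sum_distrib_right ..
  also have "\<dots> \<le> mean (2 * b) vis"
    by (intro mean_mono) (auto simp: vis_def intro!: sum_nonneg)
  also have "\<dots> = (\<Sum>t\<in>{a..2 * b}. mean (2 * b) (\<lambda>s. of_bool (loc s t = y)))"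
    unfolding vis_def mean_sum ..
  also have "\<dots> \<le> (\<Sum>t\<in>{a..2 * b}. 1 / (real t + 1))"
  proof (rule sum_mono)
    fix t assume "t \<in> {a..2 * b}"
    then show "mean (2 * b) (\<lambda>s. of_bool (loc s t = y)) \<le> 1 / (real t + 1)"
      using point_prob_le[of t y] by (subst mean_at[where f = "\<lambda>z. of_bool (z = y)"]) auto
  qed
  finally show ?thesis .
qed

text \<open>\<open>green (2 ^ l)\<close> is at least \<open>l / 8\<close>, while the expected number
  of visits in the time interval is at most \<open>l + 2 - i\<close>. Hence an interval that is
  short on the logarithmic scale rarely contains a visit to a given site.\<close>

lemma hitting_prob_dyadic:
  assumes "2 ^ i \<le> a" "b \<le> 2 ^ l" "b \<le> L" "i \<le> l" "0 < l"
  shows "mean L (\<lambda>s. of_bool (\<exists>t\<in>{a..b}. loc s t = y)) \<le> 8 * (real l + 2 - real i) / l"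
proof -
  let ?L = "max L (2 ^ l)"
  have "mean L (\<lambda>s. of_bool (\<exists>t\<in>{a..b}. loc s t = y)) = mean ?L (\<lambda>s. of_bool (\<exists>t\<in>{a..b}. loc s t = y))"
    using assms by (intro mean_prefix[symmetric]) (auto simp: min_def)
  also have "\<dots> \<le> mean ?L (\<lambda>s. of_bool (\<exists>t\<in>{2 ^ i..2 ^ l}. loc s t = y))"
    using assms by (intro mean_mono) (force simp: of_bool_def)
  also have "\<dots> \<le> 8 * (real l + 2 - real i) / l"
  proof -
    let ?m = "mean ?L (\<lambda>s. of_bool (\<exists>t\<in>{2 ^ i..2 ^ l}. loc s t = y))"
    have "?m * (l / 8) \<le> ?m * green (2 ^ l)"
      using green_ge[of l] by (intro mult_left_mono mean_nonneg) auto
    also have "\<dots> \<le> (\<Sum>t\<in>{2 ^ i..2 * 2 ^ l}. 1 / (real t + 1))"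
      using assms by (intro hitting_prob_green) (auto intro: power_increasing)
    also have "\<dots> \<le> (\<Sum>t\<in>{2 ^ i..<2 ^ (l + 2)}. 1 / (real t + 1))"
    proof (intro sum_mono2)
      have "x < 2 ^ (l + 2)" if "x \<le> 2 * 2 ^ l" for x :: nat
      proof -
        have "(0::nat) < 2 ^ l" by simp
        then show ?thesis using that unfolding power_add power2_eq_square by linarith
      qed
      then show "{2 ^ i..2 * 2 ^ l} \<subseteq> {2 ^ i..<2 ^ (l + 2) :: nat}" by auto
    qed auto
    also have "\<dots> \<le> real l + 2 - real i"
      using sum_inverse_dyadic_le[of i "l + 2"] assms by simp
    finally show ?thesis using assms by (simp add: field_simps)
  qed
  finally show ?thesis .
qed

text \<open>Decomposition at a visit to the origin that is followed by \<open>m\<close> steps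
  without return: two such visits cannot both occur by time \<open>m\<close>, and the Markov
  property factorises the probability of each.\<close>

lemma no_return_green:
  "mean m (\<lambda>s. of_bool (\<forall>u\<in>{1..m}. loc s u \<noteq> 0)) * green m \<le> 1"
proof -
  define last where "last t s \<longleftrightarrow> loc s t = 0 \<and> (\<forall>u\<in>{1..m}. loc s (t + u) \<noteq> 0)" for t and s :: "site list"
  have one: "mean (2 * m) (\<lambda>s. of_bool (last t s)) =
      mean t (\<lambda>s. of_bool (sum_list s = 0)) * mean m (\<lambda>s. of_bool (\<forall>u\<in>{1..m}. loc s u \<noteq> 0))"
    if t: "t \<le> m" for t
  proof -
    have "mean (2 * m) (\<lambda>s. of_bool (last t s)) =
      mean t (\<lambda>s. of_bool (sum_list s = 0)) * mean (2 * m - t) (\<lambda>s. of_bool (\<forall>u\<in>{1..m}. loc s u \<noteq> 0))"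
      by (rule mean_split_eq) (use t in \<open>auto simp: last_def length_walks\<close>)
    also have "mean (2 * m - t) (\<lambda>s. of_bool (\<forall>u\<in>{1..m}. loc s u \<noteq> 0)) = mean m (\<lambda>s. of_bool (\<forall>u\<in>{1..m}. loc s u \<noteq> 0))"
      by (rule mean_prefix) (use t in \<open>auto simp: min_def\<close>)
    finally show ?thesis .
  qed
  have "mean m (\<lambda>s. of_bool (\<forall>u\<in>{1..m}. loc s u \<noteq> 0)) * green m = (\<Sum>t\<le>m. mean (2 * m) (\<lambda>s. of_bool (last t s)))"
    unfolding green_def sum_distrib_left by (intro sum.cong refl) (subst one, auto)
  also have "\<dots> = mean (2 * m) (\<lambda>s. \<Sum>t\<le>m. of_bool (last t s))"
    unfolding mean_sum ..
  also have "\<dots> \<le> 1"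
  proof (rule mean_le_1)
    fix s
    have uniq: "t = t'" if "t \<le> m" "t' \<le> m" "last t s" "last t' s" for t t'
    proof -
      have False if "t < t'" "t' \<le> m" "last t s" "last t' s" for t t'
      proof -
        have "t' - t \<in> {1..m}" "t + (t' - t) = t'" using that by auto
        then show False using that unfolding last_def by metis
      qed
      with that show ?thesis by (metis linorder_neqE_nat)
    qed
    have "(\<Sum>t\<le>m. of_bool (last t s) :: real) = card {t. t \<le> m \<and> last t s}"
      by (simp add: of_bool_def sum.If_cases Int_def)
    also have "card {t. t \<le> m \<and> last t s} \<le> 1"
      using uniq by (subst card_le_Suc0_iff_eq[unfolded One_nat_def[symmetric]]) auto
    finally show "(\<Sum>t\<le>m. of_bool (last t s) :: real) \<le> 1" by simp
  qed
  finally show ?thesis .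
qed

text \<open>Read backwards in time, a walk that ends at a new site is a walk that never returns to
  its start, so \<open>no_return_green\<close> applies.\<close>

lemma new_site_prob_le:
  assumes "0 < i"
  shows "mean (2 ^ i) (\<lambda>s. of_bool (\<forall>t<2 ^ i. loc s t \<noteq> sum_list s)) \<le> 8 / i"
proof -
  let ?m = "2 ^ i :: nat"
  have "mean ?m (\<lambda>s. of_bool (\<forall>t<?m. loc s t \<noteq> sum_list s)) = mean ?m (\<lambda>s. of_bool (\<forall>t<?m. loc (rev s) t \<noteq> sum_list (rev s)))"
    by (subst mean_rev[symmetric]) simp
  also have "\<dots> = mean ?m (\<lambda>s. of_bool (\<forall>u\<in>{1..?m}. loc s u \<noteq> 0))"
  proof (rule mean_cong)
    fix s assume s: "s \<in> walks ?m"
    have "(\<forall>t<?m. loc (rev s) t \<noteq> sum_list (rev s)) \<longleftrightarrow> (\<forall>t<?m. loc s (?m - t) \<noteq> 0)"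
      using length_walks[OF s] by (auto simp: loc_rev sum_list_rev)
    also have "\<dots> \<longleftrightarrow> (\<forall>u\<in>{1..?m}. loc s u \<noteq> 0)"
    proof
      assume *: "\<forall>t<?m. loc s (?m - t) \<noteq> 0"
      show "\<forall>u\<in>{1..?m}. loc s u \<noteq> 0"
      proof
        fix u assume "u \<in> {1..?m}"
        then show "loc s u \<noteq> 0" using *[rule_format, of "?m - u"] by auto
      qed
    qed auto
    finally show "of_bool (\<forall>t<?m. loc (rev s) t \<noteq> sum_list (rev s)) = (of_bool (\<forall>u\<in>{1..?m}. loc s u \<noteq> 0) :: real)"
      by simp
  qed
  also have "\<dots> \<le> 8 / i"
  proof -
    let ?x = "mean ?m (\<lambda>s. of_bool (\<forall>u\<in>{1..?m}. loc s u \<noteq> 0))"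
    have "?x * (i / 8) \<le> ?x * green ?m"
      using green_ge[of i] by (intro mult_left_mono mean_nonneg) auto
    also have "\<dots> \<le> 1" by (rule no_return_green)
    finally show ?thesis using assms by (simp add: field_simps)
  qed
  finally show ?thesis .
qed

text \<open>A bridge of length \<open>N\<close> to \<open>x\<close> meets \<open>y\<close> either in its first half, or, read backwards, in the
  first half of the reversed bridge.\<close>

lemma bridge_hitting_prob:
  assumes "0 < i" "2 ^ i \<le> g" "N \<le> 2 ^ l" "i \<le> l"
  shows "mean N (\<lambda>s. of_bool ((\<exists>t\<in>{g..N - g}. loc s t = y) \<and> sum_list s = x))
    \<le> 32 * (real l + 2 - real i) / (real l * (real N + 1))"
proof -
  define c where "c = 8 * (real l + 2 - real i) / l"
  \<comment> \<open>At least about half of the \<open>N\<close> steps come after time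
    \<open>b\<close>; that they lead to \<open>x\<close> costs \<open>2 / (real N + 1)\<close>
    wherever the walk stands at time \<open>b\<close>.\<close>
  have half: "mean N (\<lambda>s. of_bool ((\<exists>t\<in>{g..b}. loc s t = y) \<and> sum_list s = x)) \<le> c * (2 / (real N + 1))"
    if b: "b \<le> N" "N \<le> 2 * (N - b) + 1" for b x y
  proof -
    have "mean N (\<lambda>s. of_bool ((\<exists>t\<in>{g..b}. loc s t = y) \<and> sum_list s = x))
      \<le> mean b (\<lambda>s. of_bool (\<exists>t\<in>{g..b}. loc s t = y)) * (2 / (real N + 1))"
    proof (rule mean_split_le[OF b(1)])
      fix u assume u: "u \<in> walks b"
      have "mean (N - b) (\<lambda>w. of_bool ((\<exists>t\<in>{g..b}. loc (u @ w) t = y) \<and> sum_list (u @ w) = x))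
        = mean (N - b) (\<lambda>w. of_bool (\<exists>t\<in>{g..b}. loc u t = y) * of_bool (sum_list w = x - sum_list u))"
        using length_walks[OF u] by (intro mean_cong) (auto simp: of_bool_def algebra_simps)
      also have "\<dots> = of_bool (\<exists>t\<in>{g..b}. loc u t = y) * mean (N - b) (\<lambda>w. of_bool (sum_list w = x - sum_list u))"
        by (rule mean_cmult)
      also have "\<dots> \<le> of_bool (\<exists>t\<in>{g..b}. loc u t = y) * (2 / (real N + 1))"
      proof (rule mult_left_mono)
        have "real N \<le> 2 * real (N - b) + 1" using b by linarith
        then have "1 / (real (N - b) + 1) \<le> 2 / (real N + 1)" by (simp add: field_simps)
        with point_prob_le[of "N - b" "x - sum_list u"]
        show "mean (N - b) (\<lambda>w. of_bool (sum_list w = x - sum_list u)) \<le> 2 / (real N + 1)" by simp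
      qed auto
      finally show "mean (N - b) (\<lambda>w. of_bool ((\<exists>t\<in>{g..b}. loc (u @ w) t = y) \<and> sum_list (u @ w) = x)) \<le> \<dots>" .
    qed
    also have "\<dots> \<le> c * (2 / (real N + 1))"
      unfolding c_def using assms b by (intro mult_right_mono hitting_prob_dyadic) auto
    finally show ?thesis .
  qed
  define M where "M = N div 2"
  have "mean N (\<lambda>s. of_bool ((\<exists>t\<in>{g..N - g}. loc s t = y) \<and> sum_list s = x)) \<le>
     mean N (\<lambda>s. of_bool ((\<exists>t\<in>{g..M}. loc s t = y) \<and> sum_list s = x) +
       of_bool ((\<exists>t\<in>{g..M}. loc (rev s) t = x - y) \<and> sum_list (rev s) = x))"
  proof (rule mean_mono)
    fix s assume s: "s \<in> walks N"
    have "(\<exists>t\<in>{g..M}. loc s t = y) \<or> (\<exists>t\<in>{g..M}. loc (rev s) t = x - y)"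
      if t: "t \<in> {g..N - g}" "loc s t = y" "sum_list s = x" for t
    proof (cases "t \<le> M")
      case False
      then have "N - t \<in> {g..M}" "t \<le> N" using t unfolding M_def by auto
      moreover from this have "loc (rev s) (N - t) = x - y"
        using t length_walks[OF s] by (simp add: loc_rev)
      ultimately show ?thesis by blast
    qed (use t in auto)
    then have "(\<exists>t\<in>{g..N - g}. loc s t = y) \<and> sum_list s = x \<Longrightarrow>
      (\<exists>t\<in>{g..M}. loc s t = y) \<and> sum_list s = x \<or>
      (\<exists>t\<in>{g..M}. loc (rev s) t = x - y) \<and> sum_list (rev s) = x"
      unfolding sum_list_rev by blast
    then show "of_bool ((\<exists>t\<in>{g..N - g}. loc s t = y) \<and> sum_list s = x) \<le>
      (of_bool ((\<exists>t\<in>{g..M}. loc s t = y) \<and> sum_list s = x) +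
       of_bool ((\<exists>t\<in>{g..M}. loc (rev s) t = x - y) \<and> sum_list (rev s) = x) :: real)"
      unfolding of_bool_def by (smt (verit))
  qed
  also have "\<dots> = mean N (\<lambda>s. of_bool ((\<exists>t\<in>{g..M}. loc s t = y) \<and> sum_list s = x)) +
      mean N (\<lambda>s. of_bool ((\<exists>t\<in>{g..M}. loc s t = x - y) \<and> sum_list s = x))"
    unfolding mean_add
    using mean_rev[of N "\<lambda>s. of_bool ((\<exists>t\<in>{g..M}. loc s t = x - y) \<and> sum_list s = x)"] by simp
  also have "\<dots> \<le> c * (2 / (real N + 1)) + c * (2 / (real N + 1))"
    by (intro add_mono half) (auto simp: M_def)
  also have "\<dots> = 32 * (real l + 2 - real i) / (real l * (real N + 1))"
    by (simp add: c_def field_simps)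
  finally show ?thesis .
qed

text \<open>Cauchy-Schwarz bounds the number of pairs of equal positions from below by the squared length
  divided by the number of distinct sites.\<close>

lemma few_distinct_sites_prob:
  fixes \<Delta> :: nat
  assumes "len \<le> 2 ^ k" "0 < \<Delta>" "len \<le> L"
  shows "mean L (\<lambda>s. of_bool (\<Delta> * card (loc s ` {..<len}) < len)) \<le> 2 * (real k + 1) / \<Delta>"
proof -
  define pairs where "pairs s = (\<Sum>i<len. \<Sum>j<len. of_bool (loc s i = loc s j) :: real)" for s :: "site list"
  have far: "mean L (\<lambda>s. of_bool (loc s i = loc s j)) \<le> 1 / (real (j - i) + 1)" if "i \<le> j" "j < len" for i j
  proof -
    have "mean L (\<lambda>s. of_bool (loc s i = loc s j)) \<le> mean i (\<lambda>u. 1) * (1 / (real (j - i) + 1))"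
    proof (rule mean_split_le)
      fix u assume u: "u \<in> walks i"
      have "mean (L - i) (\<lambda>w. of_bool (loc (u @ w) i = loc (u @ w) j)) = mean (L - i) (\<lambda>w. of_bool (loc w (j - i) = 0))"
        using length_walks[OF u] that by (intro mean_cong) (auto simp: of_bool_def)
      also have "\<dots> = mean (j - i) (\<lambda>w. of_bool (sum_list w = 0))"
        using that assms by (intro mean_at[where f = "\<lambda>z. of_bool (z = 0)"]) auto
      also have "\<dots> \<le> 1 / (real (j - i) + 1)" by (rule point_prob_le)
      finally show "mean (L - i) (\<lambda>w. of_bool (loc (u @ w) i = loc (u @ w) j)) \<le> 1 * (1 / (real (j - i) + 1))" by simp
    qed (use that assms in auto)
    then show ?thesis by simp
  qed
  have row: "(\<Sum>j<len. mean L (\<lambda>s. of_bool (loc s i = loc s j))) \<le> 2 * (real k + 1)" if i: "i < len" for i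
  proof -
    have "(\<Sum>j<len. mean L (\<lambda>s. of_bool (loc s i = loc s j))) \<le>
       (\<Sum>j\<in>{i..<len}. 1 / (real (j - i) + 1)) + (\<Sum>j<i. 1 / (real (i - j) + 1))"
    proof -
      have split: "{..<len} = {i..<len} \<union> {..<i}" using i by auto
      have "(\<Sum>j<len. mean L (\<lambda>s. of_bool (loc s i = loc s j))) =
        (\<Sum>j\<in>{i..<len}. mean L (\<lambda>s. of_bool (loc s i = loc s j))) + (\<Sum>j<i. mean L (\<lambda>s. of_bool (loc s i = loc s j)))"
        by (subst split, rule sum.union_disjoint) auto
      moreover have "(\<Sum>j\<in>{i..<len}. mean L (\<lambda>s. of_bool (loc s i = loc s j))) \<le> (\<Sum>j\<in>{i..<len}. 1 / (real (j - i) + 1))"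
        by (intro sum_mono far) auto
      moreover have "(\<Sum>j<i. mean L (\<lambda>s. of_bool (loc s i = loc s j))) \<le> (\<Sum>j<i. 1 / (real (i - j) + 1))"
      proof (rule sum_mono)
        fix j assume "j \<in> {..<i}"
        then show "mean L (\<lambda>s. of_bool (loc s i = loc s j)) \<le> 1 / (real (i - j) + 1)"
          using far[of j i] i by (simp add: eq_commute)
      qed
      ultimately show ?thesis by linarith
    qed
    moreover have "(\<Sum>j\<in>{i..<len}. 1 / (real (j - i) + 1)) \<le> real k + 1"
    proof -
      have "(\<Sum>j\<in>{i..<len}. 1 / (real (j - i) + 1)) = (\<Sum>t<len - i. 1 / (real t + 1))"
        by (rule sum.reindex_bij_witness[where i = "\<lambda>t. t + i" and j = "\<lambda>j. j - i"]) auto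
      also have "\<dots> \<le> (\<Sum>t<2 ^ k. 1 / (real t + 1))"
        using assms by (intro sum_mono2) auto
      also have "\<dots> \<le> real k + 1" by (rule sum_inverse_dyadic_le')
      finally show ?thesis .
    qed
    moreover have "(\<Sum>j<i. 1 / (real (i - j) + 1)) \<le> real k + 1"
    proof -
      have "(\<Sum>j<i. 1 / (real (i - j) + 1)) = (\<Sum>t\<in>{1..i}. 1 / (real t + 1))"
        by (rule sum.reindex_bij_witness[where i = "\<lambda>t. i - t" and j = "\<lambda>j. i - j"]) auto
      also have "\<dots> \<le> (\<Sum>t<2 ^ k. 1 / (real t + 1))"
        using assms i by (intro sum_mono2) auto
      also have "\<dots> \<le> real k + 1" by (rule sum_inverse_dyadic_le')
      finally show ?thesis .
    qed
    ultimately show ?thesis by simp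
  qed
  have "mean L pairs = (\<Sum>i<len. \<Sum>j<len. mean L (\<lambda>s. of_bool (loc s i = loc s j)))"
    unfolding pairs_def mean_sum ..
  also have "\<dots> \<le> (\<Sum>i<len. 2 * (real k + 1))"
    by (intro sum_mono row) auto
  finally have mean_pairs: "mean L pairs \<le> len * (2 * (real k + 1))" by simp
  have cs: "(real len)\<^sup>2 \<le> card (loc s ` {..<len}) * pairs s" for s
  proof -
    let ?A = "loc s ` {..<len}"
    define c where "c y = (\<Sum>i<len. of_bool (loc s i = y) :: real)" for y
    have "(\<Sum>y\<in>?A. c y) = (\<Sum>i<len. \<Sum>y\<in>?A. of_bool (loc s i = y))"
      unfolding c_def by (rule sum.swap)
    also have "\<dots> = (\<Sum>i<len. 1)"
      by (intro sum.cong refl) (auto simp: of_bool_def)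
    finally have sum_c: "(\<Sum>y\<in>?A. c y) = len" by simp
    have "(\<Sum>y\<in>?A. (c y)\<^sup>2) = (\<Sum>y\<in>?A. \<Sum>i<len. \<Sum>j<len. of_bool (loc s i = y) * of_bool (loc s j = y))"
      unfolding c_def power2_eq_square sum_product ..
    also have "\<dots> = (\<Sum>i<len. \<Sum>j<len. \<Sum>y\<in>?A. of_bool (loc s i = y) * of_bool (loc s j = y))"
      by (subst sum.swap) (intro sum.cong refl sum.swap)
    also have "\<dots> = pairs s"
      unfolding pairs_def
    proof (intro sum.cong refl)
      fix i j assume "i \<in> {..<len}" "j \<in> {..<len}"
      have "(\<Sum>y\<in>?A. of_bool (loc s i = y) * of_bool (loc s j = y)) = (\<Sum>y\<in>?A. if y = loc s i then of_bool (loc s i = loc s j) else 0 :: real)"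
        by (intro sum.cong) (auto simp: of_bool_def)
      also have "\<dots> = of_bool (loc s i = loc s j)"
        using \<open>i \<in> _\<close> by (subst sum.delta) auto
      finally show "(\<Sum>y\<in>?A. of_bool (loc s i = y) * of_bool (loc s j = y)) = (of_bool (loc s i = loc s j) :: real)" .
    qed
    finally have "(\<Sum>y\<in>?A. (c y)\<^sup>2) = pairs s" .
    moreover have "(\<Sum>y\<in>?A. 1 * c y)\<^sup>2 \<le> (\<Sum>y\<in>?A. 1\<^sup>2) * (\<Sum>y\<in>?A. (c y)\<^sup>2)"
      by (rule Cauchy_Schwarz_ineq_sum)
    ultimately show ?thesis using sum_c by simp
  qed
  show ?thesis
  proof (cases "len = 0")
    case True
    then show ?thesis using assms by simp
  next
    case False
    \<comment> \<open>Markov's inequality: by \<open>cs\<close>, fewer than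
      \<open>len / \<Delta>\<close> distinct sites force \<open>pairs s\<close> to be at least
      \<open>\<Delta> * len\<close>.\<close>
    have "mean L (\<lambda>s. of_bool (\<Delta> * card (loc s ` {..<len}) < len)) \<le> mean L (\<lambda>s. pairs s * (1 / (\<Delta> * len)))"
    proof (rule mean_mono)
      fix s
      have p0: "0 \<le> pairs s" unfolding pairs_def by (intro sum_nonneg) auto
      show "of_bool (\<Delta> * card (loc s ` {..<len}) < len) \<le> pairs s * (1 / (\<Delta> * len))"
      proof (cases "\<Delta> * card (loc s ` {..<len}) < len")
        case True
        have "\<Delta> * (real len)\<^sup>2 \<le> \<Delta> * card (loc s ` {..<len}) * pairs s"
          using cs[of s] assms by (simp add: mult.assoc)
        also have "\<dots> \<le> len * pairs s"
          using True p0 by (intro mult_right_mono) (auto simp flip: of_nat_mult)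
        finally have "\<Delta> * len \<le> pairs s" using False by (simp add: power2_eq_square algebra_simps)
        then show ?thesis using assms False True by (simp add: field_simps)
      qed (use p0 assms in auto)
    qed
    also have "\<dots> \<le> len * (2 * (real k + 1)) * (1 / (\<Delta> * len))"
      unfolding mean_multc using mean_pairs assms by (intro mult_right_mono) auto
    also have "\<dots> = 2 * (real k + 1) / \<Delta>"
      using False by simp
    finally show ?thesis .
  qed
qed

section \<open>The height given the horizontal steps\<close>

text \<open>Oldest step first, opposite to the order of a history, so that the result can be
  compared with a prefix of a walk in \<open>walks\<close>.\<close>

fun horizontals :: "site list \<Rightarrow> site list" where
  "horizontals [] = []"
| "horizontals (m # l) = (if fresh l then horizontals l else horizontals l @ [m])"

definition hclock :: "site list \<Rightarrow> nat" where
  "hclock l = length (horizontals l)"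

text \<open>Steps of a valid history are vertical exactly when made from a fresh vertex, so this
  says that the last step was vertical.\<close>

fun run :: "site list \<Rightarrow> bool" where
  "run [] \<longleftrightarrow> False"
| "run (m # l) \<longleftrightarrow> fresh l"

definition height :: "site \<Rightarrow> int" where
  "height x = snd (snd x)"

definition column :: "site \<Rightarrow> site" where
  "column x = (fst x, fst (snd x), 0)"

lemma column_add: "column (x + y) = column x + column y"
  by (simp add: column_def)

lemma hclock_Nil [simp]: "hclock [] = 0"
  by (simp add: hclock_def)

lemma hclock_Cons [simp]: "hclock (m # l) = (if fresh l then hclock l else Suc (hclock l))"
  by (simp add: hclock_def)

lemma horizontals_in_walks: "valid l \<Longrightarrow> horizontals l \<in> walks (hclock l)"
  by (induction l) (auto simp: walks_def moves_def hclock_def)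

lemma column_sum_list: "valid l \<Longrightarrow> column (sum_list l) = sum_list (horizontals l)"
proof (induction l)
  case (Cons m l)
  then show ?case
    by (auto simp: column_add moves_def vertical_steps_def horizontal_steps_def add.commute)
      (auto simp: column_def zero_prod_def)
qed (simp add: column_def zero_prod_def)

lemma column_visited: "valid l \<Longrightarrow> y \<in> visited l \<Longrightarrow> column y \<in> loc (horizontals l) ` {..hclock l}"
proof (induction l)
  case (Cons m l)
  have "column (sum_list l) \<in> loc (horizontals l) ` {..hclock l}"
    using Cons by (intro image_eqI[of _ _ "hclock l"]) (auto simp: column_sum_list hclock_def)
  then have "column y \<in> loc (horizontals l) ` {..hclock l}"
    using Cons by auto
  then obtain i where i: "i \<le> hclock l" "column y = loc (horizontals l) i" by auto
  then have "column y = loc (horizontals (m # l)) i" by (simp add: hclock_def)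
  moreover have "i \<le> hclock (m # l)" using i by simp
  ultimately show ?case by blast
qed simp

text \<open>All \<open>N\<close> horizontal steps are drawn in advance as \<open>s\<close>, and the
  walk reads off the next one when it needs it. Thus \<open>v s\<close> may depend on the future of
  \<open>s\<close>; averaging it over the unread part of \<open>s\<close> gives a supermartingale on
  histories.\<close>

lemma (in self_interacting_walk) annealed_hitting_bound:
  assumes nonneg: "\<And>s l. s \<in> walks N \<Longrightarrow> valid l \<Longrightarrow> hclock l \<le> N \<Longrightarrow> take (hclock l) s = horizontals l \<Longrightarrow> 0 \<le> v s l"
    and horizontal: "\<And>s l. s \<in> walks N \<Longrightarrow> valid l \<Longrightarrow> \<not> fresh l \<Longrightarrow> hclock l < N \<Longrightarrow> take (hclock l) s = horizontals l \<Longrightarrow>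
      v s (s ! hclock l # l) \<le> v s l"
    and vertical: "\<And>s l. s \<in> walks N \<Longrightarrow> valid l \<Longrightarrow> fresh l \<Longrightarrow> hclock l \<le> N \<Longrightarrow> take (hclock l) s = horizontals l \<Longrightarrow>
      (v s ((0, 0, 1) # l) + v s ((0, 0, -1) # l)) / 2 \<le> v s l"
    and hit: "\<And>s l. s \<in> walks N \<Longrightarrow> valid l \<Longrightarrow> take (hclock l) s = horizontals l \<Longrightarrow> l \<in> E \<Longrightarrow> 1 \<le> v s l"
    and E: "\<And>l. l \<in> E \<Longrightarrow> hclock l \<le> N"
  shows "prob {\<omega> \<in> space M. W 0 \<omega> = 0 \<and> (\<exists>t. history W t \<omega> \<in> E)} \<le> mean N (\<lambda>s. v s [])"
proof -
  \<comment> \<open>The value 0 beyond horizontal time \<open>N\<close> is compatible with hitting,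
    since every history in \<open>E\<close> has its clock at most \<open>N\<close>.\<close>
  define f where "f l = (if hclock l \<le> N then mean (N - hclock l) (\<lambda>w. v (horizontals l @ w) l) else 0)" for l
  have ext: "horizontals l @ w \<in> walks N" "take (hclock l) (horizontals l @ w) = horizontals l" if "valid l" "hclock l \<le> N" "w \<in> walks (N - hclock l)" for l w
    using walks_append[OF horizontals_in_walks[OF that(1)] that(3)] that by (simp_all add: hclock_def)
  have "prob {\<omega> \<in> space M. W 0 \<omega> = 0 \<and> (\<exists>t. history W t \<omega> \<in> E)} \<le> f []"
  proof (rule supermartingale_hitting_bound)
    fix l assume l: "valid l"
    show "0 \<le> f l"
      unfolding f_def using l ext by (auto intro!: mean_nonneg nonneg)
    show "(\<Sum>v\<in>moves l. f (v # l)) / card (moves l) \<le> f l"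
    proof (cases "fresh l")
      case True
      then have "(\<Sum>v\<in>moves l. f (v # l)) / card (moves l) = (f ((0, 0, 1) # l) + f ((0, 0, -1) # l)) / 2"
        by (simp add: moves_def vertical_steps_def)
      also have "\<dots> \<le> f l"
      proof (cases "hclock l \<le> N")
        case hN: True
        have "(f ((0, 0, 1) # l) + f ((0, 0, -1) # l)) / 2 =
           mean (N - hclock l) (\<lambda>w. (1 / 2) * (v (horizontals l @ w) ((0, 0, 1) # l) + v (horizontals l @ w) ((0, 0, -1) # l)))"
          unfolding mean_cmult mean_add using True hN by (simp add: f_def)
        also have "\<dots> \<le> mean (N - hclock l) (\<lambda>w. v (horizontals l @ w) l)"
          using vertical[OF ext(1)[OF l hN] l True hN ext(2)[OF l hN]] by (intro mean_mono) simp
        finally show ?thesis using hN by (simp add: f_def)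
      qed (use True in \<open>simp add: f_def\<close>)
      finally show ?thesis .
    next
      case False
      then have "(\<Sum>v\<in>moves l. f (v # l)) / card (moves l) = (\<Sum>d\<in>horizontal_steps. f (d # l)) / 4"
        by (simp add: moves_def)
      also have "\<dots> \<le> f l"
      proof (cases "hclock l < N")
        case hN: True
        then obtain n where n: "N - hclock l = Suc n" "N - Suc (hclock l) = n" by (metis Suc_diff_Suc)
        have "(\<Sum>d\<in>horizontal_steps. f (d # l)) / 4 = 
          (\<Sum>d\<in>horizontal_steps. mean n (\<lambda>w. v (horizontals l @ d # w) (d # l))) / 4"
          using False hN n by (simp add: f_def)
        also have "\<dots> \<le> (\<Sum>d\<in>horizontal_steps. mean n (\<lambda>w. v (horizontals l @ d # w) l)) / 4"
        proof (intro divide_right_mono sum_mono mean_mono)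
          fix d w assume d: "d \<in> horizontal_steps" "w \<in> walks n"
          then have "d # w \<in> walks (N - hclock l)" unfolding n by (simp add: walks_def)
          note e = ext[OF l less_imp_le[OF hN] this]
          show "v (horizontals l @ d # w) (d # l) \<le> v (horizontals l @ d # w) l"
            using horizontal[OF e(1) l False hN e(2)] by (simp add: hclock_def)
        qed auto
        \<comment> \<open>A uniform next step followed by \<open>n\<close> uniform ones is a uniform
          walk of \<open>Suc n\<close> steps.\<close>
        also have "\<dots> = f l"
          using hN n by (simp add: f_def mean_Suc)
        finally show ?thesis .
      next
        case True: False
        have "f (d # l) = 0" for d using True False by (simp add: f_def)
        moreover have "0 \<le> f l" unfolding f_def using l ext by (auto intro!: mean_nonneg nonneg)
        ultimately show ?thesis by simp
      qed
      finally show ?thesis .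
    qed
    assume lE: "l \<in> E"
    have "mean (N - hclock l) (\<lambda>w. 1) \<le> mean (N - hclock l) (\<lambda>w. v (horizontals l @ w) l)"
      using ext[OF l E[OF lE]] l lE by (intro mean_mono hit) auto
    then show "1 \<le> f l" using E[OF lE] by (simp add: f_def)
  qed
  also have "f [] = mean N (\<lambda>s. v s [])" by (simp add: f_def)
  finally show ?thesis .
qed

section \<open>Vertical steps forced by new columns\<close>

fun vsteps :: "nat \<Rightarrow> nat \<Rightarrow> site list \<Rightarrow> nat" where
  "vsteps a b [] = 0"
| "vsteps a b (m # l) = vsteps a b l + (if fresh l \<and> a \<le> hclock l \<and> hclock l \<le> b then 1 else 0)"

definition new_sites :: "site list \<Rightarrow> nat \<Rightarrow> nat \<Rightarrow> nat set" where
  "new_sites s a b = {i \<in> {a..b}. loc s i \<notin> loc s ` {..<i}}"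

lemma vsteps_0: "hclock l < a \<Longrightarrow> vsteps a b l = 0"
  by (induction l) (auto split: if_splits)

lemma loc_take_eq: "take (hclock l) s = horizontals l \<Longrightarrow> i \<le> hclock l \<Longrightarrow> loc s i = loc (horizontals l) i"
  by (metis min.absorb1 take_take)

lemma take_hclock_Cons: "take (hclock (m # l)) s = horizontals (m # l) \<Longrightarrow> take (hclock l) s = horizontals l"
proof -
  assume *: "take (hclock (m # l)) s = horizontals (m # l)"
  have "take (hclock l) s = take (hclock l) (take (hclock (m # l)) s)" by simp
  also have "\<dots> = horizontals l" unfolding * by (simp add: hclock_def)
  finally show ?thesis .
qed

text \<open>Visited vertices lie over points already seen by the planar walk, so a vertex in a new
  column is new. Since a horizontal step is nonzero, the endpoint of \<open>l\<close> cannot be the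
  exception.\<close>

lemma fresh_at_new_column:
  assumes "valid (m # l)" "\<not> fresh l" "take (hclock (m # l)) s = horizontals (m # l)"
    "loc s (Suc (hclock l)) \<notin> loc s ` {..<Suc (hclock l)}"
  shows "fresh (m # l)"
proof (rule ccontr)
  assume "\<not> fresh (m # l)"
  then have "sum_list (m # l) \<in> visited (m # l)" by (simp add: fresh_def)
  moreover have "m \<noteq> 0"
    using assms by (auto simp: moves_def horizontal_steps_def zero_prod_def)
  ultimately have "sum_list (m # l) \<in> visited l" by auto
  then have "column (sum_list (m # l)) \<in> loc (horizontals l) ` {..hclock l}"
    using column_visited[of l] assms by auto
  moreover have "loc (horizontals l) ` {..hclock l} = loc s ` {..<Suc (hclock l)}"
    unfolding lessThan_Suc_atMost using loc_take_eq[OF take_hclock_Cons[OF assms(3)]] by auto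
  moreover have "column (sum_list (m # l)) = loc s (Suc (hclock l))"
  proof -
    have "column (sum_list (m # l)) = sum_list (horizontals (m # l))"
      by (rule column_sum_list[OF assms(1)])
    also have "\<dots> = loc s (Suc (hclock l))"
      using assms(2) unfolding assms(3)[symmetric] by simp
    finally show ?thesis .
  qed
  ultimately show False using assms(4) by simp
qed

text \<open>Each entry into a new column is charged to the vertical step that follows it. The last
  summand is for a column just entered whose vertical step is still to come; it vanishes as soon as
  \<open>l\<close> is not fresh.\<close>

lemma card_new_sites_le_vsteps_aux:
  assumes "valid l" "take (hclock l) s = horizontals l"
  shows "card (new_sites s a (min (hclock l) b)) \<le> 
    vsteps a b l + (if fresh l \<and> \<not> run l \<and> a \<le> hclock l \<and> hclock l \<le> b then 1 else 0)"
  using assms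
proof (induction l)
  case Nil
  have "new_sites s a (min 0 b) \<subseteq> (if a = 0 then {0} else {})"
    by (auto simp: new_sites_def)
  then have "card (new_sites s a (min 0 b)) \<le> card (if a = 0 then {0::nat} else {})"
    by (intro card_mono) auto
  then show ?case by (auto simp: fresh_def split: if_splits)
next
  case (Cons m l)
  have IH: "card (new_sites s a (min (hclock l) b)) \<le> 
    vsteps a b l + (if fresh l \<and> \<not> run l \<and> a \<le> hclock l \<and> hclock l \<le> b then 1 else 0)"
    using Cons take_hclock_Cons by simp
  show ?case
  proof (cases "fresh l")
    case True
    then show ?thesis using IH by (auto split: if_splits)
  next
    case False
    let ?h = "Suc (hclock l)"
    show ?thesis
    proof (cases "?h \<in> new_sites s a b")
      case True
      then have "fresh (m # l)"
        using fresh_at_new_column[OF Cons.prems(1) False Cons.prems(2)] by (simp add: new_sites_def)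
      have "new_sites s a (min ?h b) \<subseteq> insert ?h (new_sites s a (min (hclock l) b))"
        by (auto simp: new_sites_def le_Suc_eq)
      then have "card (new_sites s a (min ?h b)) \<le> card (insert ?h (new_sites s a (min (hclock l) b)))"
        by (intro card_mono) (auto simp: new_sites_def)
      also have "\<dots> \<le> Suc (card (new_sites s a (min (hclock l) b)))"
        by (rule card_insert_le_m1) auto
      finally have "card (new_sites s a (min ?h b)) \<le> Suc (card (new_sites s a (min (hclock l) b)))" .
      moreover have "a \<le> ?h" "?h \<le> b" using True by (auto simp: new_sites_def)
      ultimately show ?thesis
        using IH \<open>fresh (m # l)\<close> False by simp
    next
      case notin: False
      have "new_sites s a (min ?h b) \<subseteq> new_sites s a (min (hclock l) b)"
        using notin by (auto simp: new_sites_def le_Suc_eq)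
      then have "card (new_sites s a (min ?h b)) \<le> card (new_sites s a (min (hclock l) b))"
        by (intro card_mono) (auto simp: new_sites_def)
      then show ?thesis using IH False by auto
    qed
  qed
qed

lemma card_new_sites_le_vsteps:
  assumes "valid l" "take (hclock l) s = horizontals l" "\<not> fresh l" "hclock l = b"
  shows "card (new_sites s a b) \<le> vsteps a b l"
  using card_new_sites_le_vsteps_aux[OF assms(1,2), of a b] assms by simp

text \<open>An upper bound for the expected number of vertical steps left in the current run. With a
  vertical step behind it, \<open>2 = 1 + 2 / 2\<close> allows for a continuation with probability
  one half; at the start of a run there is one step more.\<close>

definition bonus :: "site list \<Rightarrow> real" where
  "bonus l = (if fresh l then if run l then 2 else 3 else 0)"

lemma bonus_bounds: "0 \<le> bonus l" "bonus l \<le> 3"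
  by (auto simp: bonus_def)

text \<open>Two vertical steps in a row end at a vertex with a visited neighbour, so from there the run
  of vertical steps continues with probability at most one half.\<close>

lemma bonus_vertical:
  assumes "valid l" "fresh l"
  shows "bonus ((0, 0, 1) # l) + bonus ((0, 0, -1) # l) \<le> 2 * bonus l - 2"
proof (cases "run l")
  case False
  then show ?thesis using assms by (auto simp: bonus_def)
next
  case True
  then obtain m l0 where l: "l = m # l0" "fresh l0" by (cases l) auto
  then have "m = (0, 0, 1) \<or> m = (0, 0, -1)"
    using assms by (auto simp: moves_def vertical_steps_def)
  then have "\<not> fresh ((0, 0, -1) # l) \<or> \<not> fresh ((0, 0, 1) # l)"
  proof
    assume "m = (0, 0, 1)"
    then have "sum_list ((0, 0, -1) # l) = sum_list l0"
      unfolding l by (cases "sum_list l0") auto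
    then show ?thesis unfolding fresh_def l by simp
  next
    assume "m = (0, 0, -1)"
    then have "sum_list ((0, 0, 1) # l) = sum_list l0"
      unfolding l by (cases "sum_list l0") auto
    then show ?thesis unfolding fresh_def l by simp
  qed
  then show ?thesis using True assms by (auto simp: bonus_def)
qed

section \<open>Test functions for the height, and averages over fair unit steps\<close>

definition avg :: "(int \<Rightarrow> real) \<Rightarrow> int \<Rightarrow> real" where
  "avg f z = (f (z + 1) + f (z - 1)) / 2"

definition tent :: "nat \<Rightarrow> nat \<Rightarrow> int \<Rightarrow> real" where
  "tent r R z = min (max 0 (real_of_int (\<bar>z\<bar> - int r))) (real R)"

text \<open>For positive \<open>R\<close> this is 1 up to distance \<open>r\<close> from the target
  height and \<open>1 / 2\<close> from distance \<open>r + R\<close> on, with linear interpolation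
  between.\<close>

definition psi :: "nat \<Rightarrow> nat \<Rightarrow> int \<Rightarrow> real" where
  "psi r R z = 1 - tent r R z / (2 * real R)"

text \<open>A quadratic barrier: it equals \<open>r\<^sup>2\<close> at 0, vanishes from distance
  \<open>r\<close> on, and grows by at most 1 in mean per fair step, so that divided by
  \<open>r\<^sup>2\<close> it controls the chance of coming back to 0.\<close>

definition sq :: "nat \<Rightarrow> int \<Rightarrow> real" where
  "sq r z = (max 0 (real_of_int (int r - \<bar>z\<bar>)))\<^sup>2"

lemma sq_nonneg: "0 \<le> sq r z"
  by (simp add: sq_def)

lemma sq_vertical: "sq r (z + 1) + sq r (z - 1) \<le> 2 * sq r z + 2"
proof -
  define a where "a = int r - \<bar>z\<bar>"
  define b where "b = int r - \<bar>z + 1\<bar>"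
  define c where "c = int r - \<bar>z - 1\<bar>"
  have "(max 0 b)\<^sup>2 + (max 0 c)\<^sup>2 \<le> 2 * (max 0 a)\<^sup>2 + 2"
  proof -
    \<comment> \<open>The last alternative is \<open>z = 0\<close>, where both neighbours are
      farther away and the kink only helps.\<close>
    have "b = a + 1 \<and> c = a - 1 \<or> b = a - 1 \<and> c = a + 1 \<or> b = a - 1 \<and> c = a - 1"
      unfolding a_def b_def c_def by linarith
    note abc = this
    consider "1 \<le> a" | "a = 0" | "a \<le> -1" by linarith
    then show ?thesis
    proof cases
      case 3
      then have "max 0 a = 0" "max 0 b = 0" "max 0 c = 0" using abc by auto
      then show ?thesis by simp
    qed (use abc in \<open>auto simp: max_def power2_eq_square algebra_simps\<close>)
  qed
  then have "real_of_int ((max 0 b)\<^sup>2 + (max 0 c)\<^sup>2) \<le> real_of_int (2 * (max 0 a)\<^sup>2 + 2)"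
    by (simp only: of_int_le_iff)
  then show ?thesis
    by (simp add: sq_def a_def b_def c_def of_int_max)
qed

lemma tent_nonneg: "0 \<le> tent r R z" and tent_le: "tent r R z \<le> real R"
  by (auto simp: tent_def)

text \<open>The tent is convex in \<open>z\<close> as long as the cap at distance
  \<open>r + R\<close> is not reached.\<close>

lemma tent_vertical:
  assumes "\<bar>z\<bar> < int r + int R"
  shows "2 * tent r R z \<le> tent r R (z + 1) + tent r R (z - 1)"
proof -
  have "2 * min (max 0 (\<bar>z\<bar> - int r)) (int R) \<le> min (max 0 (\<bar>z + 1\<bar> - int r)) (int R) + min (max 0 (\<bar>z - 1\<bar> - int r)) (int R)"
    using assms by (auto simp: min_def max_def abs_if)
  then have "real_of_int (2 * min (max 0 (\<bar>z\<bar> - int r)) (int R)) \<le>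
     real_of_int (min (max 0 (\<bar>z + 1\<bar> - int r)) (int R) + min (max 0 (\<bar>z - 1\<bar> - int r)) (int R))"
    by (simp only: of_int_le_iff)
  then show ?thesis
    by (simp add: tent_def of_int_min of_int_max)
qed

lemma avg_Suc: "(avg ^^ Suc k) f z = ((avg ^^ k) f (z + 1) + (avg ^^ k) f (z - 1)) / 2"
  by (simp add: avg_def)

lemma avg_mono: "(\<And>z. f z \<le> g z) \<Longrightarrow> (avg ^^ k) f z \<le> (avg ^^ k) g z"
proof (induction k arbitrary: z)
  case (Suc k)
  then show ?case by (simp add: avg_def add_mono divide_right_mono)
qed simp

lemma avg_psi: "(avg ^^ k) (psi r R) z = 1 - (avg ^^ k) (tent r R) z / (2 * real R)"
proof (induction k arbitrary: z)
  case (Suc k)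
  show ?case unfolding avg_Suc Suc by (simp add: add_divide_distrib diff_divide_distrib)
qed (simp add: psi_def)

text \<open>The second and fourth moments of a sum of \<open>k\<close> fair signs are
  \<open>k\<close> and \<open>3 * k\<^sup>2 - 2 * k\<close>, and the odd moments vanish.\<close>

lemma avg_quartic:
  "(avg ^^ k) (\<lambda>z. A * (real_of_int z)\<^sup>2 - B * real_of_int z ^ 4 - C) z =
    A * ((real_of_int z)\<^sup>2 + k) - B * (real_of_int z ^ 4 + 6 * k * (real_of_int z)\<^sup>2 + 3 * (real k)\<^sup>2 - 2 * k) - C"
proof (induction k arbitrary: z)
  case (Suc k)
  then show ?case
    by (simp add: avg_def) (simp add: field_simps power2_eq_square power4_eq_xxxx)
qed simp

text \<open>The hypothesis is preserved by one averaging step because it is assumed for all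
  \<open>a\<close> and \<open>b\<close>. At \<open>b = 0\<close> it reduces an arbitrary start
  \<open>a\<close> to the start 0 at the cost of a factor 2.\<close>

lemma avg_symmetric:
  assumes "\<And>a b. f b \<le> f (a + b) + f (a - b)"
  shows "(avg ^^ k) f b \<le> (avg ^^ k) f (a + b) + (avg ^^ k) f (a - b)"
proof (induction k arbitrary: a b)
  case (Suc k)
  let ?F = "(avg ^^ k) f"
  have "?F (b + 1) \<le> ?F (a + (b + 1)) + ?F (a - (b + 1))"
    "?F (b - 1) \<le> ?F (a + (b - 1)) + ?F (a - (b - 1))"
    by (rule Suc)+
  then show ?case unfolding avg_Suc by (simp add: algebra_simps add_divide_distrib)
qed (use assms in simp)

lemma tent_symmetric: "tent r R b \<le> tent r R (a + b) + tent r R (a - b)"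
proof (cases "\<bar>b\<bar> \<le> \<bar>a + b\<bar>")
  case True
  then have "tent r R b \<le> tent r R (a + b)"
    unfolding tent_def by (intro min.mono max.mono) auto
  then show ?thesis using tent_nonneg[of r R "a - b"] by linarith
next
  case False
  then have "\<bar>b\<bar> \<le> \<bar>a - b\<bar>" by linarith
  then have "tent r R b \<le> tent r R (a - b)"
    unfolding tent_def by (intro min.mono max.mono) auto
  then show ?thesis using tent_nonneg[of r R "a + b"] by linarith
qed

text \<open>The quartic polynomial below lies under the tent, and its mean after \<open>64 r\<^sup>2\<close> steps is explicit.\<close>

lemma avg_tent_ge:
  assumes "0 < r" "8 * r \<le> R"
  shows "real r / 2 \<le> (avg ^^ (64 * r\<^sup>2)) (tent r R) z"
proof -
  define \<rho> where "\<rho> = real r"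
  have rho: "0 < \<rho>" "8 * \<rho> \<le> real R" using assms unfolding \<rho>_def by linarith+
  \<comment> \<open>With \<open>z = 8 * \<rho> * u\<close> the quadratic and quartic terms become
    \<open>8 * \<rho> * (u\<^sup>2 / 3 - u ^ 4 / 36)\<close>, whose maximum
    \<open>8 * \<rho>\<close> is at \<open>u\<^sup>2 = 6\<close>, within the cap \<open>R\<close>.
    After \<open>64 * \<rho>\<^sup>2\<close> steps from 0 their mean is at least
    \<open>2 * \<rho>\<close>.\<close>
  define A where "A = 1 / (24 * \<rho>)"
  define B where "B = 1 / (18432 * \<rho> ^ 3)"
  have below: "A * (real_of_int z)\<^sup>2 - B * real_of_int z ^ 4 - \<rho> \<le> tent r R z" for z
  proof -
    define u where "u = \<bar>real_of_int z\<bar> / (8 * \<rho>)"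
    have z: "\<bar>real_of_int z\<bar> = 8 * \<rho> * u" and u: "0 \<le> u" using rho by (auto simp: u_def)
    define g where "g = u\<^sup>2 / 3 - u ^ 4 / 36"
    have "(real_of_int z)\<^sup>2 = 64 * \<rho>\<^sup>2 * u\<^sup>2"
      using arg_cong[OF z, of "\<lambda>x. x\<^sup>2"] by (simp add: power_mult_distrib)
    moreover have "real_of_int z ^ 4 = 4096 * \<rho> ^ 4 * u ^ 4"
      using arg_cong[OF z, of "\<lambda>x. x ^ 4"] by (simp add: power_mult_distrib power_even_abs)
    ultimately have "A * (real_of_int z)\<^sup>2 - B * real_of_int z ^ 4 - \<rho> = 8 * \<rho> * g - \<rho>"
      using rho by (simp add: A_def B_def g_def field_simps power2_eq_square power3_eq_cube power4_eq_xxxx)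
    moreover have g1: "g \<le> 1"
      using zero_le_power2[of "u\<^sup>2 - 6"] by (simp add: g_def power2_eq_square power4_eq_xxxx algebra_simps)
    moreover have "g \<le> u"
    proof (cases "u \<le> 3")
      case True
      have "g \<le> u\<^sup>2 / 3" by (simp add: g_def)
      also have "\<dots> \<le> u" using mult_left_mono[OF True u] by (simp add: power2_eq_square)
      finally show ?thesis .
    qed (use g1 in auto)
    ultimately have "A * (real_of_int z)\<^sup>2 - B * real_of_int z ^ 4 - \<rho> \<le> 8 * \<rho> * u - \<rho>"
      "A * (real_of_int z)\<^sup>2 - B * real_of_int z ^ 4 - \<rho> \<le> 8 * \<rho> - \<rho>"
      using rho by (auto intro!: mult_left_mono)
    then show ?thesis
      using rho z unfolding tent_def by (simp add: \<rho>_def)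
  qed
  let ?k = "64 * r\<^sup>2"
  have k: "real ?k = 64 * \<rho>\<^sup>2" by (simp add: \<rho>_def)
  have "\<rho> \<le> A * real ?k - B * (3 * (real ?k)\<^sup>2 - 2 * real ?k) - \<rho>"
  proof -
    have "0 \<le> B * (2 * real ?k)" using rho by (simp add: B_def)
    moreover have "A * real ?k - B * (3 * (real ?k)\<^sup>2) = 2 * \<rho>"
      unfolding k A_def B_def using rho by (simp add: field_simps power2_eq_square power3_eq_cube)
    ultimately show ?thesis by (simp add: algebra_simps)
  qed
  also have "\<dots> = (avg ^^ ?k) (\<lambda>z. A * (real_of_int z)\<^sup>2 - B * real_of_int z ^ 4 - \<rho>) 0"
    unfolding avg_quartic by simp
  also have "\<dots> \<le> (avg ^^ ?k) (tent r R) 0"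
    by (intro avg_mono below)
  also have "\<dots> \<le> 2 * (avg ^^ ?k) (tent r R) z"
    using avg_symmetric[of "tent r R" ?k 0 z] tent_symmetric by simp
  finally show ?thesis by (simp add: \<rho>_def)
qed

section \<open>A potential built from a family of time windows\<close>

lemma add_vertical:
  fixes x y c :: real
  assumes "x1 + x2 \<le> 2 * x + 2" "y1 + y2 \<le> 2 * y - 2"
  shows "(x1 + c + y1) + (x2 + c + y2) \<le> 2 * (x + c + y)"
  using assms by (simp add: algebra_simps)

text \<open>Given the horizontal walk \<open>s\<close>, window \<open>j\<close> is the range
  \<open>a j\<close> to \<open>e j\<close> of the horizontal clock and \<open>z0\<close> is the
  target height. New columns force \<open>64 * (r j)\<^sup>2\<close> vertical steps, which spread
  the height over order \<open>r j\<close>; \<open>R j\<close> is large compared with the square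
  root of the window length. Ending the window within \<open>r j\<close> of \<open>z0\<close> costs
  a factor \<open>\<theta>\<close>.\<close>

locale windows =
  fixes s :: "site list" and z0 :: int and G :: "nat set"
    and a e r R :: "nat \<Rightarrow> nat" and n :: nat and \<theta> :: real
  assumes finite_G: "finite G"
    and a_pos: "j \<in> G \<Longrightarrow> 0 < a j" and a_le_e: "j \<in> G \<Longrightarrow> a j \<le> e j" and e_less: "j \<in> G \<Longrightarrow> e j < n"
    and disjoint: "i \<in> G \<Longrightarrow> j \<in> G \<Longrightarrow> a i \<le> h \<Longrightarrow> h \<le> e i \<Longrightarrow> a j \<le> h \<Longrightarrow> h \<le> e j \<Longrightarrow> i = j"
    and r_pos: "j \<in> G \<Longrightarrow> 0 < r j" and R_ge_r: "j \<in> G \<Longrightarrow> 8 * r j \<le> R j"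
    and R_ge: "j \<in> G \<Longrightarrow> 6 * (e j - a j + 1) \<le> (R j)\<^sup>2"
    and \<theta>_ge: "j \<in> G \<Longrightarrow> 1 - real (r j) / (4 * real (R j)) \<le> \<theta>"
    and many_new_sites: "j \<in> G \<Longrightarrow> 64 * (r j)\<^sup>2 \<le> card (new_sites s (a j) (e j))"
    and \<theta>_nonneg: "0 \<le> \<theta>"
begin

definition offset :: "site list \<Rightarrow> int" where
  "offset l = height (sum_list l) - z0"

text \<open>The test is made at the horizontal step that leaves the window, when no vertical step of
  the window remains, and its outcome is kept from then on.\<close>

fun escaped :: "nat \<Rightarrow> site list \<Rightarrow> bool" where
  "escaped j [] \<longleftrightarrow> False"
| "escaped j (m # l) \<longleftrightarrow> escaped j l \<or> (\<not> fresh l \<and> hclock l = e j \<and> int (r j) < \<bar>offset l\<bar>)"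

text \<open>Once the offset has left the critical range, the barrier bounds the probability that it comes back
  within the window; the term \<open>3 (e j - hclock l) + bonus l\<close> pays for the vertical steps still to come.
  Before \<open>64 (r j)\<^sup>2\<close> vertical steps the factor of a window is the exact mean of the tent-shaped bound
  reached at that number of steps.\<close>

definition barrier :: "nat \<Rightarrow> site list \<Rightarrow> real" where
  "barrier j l = (sq (R j + r j) (offset l) + 3 * (real (e j) - real (hclock l)) + bonus l) / (real (R j))\<^sup>2"

definition factor :: "nat \<Rightarrow> site list \<Rightarrow> real" where
  "factor j l =
    (if hclock l < a j then \<theta> else if e j < hclock l then 1
     else if vsteps (a j) (e j) l < 64 * (r j)\<^sup>2
       then (avg ^^ (64 * (r j)\<^sup>2 - vsteps (a j) (e j) l)) (psi (r j) (R j)) (offset l)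
     else min (psi (r j) (R j) (offset l)) (barrier j l))"

text \<open>Bounds the probability of leaving window \<open>j\<close> with an offset above \<open>r j\<close> and still hitting the target
  by horizontal time \<open>n\<close>.\<close>

definition err :: "nat \<Rightarrow> site list \<Rightarrow> real" where
  "err j l =
    (if hclock l \<le> e j then 3 * (real n - real (e j)) / (real (r j))\<^sup>2
     else if escaped j l then (sq (r j) (offset l) + 3 * (real n - real (hclock l)) + bonus l) / (real (r j))\<^sup>2
     else 0)"

text \<open>After an escape this part is 0, and a later hit of the target is paid for by
  \<open>err\<close> alone.\<close>

definition main :: "site list \<Rightarrow> real" where
  "main l = (if \<exists>j\<in>G. escaped j l then 0 else \<Prod>j\<in>G. factor j l)"

definition potential :: "site list \<Rightarrow> real" where
  "potential l = (if hclock l \<le> n then main l + (\<Sum>j\<in>G. err j l) else 0)"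

lemma offset_vertical: "offset ((0, 0, 1) # l) = offset l + 1" "offset ((0, 0, -1) # l) = offset l - 1"
  by (auto simp: offset_def height_def)

lemma offset_horizontal: "d \<in> horizontal_steps \<Longrightarrow> offset (d # l) = offset l"
  by (auto simp: offset_def height_def horizontal_steps_def)

lemma psi_nonneg: "0 < R' \<Longrightarrow> 0 \<le> psi r' R' z"
  using tent_le[of r' R' z] by (simp add: psi_def field_simps)

lemma avg_nonneg: "(\<And>z. 0 \<le> f z) \<Longrightarrow> 0 \<le> (avg ^^ k) f z"
proof (induction k arbitrary: z)
  case (Suc k)
  then show ?case by (simp add: avg_def)
qed simp

lemma R_pos: "j \<in> G \<Longrightarrow> 0 < R j"
  using r_pos[of j] R_ge_r[of j] by simp

lemma barrier_nonneg: "j \<in> G \<Longrightarrow> hclock l \<le> e j \<Longrightarrow> 0 \<le> barrier j l"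
  unfolding barrier_def using sq_nonneg bonus_bounds(1)[of l] by (intro divide_nonneg_nonneg add_nonneg_nonneg) auto

lemma factor_nonneg: "j \<in> G \<Longrightarrow> 0 \<le> factor j l"
  unfolding factor_def
  using \<theta>_nonneg barrier_nonneg[of j l] psi_nonneg[OF R_pos[of j]] by (auto intro!: avg_nonneg)

lemma main_nonneg: "0 \<le> main l"
  by (simp add: main_def prod_nonneg factor_nonneg)

lemma err_nonneg: "j \<in> G \<Longrightarrow> hclock l \<le> n \<Longrightarrow> 0 \<le> err j l"
  unfolding err_def using e_less[of j] sq_nonneg bonus_bounds(1)[of l]
  by (auto intro!: divide_nonneg_nonneg add_nonneg_nonneg)

lemma potential_nonneg: "0 \<le> potential l"
  unfolding potential_def by (auto intro!: add_nonneg_nonneg main_nonneg sum_nonneg err_nonneg)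

text \<open>In mean, \<open>sq\<close> grows by at most 1 at a vertical step and
  \<open>bonus\<close> falls by at least 1.\<close>

lemma err_vertical:
  assumes "valid l" "fresh l" "j \<in> G"
  shows "err j ((0, 0, 1) # l) + err j ((0, 0, -1) # l) \<le> 2 * err j l"
proof (cases "e j < hclock l \<and> escaped j l")
  case True
  define c where "c = (real (r j))\<^sup>2"
  have c: "0 < c" using r_pos[OF assms(3)] by (simp add: c_def)
  have "(sq (r j) (offset l + 1) + 3 * (real n - real (hclock l)) + bonus ((0, 0, 1) # l)) +
    (sq (r j) (offset l - 1) + 3 * (real n - real (hclock l)) + bonus ((0, 0, -1) # l))
    \<le> 2 * (sq (r j) (offset l) + 3 * (real n - real (hclock l)) + bonus l)"
    by (intro add_vertical sq_vertical bonus_vertical assms)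
  then show ?thesis
    unfolding err_def using True assms c
    by (simp add: offset_vertical flip: c_def) (simp add: divide_simps)
qed (use assms in \<open>auto simp: err_def\<close>)

text \<open>One tick of the clock releases 3, enough for the \<open>bonus\<close> of a run that may
  start now. At the end of the window an escape makes \<open>sq\<close> vanish, so the constant used
  before covers the new value.\<close>

lemma err_horizontal:
  assumes "\<not> fresh l" "j \<in> G" "d \<in> horizontal_steps"
  shows "err j (d # l) \<le> err j l"
proof -
  define c where "c = (real (r j))\<^sup>2"
  have c: "0 < c" using r_pos[OF assms(2)] by (simp add: c_def)
  have b: "bonus (d # l) \<le> 3" "bonus l = 0" using bonus_bounds assms by (auto simp: bonus_def)
  consider "hclock l < e j" | "hclock l = e j" | "e j < hclock l" by linarith
  then show ?thesis
  proof cases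
    case 1
    then show ?thesis using assms by (simp add: err_def)
  next
    case 2
    have s0: "sq (r j) (offset l) = 0" if "int (r j) < \<bar>offset l\<bar>"
      using that by (simp add: sq_def)
    have "\<not> escaped j l"
    proof -
      have "escaped j l' \<Longrightarrow> e j < hclock l'" for l'
        by (induction l') (auto split: if_splits)
      from this[of l] show ?thesis using 2 by auto
    qed
    then show ?thesis
      using assms 2 b e_less[OF assms(2)] c s0
      by (auto simp: err_def offset_horizontal intro!: divide_right_mono simp flip: c_def)
  next
    case 3
    then show ?thesis
      using assms b c by (auto simp: err_def offset_horizontal intro!: divide_right_mono simp flip: c_def)
  qed
qed

text \<open>Before \<open>64 * (r j)\<^sup>2\<close> vertical steps the factor is an exact average.
  Afterwards a minimum of two functions inherits the supermartingale inequality from whichever is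
  smaller at the current point.\<close>

lemma factor_vertical:
  assumes "valid l" "fresh l" "j \<in> G" "a j \<le> hclock l" "hclock l \<le> e j"
  shows "factor j ((0, 0, 1) # l) + factor j ((0, 0, -1) # l) \<le> 2 * factor j l"
proof -
  let ?N = "64 * (r j)\<^sup>2" and ?v = "vsteps (a j) (e j) l" and ?P = "psi (r j) (R j)"
  let ?z = "offset l"
  have v: "vsteps (a j) (e j) (m # l) = Suc ?v" for m
    using assms by simp
  consider "Suc ?v < ?N" | "Suc ?v = ?N" | "?N \<le> ?v" by linarith
  then show ?thesis
  proof cases
    case 1
    then have "?N - ?v = Suc (?N - Suc ?v)" by simp
    then have "(avg ^^ (?N - ?v)) ?P ?z = ((avg ^^ (?N - Suc ?v)) ?P (?z + 1) + (avg ^^ (?N - Suc ?v)) ?P (?z - 1)) / 2"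
      by (simp only: avg_Suc)
    then show ?thesis using 1 assms v by (simp add: factor_def offset_vertical)
  next
    case 2
    then have "?N - ?v = Suc 0" by simp
    then have "(avg ^^ (?N - ?v)) ?P ?z = (?P (?z + 1) + ?P (?z - 1)) / 2"
      by (simp only: avg_Suc) simp
    then show ?thesis using 2 assms v by (simp add: factor_def offset_vertical)
  next
    case 3
    define c where "c = (real (R j))\<^sup>2"
    have c: "0 < c" using R_pos[OF assms(3)] by (simp add: c_def)
    have f: "factor j l = min (?P ?z) (barrier j l)"
      "factor j ((0, 0, 1) # l) = min (?P (?z + 1)) (barrier j ((0, 0, 1) # l))"
      "factor j ((0, 0, -1) # l) = min (?P (?z - 1)) (barrier j ((0, 0, -1) # l))"
      using 3 assms v by (simp_all add: factor_def offset_vertical)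
    have bar: "barrier j ((0, 0, 1) # l) + barrier j ((0, 0, -1) # l) \<le> 2 * barrier j l"
    proof -
      have "(sq (R j + r j) (?z + 1) + 3 * (real (e j) - real (hclock l)) + bonus ((0, 0, 1) # l)) +
        (sq (R j + r j) (?z - 1) + 3 * (real (e j) - real (hclock l)) + bonus ((0, 0, -1) # l))
        \<le> 2 * (sq (R j + r j) ?z + 3 * (real (e j) - real (hclock l)) + bonus l)"
        by (intro add_vertical sq_vertical bonus_vertical assms)
      then show ?thesis
        unfolding barrier_def using assms c
        by (simp add: offset_vertical flip: c_def) (simp add: divide_simps)
    qed
    show ?thesis
    proof (cases "barrier j l \<le> ?P ?z")
      case True
      then show ?thesis using f bar by (simp add: min_def)
    next
      case False
      \<comment> \<open>\<open>psi\<close> violates the inequality only at its cap; but there it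
        equals \<open>1 / 2\<close>, and \<open>R_ge\<close> makes the barrier at most
        \<open>1 / 2\<close>, so the minimum is the barrier.\<close>
      have "\<bar>?z\<bar> < int (r j) + int (R j)"
      proof (rule ccontr)
        assume far: "\<not> \<bar>?z\<bar> < int (r j) + int (R j)"
        then have "sq (R j + r j) ?z = 0" by (simp add: sq_def)
        moreover have "6 * (real (e j) - real (a j) + 1) \<le> c"
        proof -
          have "real (6 * (e j - a j + 1)) \<le> real ((R j)\<^sup>2)"
            using R_ge[OF assms(3)] by (simp only: of_nat_le_iff)
          then show ?thesis using a_le_e[OF assms(3)] by (simp add: c_def of_nat_diff)
        qed
        ultimately have "barrier j l \<le> 1 / 2"
          unfolding barrier_def c_def[symmetric] using c assms bonus_bounds(2)[of l]
          by (simp add: divide_simps)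
        moreover have "tent (r j) (R j) ?z = R j" using far by (auto simp: tent_def)
        then have "?P ?z = 1 / 2" using R_pos[OF assms(3)] by (simp add: psi_def)
        ultimately show False using False by simp
      qed
      then have "?P (?z + 1) + ?P (?z - 1) \<le> 2 * ?P ?z"
        using tent_vertical[of ?z "r j" "R j"] R_pos[OF assms(3)]
        by (simp add: psi_def divide_simps)
      then show ?thesis using False f by (simp add: min_def)
    qed
  qed
qed

text \<open>The windows are disjoint, so at most one factor changes at a vertical step and the
  others come out as a nonnegative constant.\<close>

lemma main_vertical:
  assumes "valid l" "fresh l"
  shows "main ((0, 0, 1) # l) + main ((0, 0, -1) # l) \<le> 2 * main l"
proof (cases "\<exists>j\<in>G. escaped j l")
  case True
  then show ?thesis using assms by (auto simp: main_def)
next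
  case notesc: False
  then have m: "main (v # l) = (\<Prod>j\<in>G. factor j (v # l))" "main l = (\<Prod>j\<in>G. factor j l)" for v
    using assms by (auto simp: main_def)
  have same: "factor j (v # l) = factor j l" if "\<not> (a j \<le> hclock l \<and> hclock l \<le> e j)" for j v
    using that assms by (auto simp: factor_def)
  show ?thesis
  proof (cases "\<exists>i\<in>G. a i \<le> hclock l \<and> hclock l \<le> e i")
    case True
    then obtain i where i: "i \<in> G" "a i \<le> hclock l" "hclock l \<le> e i" by blast
    define rest where "rest = (\<Prod>j\<in>G - {i}. factor j l)"
    have "0 \<le> rest" unfolding rest_def by (intro prod_nonneg) (simp add: factor_nonneg)
    have "(\<Prod>j\<in>G - {i}. factor j (v # l)) = rest" for v
      unfolding rest_def using disjoint[OF i(1) _ i(2,3)] by (intro prod.cong same) auto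
    then have "main (v # l) = factor i (v # l) * rest" "main l = factor i l * rest" for v
      unfolding m using finite_G i by (simp_all add: prod.remove rest_def)
    then show ?thesis
      using mult_right_mono[OF factor_vertical[OF assms i] \<open>0 \<le> rest\<close>] by (simp add: algebra_simps)
  next
    case False
    then have "main (v # l) = main l" for v
      unfolding m by (intro prod.cong same) auto
    then show ?thesis by simp
  qed
qed

text \<open>On entering the window, \<open>avg_tent_ge\<close> brings the averaged
  \<open>psi\<close> below \<open>\<theta>\<close>. On leaving it without escape, the new columns
  guarantee that the second phase has been reached, and both functions in the minimum are at least 1
  within distance \<open>r j\<close>.\<close>

lemma factor_horizontal:
  assumes "valid l" "\<not> fresh l" "take (hclock l) s = horizontals l" "d \<in> horizontal_steps"
    "j \<in> G" "\<not> escaped j (d # l)"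
  shows "factor j (d # l) \<le> factor j l"
proof -
  let ?N = "64 * (r j)\<^sup>2" and ?P = "psi (r j) (R j)" and ?z = "offset l"
  note off = offset_horizontal[OF assms(4)]
  have v: "vsteps (a j) (e j) (d # l) = vsteps (a j) (e j) l"
    using assms by simp
  have Rp: "0 < real (R j)" using R_pos[OF assms(5)] by simp
  consider "Suc (hclock l) < a j" | "Suc (hclock l) = a j" | "a j \<le> hclock l" "hclock l < e j" | "hclock l = e j" | "e j < hclock l"
    by linarith
  then show ?thesis
  proof cases
    case 1
    then show ?thesis using assms by (simp add: factor_def)
  next
    case 2
    then have "vsteps (a j) (e j) l = 0" by (intro vsteps_0) simp
    then have "factor j (d # l) = (avg ^^ ?N) ?P ?z"
      using 2 assms off r_pos[OF assms(5)] a_le_e[OF assms(5)] by (simp add: factor_def)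
    also have "\<dots> = 1 - (avg ^^ ?N) (tent (r j) (R j)) ?z / (2 * real (R j))"
      by (rule avg_psi)
    also have "\<dots> \<le> 1 - real (r j) / (4 * real (R j))"
      using avg_tent_ge[OF r_pos[OF assms(5)] R_ge_r[OF assms(5)], of ?z] Rp
      by (simp add: divide_simps)
    also have "\<dots> \<le> \<theta>" by (rule \<theta>_ge[OF assms(5)])
    finally show ?thesis using 2 by (simp add: factor_def)
  next
    case 3
    have "bonus (d # l) \<le> 3" "bonus l = 0" using bonus_bounds assms by (auto simp: bonus_def)
    then have "barrier j (d # l) \<le> barrier j l"
      using assms off by (auto simp: barrier_def intro!: divide_right_mono)
    then show ?thesis using 3 assms off v by (auto simp: factor_def min_def)
  next
    case 4
    have "64 * (r j)\<^sup>2 \<le> vsteps (a j) (e j) l"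
      using many_new_sites[OF assms(5)] card_new_sites_le_vsteps[OF assms(1,3,2) 4, of "a j"] by linarith
    moreover have near: "\<bar>?z\<bar> \<le> int (r j)" using assms 4 by auto
    then have "?P ?z = 1" by (simp add: psi_def tent_def)
    moreover have "1 \<le> barrier j l"
    proof -
      have "(real (R j))\<^sup>2 \<le> sq (R j + r j) ?z"
        unfolding sq_def using near by (intro power_mono) auto
      then show ?thesis
        unfolding barrier_def using Rp 4 bonus_bounds(1)[of l] by (simp add: divide_simps)
    qed
    ultimately have "factor j l = 1"
      using 4 a_le_e[OF assms(5)] by (simp add: factor_def)
    moreover have "factor j (d # l) = 1"
      using 4 a_le_e[OF assms(5)] assms by (simp add: factor_def)
    ultimately show ?thesis by simp
  next
    case 5
    then show ?thesis using assms a_le_e[OF assms(5)] by (simp add: factor_def)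
  qed
qed

lemma main_horizontal:
  assumes "valid l" "\<not> fresh l" "take (hclock l) s = horizontals l" "d \<in> horizontal_steps"
  shows "main (d # l) \<le> main l"
proof (cases "\<exists>j\<in>G. escaped j (d # l)")
  case True
  then show ?thesis using main_nonneg[of l] by (simp add: main_def[of "d # l"])
next
  case False
  then have "(\<Prod>j\<in>G. factor j (d # l)) \<le> (\<Prod>j\<in>G. factor j l)"
    using assms by (intro prod_mono) (auto simp: factor_nonneg intro!: factor_horizontal)
  then show ?thesis using False by (auto simp: main_def)
qed

lemma potential_vertical:
  assumes "valid l" "fresh l"
  shows "(potential ((0, 0, 1) # l) + potential ((0, 0, -1) # l)) / 2 \<le> potential l"
proof (cases "hclock l \<le> n")
  case True
  have "(\<Sum>j\<in>G. err j ((0, 0, 1) # l) + err j ((0, 0, -1) # l)) \<le> (\<Sum>j\<in>G. 2 * err j l)"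
    using assms by (intro sum_mono err_vertical)
  then have "(\<Sum>j\<in>G. err j ((0, 0, 1) # l)) + (\<Sum>j\<in>G. err j ((0, 0, -1) # l)) \<le> 2 * (\<Sum>j\<in>G. err j l)"
    by (simp only: sum.distrib sum_distrib_left)
  moreover note main_vertical[OF assms]
  ultimately show ?thesis using True assms by (simp add: potential_def)
qed (use assms in \<open>simp add: potential_def\<close>)

lemma potential_horizontal:
  assumes "valid l" "\<not> fresh l" "take (hclock l) s = horizontals l" "d \<in> horizontal_steps"
  shows "potential (d # l) \<le> potential l"
proof (cases "hclock (d # l) \<le> n")
  case True
  have "(\<Sum>j\<in>G. err j (d # l)) \<le> (\<Sum>j\<in>G. err j l)"
    using assms by (intro sum_mono err_horizontal)
  moreover note main_horizontal[OF assms]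
  ultimately show ?thesis using True assms by (simp add: potential_def)
qed (use potential_nonneg[of l] in \<open>simp add: potential_def\<close>)

lemma potential_Nil: "potential [] = \<theta> ^ card G + (\<Sum>j\<in>G. 3 * (real n - real (e j)) / (real (r j))\<^sup>2)"
  using a_pos by (simp add: potential_def main_def factor_def err_def)

text \<open>At the target height \<open>sq\<close> takes its maximum \<open>(r j)\<^sup>2\<close>,
  so one escaped window makes its error term at least 1; without an escape all factors have become
  1.\<close>

lemma potential_hit:
  assumes "offset l = 0" "hclock l \<le> n" "\<And>j. j \<in> G \<Longrightarrow> e j < hclock l"
  shows "1 \<le> potential l"
proof (cases "\<exists>j\<in>G. escaped j l")
  case True
  then obtain j where j: "j \<in> G" "escaped j l" by blast
  have "sq (r j) 0 = (real (r j))\<^sup>2" by (simp add: sq_def)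
  then have "1 \<le> err j l"
    using assms(1,2) j r_pos[OF j(1)] bonus_bounds(1)[of l] assms(3)[OF j(1)]
    by (simp add: err_def divide_simps)
  also have "\<dots> \<le> (\<Sum>j\<in>G. err j l)"
    using finite_G j assms by (intro member_le_sum err_nonneg) auto
  finally show ?thesis using assms main_nonneg[of l] by (simp add: potential_def)
next
  case False
  have "factor j l = 1" if "j \<in> G" for j
    using assms(3)[OF that] a_le_e[OF that] by (simp add: factor_def)
  then have "main l = 1" using False by (simp add: main_def)
  moreover have "0 \<le> (\<Sum>j\<in>G. err j l)" using assms by (intro sum_nonneg err_nonneg)
  ultimately show ?thesis using assms by (simp add: potential_def)
qed

end

section \<open>Horizontal walks that enter few new columns\<close>

lemma shift_interval: "c \<le> p \<Longrightarrow> {p..<q} = (\<lambda>i. c + i) ` {p - c..<q - c}" for c p q :: nat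
  by (auto simp: image_iff intro!: bexI[of _ "_ - c"])

lemma mean_swap: "mean m (\<lambda>u. mean n (\<lambda>w. f u w)) = mean n (\<lambda>w. mean m (\<lambda>u. f u w))"
  unfolding mean_def sum_divide_distrib[symmetric] by (subst sum.swap) (simp add: mult.commute)

text \<open>Here the last steps \<open>w\<close> are fixed and the average is over the beginning,
  which then has to lead to a prescribed point.\<close>

lemma mean_append_le:
  assumes "m \<le> n" "\<And>w. w \<in> walks (n - m) \<Longrightarrow> mean m (\<lambda>u. f (u @ w)) \<le> c * g w"
  shows "mean n f \<le> c * mean (n - m) g"
proof -
  have "mean n f = mean (n - m) (\<lambda>w. mean m (\<lambda>u. f (u @ w)))"
    unfolding mean_split[OF assms(1)] by (rule mean_swap)
  also have "\<dots> \<le> mean (n - m) (\<lambda>w. c * g w)"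
    by (intro mean_mono assms(2))
  finally show ?thesis by (simp add: mean_cmult)
qed

lemma card_new_sites_ge: "card (loc s ` {a..e} - loc s ` {..<a}) \<le> card (new_sites s a e)"
proof (rule surj_card_le)
  show "finite (new_sites s a e)" by (simp add: new_sites_def)
  show "loc s ` {a..e} - loc s ` {..<a} \<subseteq> loc s ` new_sites s a e"
  proof
    fix y assume y: "y \<in> loc s ` {a..e} - loc s ` {..<a}"
    define i where "i = (LEAST i. loc s i = y)"
    obtain i0 where i0: "i0 \<in> {a..e}" "loc s i0 = y" using y by blast
    have i: "loc s i = y" unfolding i_def by (rule LeastI) (rule i0(2))
    have "i \<le> i0" unfolding i_def by (rule Least_le) (rule i0(2))
    have "a \<le> i" using y i by (metis DiffD2 image_eqI lessThan_iff not_le)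
    have "loc s t \<noteq> y" if "t < i" for t
      using that not_less_Least unfolding i_def by blast
    then have "y \<notin> loc s ` {..<i}" by blast
    then have "i \<in> new_sites s a e"
      using \<open>i \<le> i0\<close> \<open>a \<le> i\<close> i0 i by (simp add: new_sites_def)
    then show "y \<in> loc s ` new_sites s a e" using i by blast
  qed
qed

text \<open>\<open>k\<close> indexes the dyadic block of horizontal time, \<open>J\<close> is the
  number of windows, consecutive window lengths differ by \<open>2 ^ \<kappa>\<close>, and
  \<open>2 ^ \<gamma>\<close> is the factor lost between the length of a window and the required
  number of new sites. The last assumption keeps all lengths above
  \<open>2 ^ (k div 2)\<close>.\<close>

locale scales =
  fixes k \<kappa> \<gamma> J :: nat
  assumes kappa_pos: "0 < \<kappa>" and J_pos: "0 < J"
    and gamma_ge: "(k + 1) * \<kappa> \<le> 2 ^ \<gamma>" "3 \<le> \<gamma>"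
    and small: "2 * (\<kappa> * (J + 1) + \<gamma> + 8) \<le> k"
begin

definition \<beta> :: "nat \<Rightarrow> nat" where "\<beta> j = k - 1 - \<kappa> * j"
definition b :: "nat \<Rightarrow> nat" where "b j = 2 ^ \<beta> j"
text \<open>The stretch of this length before \<open>n\<close> lies after all \<open>J\<close>
  windows; it supplies the independent factor of order \<open>1 / k\<close>.\<close>

definition m' :: nat where "m' = b (J + 1)"
definition g :: "nat \<Rightarrow> nat" where "g j = 2 ^ (\<beta> j - \<gamma>)"
text \<open>The exponent is halved with rounding down, so that \<open>64 * (rad j)\<^sup>2\<close>
  agrees with \<open>g j\<close> up to a factor 2.\<close>

definition rad :: "nat \<Rightarrow> nat" where "rad j = 2 ^ ((\<beta> j - \<gamma> - 6) div 2)"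
definition \<Delta> :: nat where "\<Delta> = 2 ^ (\<gamma> - 3)"

definition lo :: "nat \<Rightarrow> nat \<Rightarrow> nat" where "lo n j = n - b j"
text \<open>The final 1 separates this window from the next, which starts at
  \<open>n - b (j + 1)\<close>.\<close>

definition hi :: "nat \<Rightarrow> nat \<Rightarrow> nat" where "hi n j = n - b (j + 1) - 1"

definition rich :: "site list \<Rightarrow> nat \<Rightarrow> nat set" where
  "rich s n = {j \<in> {1..J}. 64 * (rad j)\<^sup>2 \<le> card (new_sites s (lo n j) (hi n j))}"

lemma beta_bounds: "j \<le> J + 1 \<Longrightarrow> \<kappa> * j + \<beta> j = k - 1 \<and> k div 2 + \<gamma> + 7 \<le> \<beta> j"
proof -
  assume "j \<le> J + 1"
  then have le: "\<kappa> * j \<le> \<kappa> * (J + 1)" by (intro mult_left_mono) auto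
  define h where "h = k div 2"
  have "\<kappa> * (J + 1) + \<gamma> + 8 \<le> h"
    unfolding h_def using div_le_mono[OF small, of 2] by simp
  moreover have "2 * h \<le> k" by (simp add: h_def)
  ultimately show ?thesis using le unfolding \<beta>_def h_def[symmetric] by (intro conjI) linarith+
qed

lemma b_pos: "0 < b j" by (simp add: b_def)

lemma b_Suc: "j \<le> J \<Longrightarrow> b j = 2 ^ \<kappa> * b (j + 1)"
proof -
  assume j: "j \<le> J"
  have "\<kappa> * (j + 1) + \<beta> (j + 1) = k - 1" "\<kappa> * j + \<beta> j = k - 1"
    using beta_bounds[of "j + 1"] beta_bounds[of j] j by auto
  then have "\<beta> j = \<kappa> + \<beta> (j + 1)" by (simp add: algebra_simps)
  then show ?thesis by (simp add: b_def power_add)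
qed

lemma b_Suc_le: "j \<le> J \<Longrightarrow> 2 * b (j + 1) \<le> b j"
proof -
  assume j: "j \<le> J"
  have "(2::nat) ^ 1 \<le> 2 ^ \<kappa>" using kappa_pos by (intro power_increasing) auto
  then show ?thesis unfolding b_Suc[OF j] by (intro mult_right_mono) auto
qed

lemma b_mono: "i \<le> j \<Longrightarrow> b j \<le> b i"
  unfolding b_def \<beta>_def by (intro power_increasing diff_le_mono2 mult_left_mono) auto

lemma b_le: "1 \<le> j \<Longrightarrow> 4 * b j \<le> 2 ^ k"
proof -
  assume "1 \<le> j"
  then have "b j \<le> b 1" by (rule b_mono)
  moreover have "2 * b 1 \<le> b 0" using b_Suc_le[of 0] by simp
  moreover have "2 * b 0 = 2 ^ k"
  proof -
    have "k = Suc (k - 1)" using small by simp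
    then have "(2::nat) ^ k = 2 * 2 ^ (k - 1)" by (metis power_Suc)
    then show ?thesis by (simp add: b_def \<beta>_def)
  qed
  ultimately show ?thesis by linarith
qed

lemma g_b: "j \<le> J + 1 \<Longrightarrow> b j = 2 ^ \<gamma> * g j"
  using beta_bounds[of j] unfolding b_def g_def power_add[symmetric] by (intro arg_cong[where f = "power 2"]) linarith

lemma rad_le: "j \<le> J + 1 \<Longrightarrow> 64 * (rad j)\<^sup>2 \<le> g j"
proof -
  assume j: "j \<le> J + 1"
  let ?h = "(\<beta> j - \<gamma> - 6) div 2"
  have "64 * (rad j)\<^sup>2 = 2 ^ (6 + ?h * 2)"
    by (simp add: rad_def power_add power_mult)
  also have "\<dots> \<le> g j"
    unfolding g_def using beta_bounds[OF j] by (intro power_increasing) auto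
  finally show ?thesis .
qed

lemma rad_ge: "j \<le> J + 1 \<Longrightarrow> g j \<le> 128 * (rad j)\<^sup>2"
proof -
  assume j: "j \<le> J + 1"
  let ?h = "(\<beta> j - \<gamma> - 6) div 2"
  have "g j \<le> 2 ^ (7 + ?h * 2)"
    unfolding g_def using beta_bounds[OF j] by (intro power_increasing) auto
  also have "\<dots> = 128 * (rad j)\<^sup>2"
    by (simp add: rad_def power_add power_mult)
  finally show ?thesis .
qed

lemma gamma_Delta: "2 ^ \<gamma> = 8 * \<Delta>"
proof -
  have "2 ^ \<gamma> = (2::nat) ^ (3 + (\<gamma> - 3))" using gamma_ge(2) by simp
  then show ?thesis unfolding \<Delta>_def power_add by simp
qed

lemma Delta_g: "j \<le> J + 1 \<Longrightarrow> b j = 8 * \<Delta> * g j"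
  using g_b[of j] gamma_Delta by simp

lemma Delta_pos: "0 < \<Delta>" by (simp add: \<Delta>_def)

section \<open>The probability that a window has too few new sites\<close>

definition fresh_end :: "nat \<Rightarrow> site list \<Rightarrow> bool" where
  "fresh_end n s \<longleftrightarrow> (\<forall>t\<in>{n - m'..<n}. loc s t \<noteq> sum_list s)"

definition crowded :: "nat \<Rightarrow> nat \<Rightarrow> site list \<Rightarrow> bool" where
  "crowded n j s \<longleftrightarrow> \<Delta> * card (loc s ` {lo n j..hi n j}) < b j - b (j + 1)"

definition covered :: "nat \<Rightarrow> nat \<Rightarrow> site list \<Rightarrow> bool" where
  "covered n j s \<longleftrightarrow> card (loc s ` {lo n j..hi n j})
     \<le> 4 * card (loc s ` {lo n j..hi n j} \<inter> loc s ` {g j..lo n j - g j})"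

text \<open>Sites hit within the first \<open>g j\<close> or the last \<open>g j\<close> steps before the window are too few to matter.\<close>

lemma rich_if:
  assumes j: "j \<in> {1..J}" and n: "2 ^ k \<le> n" and "\<not> crowded n j s" "\<not> covered n j s"
  shows "j \<in> rich s n"
proof -
  let ?A = "loc s ` {lo n j..hi n j}"
  let ?V = "loc s ` {g j..lo n j - g j}"
  have "b j \<le> 2 * (b j - b (j + 1))" using b_Suc_le[of j] j by auto
  also have "\<dots> \<le> 2 * (\<Delta> * card ?A)" using assms by (simp add: crowded_def)
  finally have "\<Delta> * (4 * g j) \<le> \<Delta> * card ?A" using Delta_g[of j] j by simp
  then have A: "4 * g j \<le> card ?A" using Delta_pos by simp
  have "{..<lo n j} \<subseteq> {..<g j} \<union> {g j..lo n j - g j} \<union> {lo n j - g j<..<lo n j}" by auto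
  then have "?A - loc s ` {..<g j} - ?A \<inter> ?V - loc s ` {lo n j - g j<..<lo n j} \<subseteq> ?A - loc s ` {..<lo n j}"
    by blast
  then have "card (?A - loc s ` {..<g j} - ?A \<inter> ?V - loc s ` {lo n j - g j<..<lo n j}) \<le> card (?A - loc s ` {..<lo n j})"
    by (intro card_mono) auto
  moreover have "card (?A - loc s ` {..<g j} - ?A \<inter> ?V - loc s ` {lo n j - g j<..<lo n j}) \<ge>
      card ?A - card (loc s ` {..<g j}) - card (?A \<inter> ?V) - card (loc s ` {lo n j - g j<..<lo n j})"
  proof -
    have d: "card X - card Y \<le> card (X - Y)" if "finite Y" for X Y :: "site set"
      using that by (rule diff_card_le_card_Diff)
    show ?thesis
      by (rule order_trans[OF diff_le_mono[OF order_trans[OF diff_le_mono[OF d] d]] d]) auto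
  qed
  moreover have "card (loc s ` {..<g j}) \<le> g j"
    using card_image_le[of "{..<g j}" "loc s"] by simp
  moreover have "card (loc s ` {lo n j - g j<..<lo n j}) \<le> g j"
    using card_image_le[of "{lo n j - g j<..<lo n j}" "loc s"] by simp
  moreover have "4 * card (?A \<inter> ?V) < card ?A" using assms by (simp add: covered_def)
  moreover have "64 * (rad j)\<^sup>2 \<le> g j" using rad_le[of j] j by simp
  moreover note A card_new_sites_ge[of s "lo n j" "hi n j"]
  ultimately have "64 * (rad j)\<^sup>2 \<le> card (new_sites s (lo n j) (hi n j))" by linarith
  then show ?thesis using j by (simp add: rich_def)
qed

text \<open>The event depends only on the last \<open>m'\<close> steps, a walk of dyadic length with
  exponent at least \<open>k / 2\<close>.\<close>

lemma fresh_end_prob: 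
  assumes "m' \<le> n"
  shows "mean n (\<lambda>w. of_bool (fresh_end n w)) \<le> 16 / k"
proof -
  have "mean n (\<lambda>w. of_bool (fresh_end n w)) = mean (n - m') (\<lambda>u. 1) * mean (n - (n - m')) (\<lambda>w. of_bool (\<forall>t<m'. loc w t \<noteq> sum_list w))"
  proof (rule mean_split_eq)
    fix u w assume u: "u \<in> walks (n - m')" "w \<in> walks (n - (n - m'))"
    have "fresh_end n (u @ w) \<longleftrightarrow> (\<forall>t<m'. loc w t \<noteq> sum_list w)"
    proof
      assume *: "fresh_end n (u @ w)"
      show "\<forall>t<m'. loc w t \<noteq> sum_list w"
      proof (intro allI impI)
        fix t assume "t < m'"
        then have "n - m' + t \<in> {n - m'..<n}" using assms by auto
        then show "loc w t \<noteq> sum_list w"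
          using * length_walks[OF u(1)] unfolding fresh_end_def by fastforce
      qed
    next
      assume *: "\<forall>t<m'. loc w t \<noteq> sum_list w"
      show "fresh_end n (u @ w)"
        unfolding fresh_end_def
      proof
        fix t assume "t \<in> {n - m'..<n}"
        moreover from this have "t - (n - m') < m'" using assms by auto
        ultimately show "loc (u @ w) t \<noteq> sum_list (u @ w)"
          using *[rule_format, of "t - (n - m')"] length_walks[OF u(1)] by auto
      qed
    qed
    then show "of_bool (fresh_end n (u @ w)) = 1 * (of_bool (\<forall>t<m'. loc w t \<noteq> sum_list w) :: real)" by simp
  qed simp
  also have "\<dots> = mean m' (\<lambda>w. of_bool (\<forall>t<m'. loc w t \<noteq> sum_list w))"
    using assms by simp
  also have "\<dots> \<le> 8 / \<beta> (J + 1)"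
    unfolding m'_def b_def by (rule new_site_prob_le) (use beta_bounds[of "J + 1"] in simp)
  also have "\<dots> \<le> 16 / k"
  proof -
    have "k \<le> 2 * \<beta> (J + 1)" using beta_bounds[of "J + 1"] by linarith
    then have "real k \<le> 2 * real (\<beta> (J + 1))" by linarith
    moreover have "0 < k" using small by simp
    ultimately show ?thesis by (simp add: field_simps)
  qed
  finally show ?thesis .
qed

lemma window_split:
  assumes "j \<in> {1..J}" "2 ^ k \<le> n" "u \<in> walks (lo n j)" "w \<in> walks (b j)"
  shows "loc (u @ w) ` {lo n j..hi n j} = (\<lambda>i. sum_list u + loc w i) ` {..<b j - b (j + 1)}"
    and "fresh_end n (u @ w) \<longleftrightarrow> fresh_end (b j) w"
proof -
  have "b (j + 1) < b j" using b_Suc_le[of j] b_pos[of "j + 1"] assms(1) by simp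
  then have bn: "b j \<le> n" "b (j + 1) < b j" "m' \<le> b j" "0 < b (j + 1)"
    using b_le[of j] b_mono[of j "J + 1"] b_pos assms by (auto simp: m'_def)
  have len: "length u = lo n j" using assms length_walks by blast
  have "{lo n j..hi n j} = {lo n j..<n - b (j + 1)}" using bn by (auto simp: hi_def)
  also have "\<dots> = (\<lambda>i. lo n j + i) ` {lo n j - lo n j..<n - b (j + 1) - lo n j}"
    by (rule shift_interval) simp
  also have "{lo n j - lo n j..<n - b (j + 1) - lo n j} = {..<b j - b (j + 1)}"
    using bn by (auto simp: lo_def)
  finally have "{lo n j..hi n j} = (\<lambda>i. lo n j + i) ` {..<b j - b (j + 1)}" .
  then show "loc (u @ w) ` {lo n j..hi n j} = (\<lambda>i. sum_list u + loc w i) ` {..<b j - b (j + 1)}"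
    using len by (simp add: image_image)
  show "fresh_end n (u @ w) \<longleftrightarrow> fresh_end (b j) w"
  proof -
    have "{n - m'..<n} = (\<lambda>i. lo n j + i) ` {n - m' - lo n j..<n - lo n j}"
      using bn by (intro shift_interval) (simp add: lo_def)
    moreover have "n - m' - lo n j = b j - m'" "n - lo n j = b j" using bn by (auto simp: lo_def)
    ultimately have "{n - m'..<n} = (\<lambda>i. lo n j + i) ` {b j - m'..<b j}" by (simp only:)
    then have "fresh_end n (u @ w) \<longleftrightarrow> (\<forall>i\<in>{b j - m'..<b j}. loc (u @ w) (lo n j + i) \<noteq> sum_list (u @ w))"
      unfolding fresh_end_def by (simp only:) blast
    also have "\<dots> \<longleftrightarrow> fresh_end (b j) w"
      using len by (simp add: fresh_end_def)
    finally show ?thesis .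
  qed
qed

text \<open>Three independent pieces of the walk each give a factor: the steps before the window
  must lead to a prescribed point, those in the window see few distinct sites, and those after it
  satisfy \<open>fresh_end\<close>.\<close>

lemma crowded_prob:
  assumes j: "j \<in> {1..J}" and n: "2 ^ k \<le> n"
  shows "mean n (\<lambda>s. of_bool (sum_list s = x \<and> fresh_end n s \<and> crowded n j s))
    \<le> 1 / (real (lo n j) + 1) * (16 / \<kappa> * (16 / k))"
proof -
  have bn: "b j \<le> n" "b (j + 1) \<le> b j" "m' \<le> b j" "m' \<le> b (j + 1)"
    using b_le[of j] b_mono[of j "j + 1"] b_mono[of j "J + 1"] b_mono[of "j + 1" "J + 1"] b_pos assms 
    by (auto simp: m'_def)
  have nlo: "n - lo n j = b j" using bn by (simp add: lo_def)
  let ?len = "b j - b (j + 1)"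
  let ?c = "\<lambda>w. \<Delta> * card (loc w ` {..<?len}) < ?len"
  have "mean n (\<lambda>s. of_bool (sum_list s = x \<and> fresh_end n s \<and> crowded n j s))
    \<le> 1 / (real (lo n j) + 1) * mean (n - lo n j) (\<lambda>w. of_bool (?c w) * of_bool (fresh_end (b j) w))"
  proof (rule mean_append_le)
    fix w assume w: "w \<in> walks (n - lo n j)"
    then have w': "w \<in> walks (b j)" by (simp add: nlo)
    have "mean (lo n j) (\<lambda>u. of_bool (sum_list (u @ w) = x \<and> fresh_end n (u @ w) \<and> crowded n j (u @ w)))
      = mean (lo n j) (\<lambda>u. (of_bool (?c w) * of_bool (fresh_end (b j) w)) * of_bool (sum_list u = x - sum_list w))"
    proof (rule mean_cong)
      fix u assume u: "u \<in> walks (lo n j)"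
      have "card (loc (u @ w) ` {lo n j..hi n j}) = card ((+) (sum_list u) ` loc w ` {..<?len})"
        unfolding window_split(1)[OF j n u w'] by (simp add: image_image)
      also have "\<dots> = card (loc w ` {..<?len})"
        by (rule card_image) (auto simp: inj_on_def)
      finally show "of_bool (sum_list (u @ w) = x \<and> fresh_end n (u @ w) \<and> crowded n j (u @ w)) =
        of_bool (?c w) * of_bool (fresh_end (b j) w) * (of_bool (sum_list u = x - sum_list w) :: real)"
        using window_split(2)[OF j n u w'] by (auto simp: crowded_def of_bool_def algebra_simps)
    qed
    also have "\<dots> = (of_bool (?c w) * of_bool (fresh_end (b j) w)) * mean (lo n j) (\<lambda>u. of_bool (sum_list u = x - sum_list w))"
      by (rule mean_cmult)
    also have "\<dots> \<le> (of_bool (?c w) * of_bool (fresh_end (b j) w)) * (1 / (real (lo n j) + 1))"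
      by (intro mult_left_mono point_prob_le) auto
    finally show "mean (lo n j) (\<lambda>u. of_bool (sum_list (u @ w) = x \<and> fresh_end n (u @ w) \<and> crowded n j (u @ w)))
      \<le> 1 / (real (lo n j) + 1) * (of_bool (?c w) * of_bool (fresh_end (b j) w))" by (simp only: mult.commute)
  qed (simp add: lo_def)
  also have "mean (n - lo n j) (\<lambda>w. of_bool (?c w) * of_bool (fresh_end (b j) w))
    = mean (b j) (\<lambda>w. of_bool (?c w) * of_bool (fresh_end (b j) w))"
    by (simp add: nlo)
  also have "\<dots> = mean ?len (\<lambda>w. of_bool (?c w)) * mean (b j - ?len) (\<lambda>w. of_bool (fresh_end (b (j + 1)) w))"
  proof (rule mean_split_eq)
    fix u w assume u: "u \<in> walks ?len" and w: "w \<in> walks (b j - ?len)"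
    have lu: "length u = ?len" using length_walks[OF u] .
    have "{b j - m'..<b j} = (\<lambda>i. ?len + i) ` {b j - m' - ?len..<b j - ?len}"
      using bn by (intro shift_interval) simp
    moreover have "b j - m' - ?len = b (j + 1) - m'" "b j - ?len = b (j + 1)" using bn by auto
    ultimately have "{b j - m'..<b j} = (\<lambda>i. ?len + i) ` {b (j + 1) - m'..<b (j + 1)}" by (simp only:)
    then have "fresh_end (b j) (u @ w) \<longleftrightarrow>
        (\<forall>i\<in>{b (j + 1) - m'..<b (j + 1)}. loc (u @ w) (?len + i) \<noteq> sum_list (u @ w))"
      unfolding fresh_end_def by (simp only:) blast
    also have "\<dots> \<longleftrightarrow> fresh_end (b (j + 1)) w"
      using lu by (simp add: fresh_end_def)
    finally have "fresh_end (b j) (u @ w) \<longleftrightarrow> fresh_end (b (j + 1)) w" .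
    moreover have "loc (u @ w) ` {..<?len} = loc u ` {..<?len}"
      using lu by (intro image_cong) auto
    ultimately show "of_bool (?c (u @ w)) * of_bool (fresh_end (b j) (u @ w)) =
      of_bool (?c u) * (of_bool (fresh_end (b (j + 1)) w) :: real)" by simp
  qed simp
  also have "\<dots> \<le> 16 / \<kappa> * (16 / k)"
  proof (rule mult_mono)
    have "?len \<le> 2 ^ k" using b_le[of j] j by auto
    then have "mean ?len (\<lambda>w. of_bool (?c w)) \<le> 2 * (real k + 1) / \<Delta>"
      using few_distinct_sites_prob[of ?len k \<Delta> ?len] Delta_pos by simp
    also have "\<dots> \<le> 16 / \<kappa>"
    proof -
      have "(k + 1) * \<kappa> \<le> 8 * \<Delta>"
        using gamma_ge(1) gamma_Delta by simp
      then have "real ((k + 1) * \<kappa>) \<le> real (8 * \<Delta>)" by (simp only: of_nat_le_iff)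
      then show ?thesis using Delta_pos kappa_pos by (simp add: field_simps)
    qed
    finally show "mean ?len (\<lambda>w. of_bool (?c w)) \<le> 16 / \<kappa>" .
    have "b j - ?len = b (j + 1)" using bn by simp
    then show "mean (b j - ?len) (\<lambda>w. of_bool (fresh_end (b (j + 1)) w)) \<le> 16 / k"
      using fresh_end_prob[OF bn(4)] by simp
  qed (auto intro!: mean_nonneg)
  finally show ?thesis by (simp add: divide_right_mono)
qed

text \<open>Fixing the steps \<open>w\<close> from the start of the window on and the endpoint
  \<open>x\<close> determines the set of window sites, and the earlier steps form a bridge. The
  expected fraction of these sites met by the bridge is at most the maximal bridge hitting
  probability, and Markov's inequality at level \<open>1 / 4\<close> concludes.\<close>

lemma covered_prob:
  assumes j: "j \<in> {1..J}" and n: "2 ^ k \<le> n" "n < 2 ^ (k + 1)"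
  shows "mean n (\<lambda>s. of_bool (sum_list s = x \<and> fresh_end n s \<and> covered n j s))
    \<le> 1 / (real (lo n j) + 1) * (128 * (real (\<kappa> * J + \<gamma>) + 4) / (real k + 1) * (16 / k))"
proof -
  have bn: "b j \<le> n" "b (j + 1) < b j" "m' \<le> b j"
    using b_le[of j] b_Suc_le[of j] b_mono[of j "J + 1"] b_pos[of "j + 1"] assms
    by (auto simp: m'_def)
  have nlo: "n - lo n j = b j" using bn by (simp add: lo_def)
  let ?len = "b j - b (j + 1)"
  define q where "q = 32 * (real (\<kappa> * J + \<gamma>) + 4) / ((real k + 1) * (real (lo n j) + 1))"
  have bridge: "mean (lo n j) (\<lambda>u. of_bool ((\<exists>t\<in>{g j..lo n j - g j}. loc u t = y) \<and> sum_list u = z)) \<le> q" for y z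
  proof -
    let ?i = "\<beta> j - \<gamma>"
    have "mean (lo n j) (\<lambda>u. of_bool ((\<exists>t\<in>{g j..lo n j - g j}. loc u t = y) \<and> sum_list u = z))
      \<le> 32 * (real (k + 1) + 2 - real ?i) / (real (k + 1) * (real (lo n j) + 1))"
    proof (rule bridge_hitting_prob)
      show "0 < ?i" using beta_bounds[of j] j by auto
      show "2 ^ ?i \<le> g j" by (simp add: g_def)
      show "lo n j \<le> 2 ^ (k + 1)" using n by (simp add: lo_def)
      show "?i \<le> k + 1" by (simp add: \<beta>_def)
    qed
    also have "\<dots> \<le> q"
    proof -
      have "\<kappa> * j + \<beta> j = k - 1" "\<gamma> \<le> \<beta> j" "1 \<le> k"
        using beta_bounds[of j] j small by auto
      then have "real \<kappa> * real j + real (\<beta> j) = real k - 1" "real ?i = real (\<beta> j) - real \<gamma>"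
        by (simp_all flip: of_nat_mult of_nat_add add: of_nat_diff)
      moreover have "real \<kappa> * real j \<le> real \<kappa> * real J"
        using j by (intro mult_left_mono) auto
      ultimately have "real (k + 1) + 2 - real ?i \<le> real (\<kappa> * J + \<gamma>) + 4"
        by simp
      then show ?thesis
        unfolding q_def by (intro frac_le) (auto simp: add.commute)
    qed
    finally show ?thesis .
  qed
  have "mean n (\<lambda>s. of_bool (sum_list s = x \<and> fresh_end n s \<and> covered n j s))
    \<le> 4 * q * mean (n - lo n j) (\<lambda>w. of_bool (fresh_end (b j) w))"
  proof (rule mean_append_le)
    fix w assume w: "w \<in> walks (n - lo n j)"
    then have w': "w \<in> walks (b j)" by (simp add: nlo)
    \<comment> \<open>The window sites computed backwards from the endpoint \<open>x\<close>, hence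
      independent of \<open>u\<close>.\<close>
    define A where "A = (\<lambda>i. x - sum_list w + loc w i) ` {..<?len}"
    have "finite A" "A \<noteq> {}" using bn by (auto simp: A_def lessThan_empty_iff)
    then have cA: "0 < real (card A)" by (simp add: card_gt_0_iff)
    let ?h = "\<lambda>u y. (\<exists>t\<in>{g j..lo n j - g j}. loc u t = y) \<and> sum_list u = x - sum_list w"
    have "mean (lo n j) (\<lambda>u. of_bool (sum_list (u @ w) = x \<and> fresh_end n (u @ w) \<and> covered n j (u @ w)))
      \<le> mean (lo n j) (\<lambda>u. of_bool (fresh_end (b j) w) * (4 / card A) * (\<Sum>y\<in>A. of_bool (?h u y)))"
    proof (rule mean_mono)
      fix u assume u: "u \<in> walks (lo n j)"
      have lu: "length u = lo n j" using length_walks[OF u] .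
      show "of_bool (sum_list (u @ w) = x \<and> fresh_end n (u @ w) \<and> covered n j (u @ w))
        \<le> of_bool (fresh_end (b j) w) * (4 / card A) * (\<Sum>y\<in>A. of_bool (?h u y))"
      proof (cases "sum_list (u @ w) = x \<and> fresh_end n (u @ w) \<and> covered n j (u @ w)")
        case True
        then have su: "sum_list u = x - sum_list w" by (auto simp: algebra_simps)
        have img: "loc (u @ w) ` {lo n j..hi n j} = A"
          unfolding window_split(1)[OF j n(1) u w'] su A_def ..
        have V: "loc (u @ w) ` {g j..lo n j - g j} = loc u ` {g j..lo n j - g j}"
          using lu by (intro image_cong) auto
        have "card A \<le> 4 * card (A \<inter> loc u ` {g j..lo n j - g j})"
          using True unfolding covered_def img V by blast
        then have "real (card A) \<le> 4 * real (card (A \<inter> loc u ` {g j..lo n j - g j}))" by linarith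
        also have "real (card (A \<inter> loc u ` {g j..lo n j - g j})) = (\<Sum>y\<in>A. of_bool (?h u y))"
        proof -
          have "A \<inter> loc u ` {g j..lo n j - g j} = A \<inter> {y. ?h u y}" using su by blast
          then show ?thesis using \<open>finite A\<close> by (simp add: of_bool_def sum.If_cases)
        qed
        finally have "1 \<le> 4 / card A * (\<Sum>y\<in>A. of_bool (?h u y))"
          using cA by (simp add: field_simps)
        moreover have "fresh_end (b j) w" using True window_split(2)[OF j n(1) u w'] by simp
        ultimately show ?thesis by simp
      next
        case False
        have "0 \<le> of_bool (fresh_end (b j) w) * (4 / real (card A)) * (\<Sum>y\<in>A. of_bool (?h u y))"
          by (intro mult_nonneg_nonneg sum_nonneg) auto
        then show ?thesis using False by (simp only: of_bool_eq)
      qed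
    qed
    also have "\<dots> = of_bool (fresh_end (b j) w) * (4 / card A) * (\<Sum>y\<in>A. mean (lo n j) (\<lambda>u. of_bool (?h u y)))"
      unfolding mean_cmult mean_sum ..
    also have "\<dots> \<le> of_bool (fresh_end (b j) w) * (4 / card A) * (\<Sum>y\<in>A. q)"
      by (intro mult_left_mono sum_mono bridge) auto
    also have "\<dots> = 4 * q * of_bool (fresh_end (b j) w)"
      using cA by simp
    finally show "mean (lo n j) (\<lambda>u. of_bool (sum_list (u @ w) = x \<and> fresh_end n (u @ w) \<and> covered n j (u @ w)))
      \<le> 4 * q * of_bool (fresh_end (b j) w)" .
  qed (simp add: lo_def)
  also have "\<dots> \<le> 4 * q * (16 / k)"
    using fresh_end_prob[OF bn(3)] by (intro mult_left_mono) (auto simp: nlo q_def)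
  also have "\<dots> = 1 / (real (lo n j) + 1) * (128 * (real (\<kappa> * J + \<gamma>) + 4) / (real k + 1) * (16 / k))"
    by (simp add: q_def)
  finally show ?thesis .
qed

definition \<epsilon> :: real where
  "\<epsilon> = 16 / \<kappa> + 128 * (real (\<kappa> * J + \<gamma>) + 4) / (real k + 1)"

text \<open>By \<open>rich_if\<close>, fewer than \<open>J / 2\<close> rich windows means at least
  \<open>J / 2\<close> crowded or covered ones, so Markov's inequality applies to their number.
  Since \<open>lo n j\<close> is at least \<open>2 ^ k / 2\<close>, the point probability is at most
  \<open>2 / 2 ^ k\<close>.\<close>

lemma poor_prob:
  assumes n: "2 ^ k \<le> n" "n < 2 ^ (k + 1)"
  shows "mean n (\<lambda>s. of_bool (sum_list s = x \<and> fresh_end n s \<and> 2 * card (rich s n) < J))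
    \<le> 64 / k * \<epsilon> / 2 ^ k"
proof -
  let ?B = "\<lambda>j s. (of_bool (sum_list s = x \<and> fresh_end n s \<and> crowded n j s) +
      of_bool (sum_list s = x \<and> fresh_end n s \<and> covered n j s) :: real)"
  have "mean n (\<lambda>s. of_bool (sum_list s = x \<and> fresh_end n s \<and> 2 * card (rich s n) < J))
    \<le> mean n (\<lambda>s. 2 / J * (\<Sum>j\<in>{1..J}. ?B j s))"
  proof (rule mean_mono)
    fix s
    show "of_bool (sum_list s = x \<and> fresh_end n s \<and> 2 * card (rich s n) < J) \<le> 2 / J * (\<Sum>j\<in>{1..J}. ?B j s)"
    proof (cases "sum_list s = x \<and> fresh_end n s \<and> 2 * card (rich s n) < J")
      case True
      have "real (card ({1..J} - rich s n)) = (\<Sum>j\<in>{1..J} - rich s n. 1)" by simp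
      also have "\<dots> \<le> (\<Sum>j\<in>{1..J} - rich s n. ?B j s)"
      proof (rule sum_mono)
        fix j assume "j \<in> {1..J} - rich s n"
        then have "crowded n j s \<or> covered n j s" using rich_if[OF _ n(1)] by auto
        then show "1 \<le> ?B j s" using True by auto
      qed
      also have "\<dots> \<le> (\<Sum>j\<in>{1..J}. ?B j s)" by (intro sum_mono2) auto
      finally have "real (card ({1..J} - rich s n)) \<le> (\<Sum>j\<in>{1..J}. ?B j s)" .
      moreover have "card ({1..J} - rich s n) = J - card (rich s n)"
        by (subst card_Diff_subset) (auto simp: rich_def)
      then have "J \<le> 2 * card ({1..J} - rich s n)" using True by linarith
      then have "real J \<le> 2 * real (card ({1..J} - rich s n))" by linarith
      ultimately have "real J \<le> 2 * (\<Sum>j\<in>{1..J}. ?B j s)" by linarith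
      then show ?thesis using True J_pos by (simp add: field_simps)
    next
      case False
      have "0 \<le> 2 / real J * (\<Sum>j\<in>{1..J}. ?B j s)"
        by (intro mult_nonneg_nonneg sum_nonneg) auto
      then show ?thesis using False by (simp only: of_bool_eq)
    qed
  qed
  also have "\<dots> = 2 / J * (\<Sum>j\<in>{1..J}. mean n (?B j))"
    unfolding mean_cmult mean_sum ..
  also have "\<dots> \<le> 2 / J * (\<Sum>j\<in>{1..J}. 2 / 2 ^ k * (\<epsilon> * (16 / k)))"
  proof (intro mult_left_mono sum_mono)
    fix j assume j: "j \<in> {1..J}"
    have lo: "1 / (real (lo n j) + 1) \<le> 2 / 2 ^ k"
    proof -
      have "2 ^ k \<le> 2 * lo n j" using b_le[of j] j n unfolding lo_def by auto
      then have "real (2 ^ k) \<le> real (2 * lo n j)" by (simp only: of_nat_le_iff)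
      then have "2 ^ k \<le> 2 * real (lo n j)" by simp
      then show ?thesis by (simp add: field_simps)
    qed
    have "mean n (?B j) \<le> 1 / (real (lo n j) + 1) * (\<epsilon> * (16 / k))"
      unfolding mean_add \<epsilon>_def using crowded_prob[OF j n(1), of x] covered_prob[OF j n, of x]
      by (simp add: algebra_simps)
    also have "\<dots> \<le> 2 / 2 ^ k * (\<epsilon> * (16 / k))"
      by (intro mult_right_mono lo) (auto simp: \<epsilon>_def)
    finally show "mean n (?B j) \<le> 2 / 2 ^ k * (\<epsilon> * (16 / k))" .
  qed auto
  also have "\<dots> = 64 / k * \<epsilon> / 2 ^ k"
    using J_pos by simp
  finally show ?thesis .
qed

section \<open>Exceptional horizontal walks\<close>

definition first_hit :: "site \<Rightarrow> site list \<Rightarrow> nat \<Rightarrow> bool" where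
  "first_hit x s n \<longleftrightarrow> 2 ^ k \<le> n \<and> n < 2 ^ (k + 1) \<and> loc s n = x \<and> (\<forall>t\<in>{2 ^ k..<n}. loc s t \<noteq> x)"

text \<open>A first hit too close to the start of the block is excluded because the preceding
  \<open>m'\<close> steps would leave the block; a visit more than \<open>m'\<close> after the first
  is excluded because the windows before \<open>n\<close> control only a short time
  afterwards.\<close>

definition bad :: "site \<Rightarrow> site list \<Rightarrow> bool" where
  "bad x s \<longleftrightarrow> (\<exists>n. first_hit x s n \<and>
     (n < 2 ^ k + m' \<or> 2 * card (rich s n) < J \<or> (\<exists>t\<in>{n + m'..<2 ^ (k + 1)}. loc s t = x)))"

lemma new_sites_take: "e \<le> n \<Longrightarrow> new_sites (take n s) a e = new_sites s a e"
proof -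
  assume "e \<le> n"
  then have "loc (take n s) i = loc s i" "loc (take n s) ` {..<i} = loc s ` {..<i}" if "i \<in> {a..e}" for i
    using that by (auto simp: min_def intro!: image_cong)
  then show ?thesis unfolding new_sites_def by auto
qed

lemma rich_take: "rich (take n s) n = rich s n"
  unfolding rich_def by (simp add: new_sites_take hi_def)

text \<open>A union bound over the three alternatives. The first two are summed over
  \<open>n\<close>. For the third, the Markov property at the first hit gives the probability of a
  hit in the block, at most \<open>24 / (real k + 1)\<close>, times that of a late return.\<close>

lemma bad_prob:
  "mean (2 ^ (k + 1)) (\<lambda>s. of_bool (bad x s))
    \<le> real m' / 2 ^ k + 64 / k * \<epsilon> + 192 * (real (\<kappa> * (J + 1)) + 4) / (real k + 1)\<^sup>2"
proof -
  let ?N = "2 ^ (k + 1) :: nat"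
  let ?F1 = "\<lambda>n s. of_bool (loc s n = x) :: real"
  let ?F2 = "\<lambda>n s. of_bool (first_hit x s n \<and> 2 * card (rich s n) < J) :: real"
  let ?F3 = "\<lambda>n s. of_bool (first_hit x s n \<and> (\<exists>t\<in>{n + m'..<?N}. loc s t = x)) :: real"
  have "mean ?N (\<lambda>s. of_bool (bad x s)) \<le> mean ?N (\<lambda>s. (\<Sum>n\<in>{2 ^ k..<2 ^ k + m'}. ?F1 n s) + 
      ((\<Sum>n\<in>{2 ^ k + m'..<?N}. ?F2 n s) + (\<Sum>n\<in>{2 ^ k..<?N}. ?F3 n s)))"
  proof (rule mean_mono)
    fix s
    let ?S1 = "\<Sum>n\<in>{2 ^ k..<2 ^ k + m'}. ?F1 n s" and ?S2 = "\<Sum>n\<in>{2 ^ k + m'..<?N}. ?F2 n s"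
      and ?S3 = "\<Sum>n\<in>{2 ^ k..<?N}. ?F3 n s"
    have nn: "0 \<le> ?S1" "0 \<le> ?S2" "0 \<le> ?S3" by (intro sum_nonneg; simp)+
    show "of_bool (bad x s) \<le> ?S1 + (?S2 + ?S3)"
    proof (cases "bad x s")
      case True
      then obtain n where n: "first_hit x s n"
        "n < 2 ^ k + m' \<or> 2 * card (rich s n) < J \<or> (\<exists>t\<in>{n + m'..<?N}. loc s t = x)"
        by (auto simp: bad_def)
      consider "n < 2 ^ k + m'" | "2 ^ k + m' \<le> n" "2 * card (rich s n) < J" | "\<exists>t\<in>{n + m'..<?N}. loc s t = x"
        using n(2) by linarith
      then show ?thesis
      proof cases
        case 1
        then have "?F1 n s \<le> ?S1" using n by (intro member_le_sum) (auto simp: first_hit_def)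
        moreover have "?F1 n s = 1" using n by (simp add: first_hit_def)
        ultimately show ?thesis using True nn by simp
      next
        case 2
        then have "?F2 n s \<le> ?S2" using n by (intro member_le_sum) (auto simp: first_hit_def)
        moreover have "?F2 n s = 1" using n 2 by simp
        ultimately show ?thesis using True nn by simp
      next
        case 3
        then have "?F3 n s \<le> ?S3" using n by (intro member_le_sum) (auto simp: first_hit_def)
        moreover have "?F3 n s = 1" using n 3 by simp
        ultimately show ?thesis using True nn by simp
      qed
    qed (use nn in simp)
  qed
  also have "\<dots> = (\<Sum>n\<in>{2 ^ k..<2 ^ k + m'}. mean ?N (?F1 n)) + 
      ((\<Sum>n\<in>{2 ^ k + m'..<?N}. mean ?N (?F2 n)) + (\<Sum>n\<in>{2 ^ k..<?N}. mean ?N (?F3 n)))"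
    unfolding mean_add mean_sum ..
  also have "(\<Sum>n\<in>{2 ^ k..<2 ^ k + m'}. mean ?N (?F1 n)) \<le> (\<Sum>n\<in>{2 ^ k..<2 ^ k + m'}. 1 / 2 ^ k)"
  proof (rule sum_mono)
    fix n assume n: "n \<in> {2 ^ k..<2 ^ k + m'}"
    have "m' \<le> 2 ^ k" using b_le[of "J + 1"] unfolding m'_def by simp
    then have "n \<le> ?N" using n by simp
    then have "mean ?N (?F1 n) = mean n (\<lambda>s. of_bool (sum_list s = x))"
      by (rule mean_at[where f = "\<lambda>z. of_bool (z = x)"])
    also have "\<dots> \<le> 1 / (real n + 1)" by (rule point_prob_le)
    also have "\<dots> \<le> 1 / 2 ^ k"
    proof -
      have "real (2 ^ k) \<le> real n" using n by (simp only: of_nat_le_iff atLeastLessThan_iff)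
      then have "2 ^ k \<le> real n" by (simp only: of_nat_power of_nat_numeral)
      then have "2 ^ k \<le> real n + 1" by linarith
      then show ?thesis by (intro divide_left_mono) auto
    qed
    finally show "mean ?N (?F1 n) \<le> 1 / 2 ^ k" .
  qed
  also have "(\<Sum>n\<in>{2 ^ k..<2 ^ k + m'}. 1 / 2 ^ k) = real m' / 2 ^ k" by simp
  also have "(\<Sum>n\<in>{2 ^ k + m'..<?N}. mean ?N (?F2 n)) \<le> (\<Sum>n\<in>{2 ^ k + m'..<?N}. 64 / k * \<epsilon> / 2 ^ k)"
  proof (rule sum_mono)
    fix n assume n: "n \<in> {2 ^ k + m'..<?N}"
    have "mean ?N (?F2 n) \<le> mean ?N (\<lambda>s. of_bool (sum_list (take n s) = x \<and> fresh_end n (take n s) \<and> 2 * card (rich (take n s) n) < J))"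
    proof (rule mean_mono)
      fix s assume "s \<in> walks ?N"
      \<comment> \<open>Since \<open>n\<close> is at least \<open>2 ^ k + m'\<close>, the last
        \<open>m'\<close> steps before \<open>n\<close> lie in the block, where a first hit forbids
        earlier visits to \<open>x\<close>.\<close>
      have "fresh_end n (take n s)" if "first_hit x s n"
        unfolding fresh_end_def
      proof
        fix t assume t: "t \<in> {n - m'..<n}"
        then have "t \<in> {2 ^ k..<n}" using n by auto
        then have "loc s t \<noteq> loc s n" using that by (auto simp: first_hit_def)
        then show "loc (take n s) t \<noteq> loc s n" using t by (simp add: min_def)
      qed
      then show "?F2 n s \<le> of_bool (sum_list (take n s) = x \<and> fresh_end n (take n s) \<and> 2 * card (rich (take n s) n) < J)"
        unfolding rich_take by (auto simp: first_hit_def of_bool_def)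
    qed
    also have "\<dots> = mean n (\<lambda>s. of_bool (sum_list s = x \<and> fresh_end n s \<and> 2 * card (rich s n) < J))"
      using n by (intro mean_take) auto
    also have "\<dots> \<le> 64 / k * \<epsilon> / 2 ^ k"
      using n by (intro poor_prob) auto
    finally show "mean ?N (?F2 n) \<le> 64 / k * \<epsilon> / 2 ^ k" .
  qed
  also have "(\<Sum>n\<in>{2 ^ k + m'..<?N}. 64 / k * \<epsilon> / 2 ^ k) \<le> 64 / k * \<epsilon>"
  proof -
    have "real (?N - (2 ^ k + m')) \<le> 2 ^ k" by simp
    then have "real (?N - (2 ^ k + m')) * (64 / k * \<epsilon> / 2 ^ k) \<le> 2 ^ k * (64 / k * \<epsilon> / 2 ^ k)"
      by (intro mult_right_mono) (auto simp: \<epsilon>_def)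
    then show ?thesis by simp
  qed
  also have "(\<Sum>n\<in>{2 ^ k..<?N}. mean ?N (?F3 n)) \<le> (\<Sum>n\<in>{2 ^ k..<?N}. mean ?N (\<lambda>s. of_bool (first_hit x s n)) * (8 * (real (\<kappa> * (J + 1)) + 4) / (real k + 1)))"
  proof (rule sum_mono)
    fix n assume n: "n \<in> {2 ^ k..<?N}"
    define c where "c = 8 * (real (\<kappa> * (J + 1)) + 4) / (real k + 1)"
    have later: "mean (?N - n) (\<lambda>w. of_bool (\<exists>t\<in>{m'..?N - n}. loc w t = 0)) \<le> c"
    proof -
      have "mean (?N - n) (\<lambda>w. of_bool (\<exists>t\<in>{m'..?N - n}. loc w t = 0))
        \<le> 8 * (real (k + 1) + 2 - real (\<beta> (J + 1))) / (k + 1)"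
        unfolding m'_def b_def by (rule hitting_prob_dyadic) (auto simp: \<beta>_def)
      also have "real (k + 1) + 2 - real (\<beta> (J + 1)) = real (\<kappa> * (J + 1)) + 4"
      proof -
        have "\<kappa> * (J + 1) + \<beta> (J + 1) = k - 1" "1 \<le> k" using beta_bounds[of "J + 1"] small by auto
        then have "real (\<kappa> * (J + 1) + \<beta> (J + 1)) = real k - 1" by (simp only: of_nat_diff of_nat_1)
        then show ?thesis by simp
      qed
      finally show ?thesis by (simp add: c_def add.commute)
    qed
    have first_take: "first_hit x (u @ w) n \<longleftrightarrow> first_hit x u n" if "u \<in> walks n" for u w
      using length_walks[OF that] by (auto simp: first_hit_def)
    have "mean ?N (?F3 n) \<le> mean n (\<lambda>u. of_bool (first_hit x u n)) * c"
    proof (rule mean_split_le)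
      fix u assume u: "u \<in> walks n"
      have "mean (?N - n) (\<lambda>w. ?F3 n (u @ w)) \<le> mean (?N - n) (\<lambda>w. of_bool (first_hit x u n) * of_bool (\<exists>t\<in>{m'..?N - n}. loc w t = 0))"
      proof (rule mean_mono)
        fix w
        have "\<exists>t\<in>{m'..?N - n}. loc w t = 0" if fh: "first_hit x u n" and t: "t \<in> {n + m'..<?N}" "loc (u @ w) t = x" for t
          using fh t length_walks[OF u] by (intro bexI[of _ "t - n"]) (auto simp: first_hit_def)
        then show "?F3 n (u @ w) \<le> of_bool (first_hit x u n) * of_bool (\<exists>t\<in>{m'..?N - n}. loc w t = 0)"
          unfolding first_take[OF u] by (simp only: of_bool_conj[symmetric] of_bool_less_eq_iff) blast
      qed
      also have "\<dots> \<le> of_bool (first_hit x u n) * c"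
        unfolding mean_cmult using later by (intro mult_left_mono) auto
      finally show "mean (?N - n) (\<lambda>w. ?F3 n (u @ w)) \<le> of_bool (first_hit x u n) * c" .
    qed (use n in simp)
    also have "mean n (\<lambda>u. of_bool (first_hit x u n)) = mean ?N (\<lambda>s. of_bool (first_hit x s n))"
      using n by (intro mean_prefix[symmetric]) (auto simp: first_hit_def min_def)
    finally show "mean ?N (?F3 n) \<le> mean ?N (\<lambda>s. of_bool (first_hit x s n)) * (8 * (real (\<kappa> * (J + 1)) + 4) / (real k + 1))"
      by (simp add: c_def)
  qed
  also have "\<dots> = mean ?N (\<lambda>s. \<Sum>n\<in>{2 ^ k..<?N}. of_bool (first_hit x s n)) * (8 * (real (\<kappa> * (J + 1)) + 4) / (real k + 1))"
    unfolding mean_sum sum_distrib_right ..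
  also have "\<dots> \<le> 24 / (real k + 1) * (8 * (real (\<kappa> * (J + 1)) + 4) / (real k + 1))"
  proof (rule mult_right_mono)
    have "mean ?N (\<lambda>s. \<Sum>n\<in>{2 ^ k..<?N}. of_bool (first_hit x s n)) \<le> mean ?N (\<lambda>s. of_bool (\<exists>t\<in>{2 ^ k..?N}. loc s t = x))"
    proof (rule mean_mono)
      fix s
      have uniq: "n = n'" if "first_hit x s n" "first_hit x s n'" for n n'
        using that unfolding first_hit_def by (metis atLeastLessThan_iff linorder_neqE_nat)
      show "(\<Sum>n\<in>{2 ^ k..<?N}. of_bool (first_hit x s n)) \<le> (of_bool (\<exists>t\<in>{2 ^ k..?N}. loc s t = x) :: real)"
      proof (cases "\<exists>n. first_hit x s n")
        case True
        then obtain n where n: "first_hit x s n" by blast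
        then have "first_hit x s i \<longleftrightarrow> i = n" for i using uniq by blast
        then have "(\<Sum>i\<in>{2 ^ k..<?N}. of_bool (first_hit x s i) :: real) = (\<Sum>i\<in>{2 ^ k..<?N}. if i = n then 1 else 0)"
          by (simp add: of_bool_def)
        also have "\<dots> \<le> 1" by simp
        also have "\<exists>t\<in>{2 ^ k..?N}. loc s t = x" using n by (intro bexI[of _ n]) (auto simp: first_hit_def)
        then have "1 = (of_bool (\<exists>t\<in>{2 ^ k..?N}. loc s t = x) :: real)" by simp
        finally show ?thesis .
      next
        case False
        then have "(\<Sum>n\<in>{2 ^ k..<?N}. of_bool (first_hit x s n) :: real) = 0" by simp
        then show ?thesis by simp
      qed
    qed
    also have "\<dots> \<le> 8 * (real (k + 1) + 2 - real k) / (k + 1)"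
      by (rule hitting_prob_dyadic) auto
    also have "\<dots> = 24 / (real k + 1)" by (simp add: add.commute)
    finally show "mean ?N (\<lambda>s. \<Sum>n\<in>{2 ^ k..<?N}. of_bool (first_hit x s n)) \<le> 24 / (real k + 1)" .
  qed auto
  also have "24 / (real k + 1) * (8 * (real (\<kappa> * (J + 1)) + 4) / (real k + 1)) = 192 * (real (\<kappa> * (J + 1)) + 4) / (real k + 1)\<^sup>2"
    by (simp add: power2_eq_square)
  finally show ?thesis by simp
qed

end

section \<open>Transience\<close>

definition potential_bound :: "nat \<Rightarrow> nat \<Rightarrow> nat \<Rightarrow> nat \<Rightarrow> real" where
  "potential_bound k \<kappa> \<gamma> J =
     1 / 2 ^ \<kappa> + 64 / k * (16 / \<kappa> + 128 * (real (\<kappa> * J + \<gamma>) + 4) / (real k + 1))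
     + 192 * (real (\<kappa> * (J + 1)) + 4) / (real k + 1)\<^sup>2
     + exp (- real J / (320 * 2 ^ ((\<gamma> + 1) div 2))) + 1152 * real J * 2 ^ \<gamma> / 2 ^ \<kappa>"

text \<open>The requirements of \<open>annealed_hitting_bound\<close> for one fixed horizontal walk
  \<open>s\<close>, with \<open>E\<close> the histories that stand at \<open>y\<close> at a
  horizontal time in block \<open>k\<close>.\<close>

definition is_potential :: "nat \<Rightarrow> site \<Rightarrow> site list \<Rightarrow> (site list \<Rightarrow> real) \<Rightarrow> bool" where
  "is_potential k y s v \<longleftrightarrow>
     (\<forall>l. 0 \<le> v l) \<and>
     (\<forall>l d. valid l \<longrightarrow> \<not> fresh l \<longrightarrow> take (hclock l) s = horizontals l \<longrightarrow> d \<in> horizontal_steps \<longrightarrow> v (d # l) \<le> v l) \<and>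
     (\<forall>l. valid l \<longrightarrow> fresh l \<longrightarrow> (v ((0, 0, 1) # l) + v ((0, 0, -1) # l)) / 2 \<le> v l) \<and>
     (\<forall>l. valid l \<longrightarrow> take (hclock l) s = horizontals l \<longrightarrow> sum_list l = y \<longrightarrow> 2 ^ k \<le> hclock l \<longrightarrow> hclock l < 2 ^ (k + 1) \<longrightarrow> 1 \<le> v l)"

context scales
begin

text \<open>The ratio \<open>R j / r j\<close>. Its exponent is \<open>\<gamma> / 2\<close> rounded
  up, so that its square dominates the window length divided by
  \<open>(rad j)\<^sup>2\<close>.\<close>

definition \<rho> :: nat where "\<rho> = 40 * 2 ^ ((\<gamma> + 1) div 2)"

lemma rho_ge: "1600 * 2 ^ \<gamma> \<le> \<rho>\<^sup>2"
proof -
  have "(2::nat) ^ \<gamma> \<le> 2 ^ ((\<gamma> + 1) div 2 * 2)" by (intro power_increasing) auto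
  then show ?thesis by (simp add: \<rho>_def power_mult_distrib power_mult)
qed

lemma windows_rich:
  assumes fh: "2 ^ k \<le> n"
  shows "windows s (rich s n) (lo n) (hi n) rad (\<lambda>j. \<rho> * rad j) (n + m') (1 - 1 / (4 * real \<rho>))"
proof
  have rich: "j \<in> {1..J}" if "j \<in> rich s n" for j using that by (simp add: rich_def)
  have bn: "b j < n" "2 * b (j + 1) \<le> b j" "0 < b (j + 1)" if "j \<in> {1..J}" for j
    using b_le[of j] b_Suc_le[of j] b_pos[of j] b_pos[of "j + 1"] that fh by auto
  have rp: "0 < rad j" for j by (simp add: rad_def)
  have rho: "40 \<le> \<rho>" by (simp add: \<rho>_def)
  show "finite (rich s n)" by (simp add: rich_def)
  fix j assume j: "j \<in> rich s n"
  note j' = rich[OF j]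
  show "0 < lo n j" "lo n j \<le> hi n j" "hi n j < n + m'"
    using bn[OF j'] b_pos[of "J + 1"] by (auto simp: lo_def hi_def m'_def)
  show "0 < rad j" by (rule rp)
  show "8 * rad j \<le> \<rho> * rad j" using rho by simp
  show "64 * (rad j)\<^sup>2 \<le> card (new_sites s (lo n j) (hi n j))" using j by (simp add: rich_def)
  show "1 - real (rad j) / (4 * real (\<rho> * rad j)) \<le> 1 - 1 / (4 * real \<rho>)"
    using rp[of j] by simp
  show "6 * (hi n j - lo n j + 1) \<le> (\<rho> * rad j)\<^sup>2"
  proof -
    have "hi n j - lo n j + 1 \<le> b j" using bn[OF j'] by (simp add: lo_def hi_def)
    also have "b j = 2 ^ \<gamma> * g j" using j' by (intro g_b) simp
    also have "\<dots> \<le> 2 ^ \<gamma> * (128 * (rad j)\<^sup>2)" using j' by (intro mult_left_mono rad_ge) auto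
    finally have "6 * (hi n j - lo n j + 1) \<le> 1600 * 2 ^ \<gamma> * (rad j)\<^sup>2" by simp
    also have "\<dots> \<le> \<rho>\<^sup>2 * (rad j)\<^sup>2" by (intro mult_right_mono rho_ge) simp
    finally show ?thesis by (simp add: power_mult_distrib)
  qed
  fix i h assume i: "i \<in> rich s n" and h: "lo n j \<le> h" "h \<le> hi n j" "lo n i \<le> h" "h \<le> hi n i"
  have False if "i \<in> {1..J}" "j \<in> {1..J}" "i < j" "lo n j \<le> h" "h \<le> hi n i" for i j
  proof -
    have "b j \<le> b (i + 1)" using that by (intro b_mono) simp
    moreover have "b (i + 1) < n" using bn[OF that(1)] by linarith
    ultimately show False using that by (simp add: lo_def hi_def)
  qed
  from this[of i j] this[of j i] show "j = i" using h j' rich[OF i] by (meson linorder_neqE_nat)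
next
  have "40 \<le> \<rho>" by (simp add: \<rho>_def)
  then show "0 \<le> 1 - 1 / (4 * real \<rho>)" by (simp add: field_simps)
qed

text \<open>A bad \<open>s\<close> gets the constant 1, and an \<open>s\<close> that misses the
  column during the block gets 0. In the remaining case every hit falls between \<open>n\<close> and
  \<open>n + m'\<close>, after all windows, and at least half of the windows are rich, so the
  potential of the rich windows works.\<close>

lemma potential_exists:
  assumes s: "s \<in> walks (2 ^ (k + 1))"
  shows "\<exists>v. is_potential k y s v \<and>
    v [] \<le> of_bool (bad (column y) s) + (exp (- real J / (8 * real \<rho>)) + 1152 * real J * 2 ^ \<gamma> / 2 ^ \<kappa>)"
proof -
  let ?x = "column y"
  have d0: "0 \<le> exp (- real J / (8 * real \<rho>)) + 1152 * real J * 2 ^ \<gamma> / 2 ^ \<kappa>" by simp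
  have hit: "loc s (hclock l) = ?x" if "valid l" "take (hclock l) s = horizontals l" "sum_list l = y" for l
    using column_sum_list[OF that(1)] that by simp
  consider "bad ?x s" | "\<not> bad ?x s" "\<nexists>n. first_hit ?x s n" | n where "\<not> bad ?x s" "first_hit ?x s n"
    by blast
  then show ?thesis
  proof cases
    case 1
    then show ?thesis using d0 by (intro exI[of _ "\<lambda>_. 1"]) (auto simp: is_potential_def)
  next
    case 2
    have "\<not> (2 ^ k \<le> h \<and> h < 2 ^ (k + 1) \<and> loc s h = ?x)" for h
    proof
      assume h: "2 ^ k \<le> h \<and> h < 2 ^ (k + 1) \<and> loc s h = ?x"
      define n where "n = (LEAST n. 2 ^ k \<le> n \<and> n < 2 ^ (k + 1) \<and> loc s n = ?x)"
      have "2 ^ k \<le> n \<and> n < 2 ^ (k + 1) \<and> loc s n = ?x"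
        unfolding n_def by (rule LeastI) (rule h)
      moreover have "loc s t \<noteq> ?x" if "t \<in> {2 ^ k..<n}" for t
        using not_less_Least[of t] that calculation unfolding n_def[symmetric]
        by (metis (mono_tags, lifting) atLeastLessThan_iff n_def not_less_Least order_less_trans)
      ultimately show False using 2 by (auto simp: first_hit_def)
    qed
    then show ?thesis using 2 d0 hit by (intro exI[of _ "\<lambda>_. 0"]) (fastforce simp: is_potential_def)
  next
    case 3
    have n: "2 ^ k \<le> n" "loc s n = ?x" using 3(2) by (auto simp: first_hit_def)
    interpret windows s "height y" "rich s n" "lo n" "hi n" rad "\<lambda>j. \<rho> * rad j" "n + m'" "1 - 1 / (4 * real \<rho>)"
      by (rule windows_rich) (rule n)
    have rich: "j \<in> {1..J}" if "j \<in> rich s n" for j using that by (simp add: rich_def)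
    have rho: "40 \<le> \<rho>" by (simp add: \<rho>_def)
    have "potential [] \<le> exp (- real J / (8 * real \<rho>)) + 1152 * real J * 2 ^ \<gamma> / 2 ^ \<kappa>"
      unfolding potential_Nil
    proof (rule add_mono)
      have "1 - 1 / (4 * real \<rho>) \<le> exp (- 1 / (4 * real \<rho>))"
        using exp_ge_add_one_self[of "- 1 / (4 * real \<rho>)"] by simp
      then have "(1 - 1 / (4 * real \<rho>)) ^ card (rich s n) \<le> exp (- 1 / (4 * real \<rho>)) ^ card (rich s n)"
        by (intro power_mono \<theta>_nonneg)
      also have "\<dots> = exp (real (card (rich s n)) * (- 1 / (4 * real \<rho>)))"
        by (rule exp_of_nat_mult[symmetric])
      also have "\<dots> \<le> exp (- real J / (8 * real \<rho>))"
      proof -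
        have "J \<le> 2 * card (rich s n)" using 3 by (auto simp: bad_def)
        then have "real J \<le> 2 * real (card (rich s n))" by linarith
        then show ?thesis using rho by (simp add: field_simps)
      qed
      finally show "(1 - 1 / (4 * real \<rho>)) ^ card (rich s n) \<le> exp (- real J / (8 * real \<rho>))" .
      have "(\<Sum>j\<in>rich s n. 3 * (real (n + m') - real (hi n j)) / (real (rad j))\<^sup>2)
        \<le> (\<Sum>j\<in>rich s n. 1152 * 2 ^ \<gamma> / 2 ^ \<kappa>)"
      proof (rule sum_mono)
        fix j assume "j \<in> rich s n"
        then have j: "j \<in> {1..J}" by (rule rich)
        have "b (j + 1) < n" using b_le[of j] b_Suc_le[of j] b_pos[of j] b_pos[of "j + 1"] j n(1) by auto
        \<comment> \<open>The time left after window \<open>j\<close> is at most three times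
          \<open>b (j + 1)\<close>, which is smaller than \<open>b j\<close> by the factor
          \<open>2 ^ \<kappa>\<close>.\<close>
        then have "real (n + m') - real (hi n j) = real m' + real (b (j + 1)) + 1"
          by (simp add: hi_def)
        moreover have "m' \<le> b (j + 1)" unfolding m'_def using j by (intro b_mono) simp
        moreover have "1 \<le> b (j + 1)" using b_pos[of "j + 1"] by simp
        ultimately have num: "real (n + m') - real (hi n j) \<le> 3 * real (b (j + 1))" by linarith
        have "2 ^ \<kappa> * b (j + 1) = 2 ^ \<gamma> * g j"
          using b_Suc[of j] g_b[of j] j by simp
        also have "\<dots> \<le> 2 ^ \<gamma> * (128 * (rad j)\<^sup>2)" using j by (intro mult_left_mono rad_ge) auto
        finally have "real (2 ^ \<kappa> * b (j + 1)) \<le> real (2 ^ \<gamma> * (128 * (rad j)\<^sup>2))" by (simp only: of_nat_le_iff)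
        then have "2 ^ \<kappa> * real (b (j + 1)) \<le> 2 ^ \<gamma> * 128 * (real (rad j))\<^sup>2" by simp
        then have "9 * real (b (j + 1)) \<le> 1152 * 2 ^ \<gamma> / 2 ^ \<kappa> * (real (rad j))\<^sup>2"
          by (simp add: field_simps)
        moreover have "3 * (real (n + m') - real (hi n j)) \<le> 9 * real (b (j + 1))"
          using mult_left_mono[OF num, of 3] by simp
        ultimately have "3 * (real (n + m') - real (hi n j)) \<le> 1152 * 2 ^ \<gamma> / 2 ^ \<kappa> * (real (rad j))\<^sup>2"
          by (rule order_trans[rotated])
        then show "3 * (real (n + m') - real (hi n j)) / (real (rad j))\<^sup>2 \<le> 1152 * 2 ^ \<gamma> / 2 ^ \<kappa>"
          by (simp add: rad_def divide_le_eq)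
      qed
      also have "\<dots> = real (card (rich s n)) * (1152 * 2 ^ \<gamma> / 2 ^ \<kappa>)" by simp
      also have "\<dots> \<le> real J * (1152 * 2 ^ \<gamma> / 2 ^ \<kappa>)"
      proof (rule mult_right_mono)
        have "card (rich s n) \<le> card {1..J}" by (intro card_mono) (auto simp: rich_def)
        then show "real (card (rich s n)) \<le> real J" by simp
      qed simp
      finally show "(\<Sum>j\<in>rich s n. 3 * (real (n + m') - real (hi n j)) / (real (rad j))\<^sup>2)
        \<le> 1152 * real J * 2 ^ \<gamma> / 2 ^ \<kappa>" by (simp add: mult_ac)
    qed
    moreover have "is_potential k y s potential"
      unfolding is_potential_def
    proof (intro conjI allI impI)
      fix l assume l: "valid l" "take (hclock l) s = horizontals l" "sum_list l = y" "2 ^ k \<le> hclock l" "hclock l < 2 ^ (k + 1)"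
      have h: "loc s (hclock l) = ?x" using hit l by blast
      have "n \<le> hclock l"
      proof (rule ccontr)
        assume "\<not> n \<le> hclock l"
        then have "hclock l \<in> {2 ^ k..<n}" using l by simp
        then show False using 3(2) h unfolding first_hit_def by blast
      qed
      moreover have "hclock l < n + m'"
      proof (rule ccontr)
        assume "\<not> hclock l < n + m'"
        then have "hclock l \<in> {n + m'..<2 ^ (k + 1)}" using l by simp
        then show False using 3 h unfolding bad_def by blast
      qed
      moreover have "0 < n" using n(1) by (rule less_le_trans[rotated]) simp
      ultimately show "1 \<le> potential l"
        using l(3) by (intro potential_hit) (auto simp: offset_def hi_def)
    qed (blast intro: potential_nonneg potential_vertical potential_horizontal)+
    ultimately show ?thesis by (intro exI[of _ potential]) auto
  qed
qed

lemma mean_potential_exists: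
  "\<exists>v. (\<forall>s\<in>walks (2 ^ (k + 1)). is_potential k y s (v s)) \<and>
    mean (2 ^ (k + 1)) (\<lambda>s. v s []) \<le> potential_bound k \<kappa> \<gamma> J"
proof -
  let ?N = "2 ^ (k + 1)"
  let ?d = "exp (- real J / (8 * real \<rho>)) + 1152 * real J * 2 ^ \<gamma> / 2 ^ \<kappa>"
  have "\<forall>s\<in>walks ?N. \<exists>v. is_potential k y s v \<and> v [] \<le> of_bool (bad (column y) s) + ?d"
    using potential_exists by blast
  from bchoice[OF this] obtain v
    where v: "\<forall>s\<in>walks ?N. is_potential k y s (v s) \<and> v s [] \<le> of_bool (bad (column y) s) + ?d"
    by blast
  have "mean ?N (\<lambda>s. v s []) \<le> mean ?N (\<lambda>s. of_bool (bad (column y) s) + ?d)"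
    using v by (intro mean_mono) blast
  also have "\<dots> = mean ?N (\<lambda>s. of_bool (bad (column y) s)) + ?d"
    unfolding mean_add by simp
  also have "\<dots> \<le> real m' / 2 ^ k + 64 / k * \<epsilon> + 192 * (real (\<kappa> * (J + 1)) + 4) / (real k + 1)\<^sup>2 + ?d"
    by (intro add_right_mono bad_prob)
  also have "real m' / 2 ^ k \<le> 1 / 2 ^ \<kappa>"
  proof -
    have "\<kappa> \<le> \<kappa> * (J + 1)" "\<kappa> * (J + 1) + \<beta> (J + 1) = k - 1"
      using beta_bounds[of "J + 1"] by auto
    then have "\<kappa> + \<beta> (J + 1) \<le> k" by linarith
    then have "(2::nat) ^ (\<kappa> + \<beta> (J + 1)) \<le> 2 ^ k" by (intro power_increasing) auto
    then have "2 ^ \<kappa> * m' \<le> 2 ^ k" unfolding m'_def b_def by (simp add: power_add)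
    then have "real (2 ^ \<kappa> * m') \<le> real (2 ^ k)" by (simp only: of_nat_le_iff)
    then show ?thesis by (simp add: field_simps)
  qed
  finally have "mean ?N (\<lambda>s. v s []) \<le> potential_bound k \<kappa> \<gamma> J"
    unfolding potential_bound_def \<epsilon>_def \<rho>_def by (simp add: add.assoc)
  with v show ?thesis by blast
qed

end

section \<open>Hitting a vertex during a dyadic block of horizontal time\<close>

context self_interacting_walk
begin

definition block_hit :: "site \<Rightarrow> nat \<Rightarrow> 'a set" where
  "block_hit y k = {\<omega> \<in> space M. W 0 \<omega> = 0 \<and>
     (\<exists>t. history W t \<omega> \<in> {l. sum_list l = y \<and> 2 ^ k \<le> hclock l \<and> hclock l < 2 ^ (k + 1)})}"

lemma block_hit_sets [measurable]: "block_hit y k \<in> sets M"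
proof -
  note measurable_walk [measurable]
  show ?thesis unfolding block_hit_def by measurable
qed

lemma prob_block_hit:
  assumes "scales k \<kappa> \<gamma> J"
  shows "prob (block_hit y k) \<le> potential_bound k \<kappa> \<gamma> J"
proof -
  let ?N = "2 ^ (k + 1) :: nat"
  obtain v where v: "\<And>s. s \<in> walks ?N \<Longrightarrow> is_potential k y s (v s)"
    and le: "mean ?N (\<lambda>s. v s []) \<le> potential_bound k \<kappa> \<gamma> J"
    using scales.mean_potential_exists[OF assms, of y] by blast
  have "prob (block_hit y k) \<le> mean ?N (\<lambda>s. v s [])"
    unfolding block_hit_def
  proof (rule annealed_hitting_bound)
    fix s l assume s: "s \<in> walks ?N" and l: "valid l"
    note p = v[OF s, unfolded is_potential_def]
    show "0 \<le> v s l" using p by blast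
    show "v s (s ! hclock l # l) \<le> v s l" if "\<not> fresh l" "hclock l < ?N" "take (hclock l) s = horizontals l"
    proof -
      have "s ! hclock l \<in> set s" using that length_walks[OF s] by simp
      then have "s ! hclock l \<in> horizontal_steps" using s by (auto simp: walks_def)
      then show ?thesis using p l that by blast
    qed
    show "(v s ((0, 0, 1) # l) + v s ((0, 0, -1) # l)) / 2 \<le> v s l" if "fresh l"
      using p l that by blast
    show "1 \<le> v s l" if "take (hclock l) s = horizontals l" "l \<in> {l. sum_list l = y \<and> 2 ^ k \<le> hclock l \<and> hclock l < ?N}"
      using p l that by blast
  qed auto
  with le show ?thesis by linarith
qed

end

section \<open>Choice of the parameters and summability over the blocks\<close>

lemma scales_parameters:
  assumes \<kappa>: "4 \<le> \<kappa>" "\<kappa> ^ 8 \<le> k" "k < (\<kappa> + 1) ^ 8"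
  obtains \<gamma> where "scales k \<kappa> \<gamma> (\<kappa> ^ 6)" "2 ^ \<gamma> \<le> 2 * (k + 1) * \<kappa>" "\<gamma> \<le> 9 * \<kappa> + 1"
proof -
  have p9: "y ^ 9 = y ^ 8 * y" for y :: nat
    using power_add[of y 8 1] by simp
  \<comment> \<open>Minimality keeps \<open>2 ^ \<gamma>\<close> within a factor 2 of
    \<open>(k + 1) * \<kappa>\<close>, hence polynomial in \<open>\<kappa>\<close>.\<close>
  define \<gamma> where "\<gamma> = (LEAST c. (k + 1) * \<kappa> \<le> 2 ^ c)"
  have ge: "(k + 1) * \<kappa> \<le> 2 ^ \<gamma>"
    unfolding \<gamma>_def by (rule LeastI[of _ "(k + 1) * \<kappa>"]) (simp add: less_imp_le)
  have "2 ^ 2 < (2::nat) ^ \<gamma>"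
  proof -
    have "4 ^ 8 \<le> \<kappa> ^ 8" using \<kappa> by (intro power_mono) auto
    then have "(8::nat) \<le> (k + 1) * 1" using \<kappa>(2) by simp
    also have "\<dots> \<le> (k + 1) * \<kappa>" using \<kappa> by (intro mult_left_mono) auto
    finally show ?thesis using ge by simp
  qed
  then have "3 \<le> \<gamma>" using power_less_imp_less_exp[of "2::nat" 2 \<gamma>] by simp
  then obtain c where c: "\<gamma> = Suc c" by (cases \<gamma>) auto
  then have "\<not> (k + 1) * \<kappa> \<le> 2 ^ c" using not_less_Least[of c "\<lambda>c. (k + 1) * \<kappa> \<le> 2 ^ c"] unfolding \<gamma>_def by simp
  then have le: "2 ^ \<gamma> \<le> 2 * (k + 1) * \<kappa>" using c by simp
  have "\<kappa> + 1 \<le> 2 ^ \<kappa>" by (induction \<kappa>) auto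
  have "2 * (k + 1) * \<kappa> \<le> 2 * (\<kappa> + 1) ^ 8 * (\<kappa> + 1)"
    using \<kappa> by (intro mult_mono) auto
  also have "\<dots> = 2 * (\<kappa> + 1) ^ 9" by (simp only: p9 mult.assoc)
  also have "\<dots> \<le> 2 * (2 ^ \<kappa>) ^ 9"
    using \<open>\<kappa> + 1 \<le> 2 ^ \<kappa>\<close> by (intro mult_left_mono power_mono) auto
  also have "\<dots> = 2 ^ (9 * \<kappa> + 1)" by (simp add: power_mult[symmetric] mult.commute)
  finally have "2 ^ \<gamma> \<le> (2::nat) ^ (9 * \<kappa> + 1)" using le by linarith
  then have \<gamma>_le: "\<gamma> \<le> 9 * \<kappa> + 1" by (rule power_le_imp_le_exp[rotated]) simp
  have "2 * (\<kappa> * (\<kappa> ^ 6 + 1) + \<gamma> + 8) \<le> k"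
  proof -
    have "4 * \<kappa> ^ 7 \<le> \<kappa> * \<kappa> ^ 7" using \<kappa> by (intro mult_right_mono) auto
    then have "4 * \<kappa> ^ 7 \<le> k" using \<kappa>(2) by (simp add: power_Suc[symmetric])
    moreover have "4 ^ 6 * \<kappa> \<le> \<kappa> ^ 6 * \<kappa>" using \<kappa> by (intro mult_right_mono power_mono) auto
    then have "4096 * \<kappa> \<le> \<kappa> ^ 7" by (simp add: power_Suc2[symmetric])
    moreover have "\<kappa> * (\<kappa> ^ 6 + 1) = \<kappa> ^ 7 + \<kappa>" by (simp add: power_Suc[symmetric] distrib_left)
    then have "2 * (\<kappa> * (\<kappa> ^ 6 + 1) + \<gamma> + 8) = 2 * \<kappa> ^ 7 + 2 * \<kappa> + 2 * \<gamma> + 16" by simp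
    moreover have "2 * p + 2 * \<kappa> + 2 * \<gamma> + 16 \<le> k" if "4 * p \<le> k" "4096 * \<kappa> \<le> p" for p
      using that \<gamma>_le \<kappa>(1) by linarith
    then have "2 * \<kappa> ^ 7 + 2 * \<kappa> + 2 * \<gamma> + 16 \<le> k"
      using \<open>4 * \<kappa> ^ 7 \<le> k\<close> \<open>4096 * \<kappa> \<le> \<kappa> ^ 7\<close> by blast
    ultimately show ?thesis by (simp only:)
  qed
  then have "scales k \<kappa> \<gamma> (\<kappa> ^ 6)"
    using \<kappa> ge \<open>3 \<le> \<gamma>\<close> by unfold_locales auto
  then show thesis using le \<gamma>_le by (rule that)
qed

text \<open>With \<open>J = \<kappa> ^ 6\<close> and \<open>k\<close> of order
  \<open>\<kappa> ^ 8\<close>, the product \<open>\<kappa> * J\<close> is of order at most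
  \<open>k / \<kappa>\<close>, while \<open>J\<close> exceeds the square root of
  \<open>2 ^ \<gamma>\<close> by at least order \<open>\<kappa>\<close>. So the polynomial terms are
  of order \<open>1 / (k * \<kappa>)\<close> and the rest decays exponentially in
  \<open>\<kappa>\<close> up to powers.\<close>

lemma potential_bound_le:
  assumes \<kappa>: "4 \<le> \<kappa>" "\<kappa> ^ 8 \<le> k" "k < (\<kappa> + 1) ^ 8"
    and \<gamma>: "2 ^ \<gamma> \<le> 2 * (k + 1) * \<kappa>" "\<gamma> \<le> 9 * \<kappa> + 1"
  shows "potential_bound k \<kappa> \<gamma> (\<kappa> ^ 6) \<le> 200000 / (real k * real \<kappa>) +
    (1 / 2 ^ \<kappa> + exp (- real \<kappa> / 40960) + 1179648 * 2 * real \<kappa> ^ 15 / 2 ^ \<kappa>)"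
proof -
  define x where "x = real \<kappa>"
  have x: "4 \<le> x" using \<kappa> by (simp add: x_def)
  have "real (\<kappa> ^ 8) \<le> real k" using \<kappa>(2) by (simp only: of_nat_le_iff)
  then have k: "x ^ 8 \<le> real k" by (simp add: x_def)
  have k0: "0 < real k" using k x by (smt (verit) zero_less_power)
  have "k + 1 \<le> (2 * \<kappa>) ^ 8"
  proof -
    have "k + 1 \<le> (\<kappa> + 1) ^ 8" using \<kappa>(3) by simp
    also have "\<dots> \<le> (2 * \<kappa>) ^ 8" using \<kappa>(1) by (intro power_mono) auto
    finally show ?thesis .
  qed
  then have "2 * (k + 1) * \<kappa> \<le> 2 * (2 * \<kappa>) ^ 8 * \<kappa>" by (intro mult_mono) auto
  then have "2 ^ \<gamma> \<le> 512 * \<kappa> ^ 9" using \<gamma>(1) power_add[of \<kappa> 8 1] by (simp add: power_mult_distrib)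
  then have "real (2 ^ \<gamma>) \<le> real (512 * \<kappa> ^ 9)" by (simp only: of_nat_le_iff)
  then have two_gamma: "2 ^ \<gamma> \<le> 512 * x ^ 9" by (simp add: x_def)
  have pow: "x * x ^ 6 = x ^ 7" "x * x ^ 7 = x ^ 8" "x * x ^ 8 = x ^ 9" "x ^ 6 * x ^ 9 = x ^ 15" "x * x ^ 5 = x ^ 6"
    by (simp_all add: power_Suc[symmetric] power_add[symmetric])
  have x7: "x \<le> x ^ 7" "1 \<le> x ^ 7" using x self_le_power[of x 7] one_le_power[of x 7] by auto
  have "64 / real k * (16 / x + 128 * (real (\<kappa> * \<kappa> ^ 6 + \<gamma>) + 4) / (real k + 1)) \<le> 64 / real k * (16 / x + 128 * (15 / x))"
  proof -
    have "real (\<kappa> * \<kappa> ^ 6 + \<gamma>) + 4 \<le> x ^ 7 + 9 * x + 5"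
      using \<gamma>(2) pow(1) by (simp add: x_def)
    also have "\<dots> \<le> 15 * x ^ 7" using x7 by linarith
    finally have "(real (\<kappa> * \<kappa> ^ 6 + \<gamma>) + 4) / (real k + 1) \<le> 15 * x ^ 7 / x ^ 8"
      using k x by (intro frac_le) auto
    also have "15 * x ^ 7 / x ^ 8 = 15 / x" using x pow(2)[symmetric] by simp
    finally have "128 * (real (\<kappa> * \<kappa> ^ 6 + \<gamma>) + 4) / (real k + 1) \<le> 128 * (15 / x)"
      by (subst times_divide_eq_right[symmetric]) (rule mult_left_mono, simp_all)
    then show ?thesis by (intro mult_left_mono add_left_mono) auto
  qed
  also have "\<dots> = 123904 / (real k * x)" by (simp add: field_simps)
  finally have t2: "64 / real k * (16 / x + 128 * (real (\<kappa> * \<kappa> ^ 6 + \<gamma>) + 4) / (real k + 1)) \<le> 123904 / (real k * x)" .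
  have "192 * (real (\<kappa> * (\<kappa> ^ 6 + 1)) + 4) / (real k + 1)\<^sup>2 \<le> 192 * (6 * x ^ 7) / (real k * x ^ 8)"
  proof (rule frac_le)
    have "real (\<kappa> * (\<kappa> ^ 6 + 1)) = x ^ 7 + x" using pow(1) by (simp add: x_def distrib_left)
    then have "real (\<kappa> * (\<kappa> ^ 6 + 1)) + 4 \<le> 6 * x ^ 7" using x7 by linarith
    then show "192 * (real (\<kappa> * (\<kappa> ^ 6 + 1)) + 4) \<le> 192 * (6 * x ^ 7)" by (rule mult_left_mono) simp
    show "real k * x ^ 8 \<le> (real k + 1)\<^sup>2"
      unfolding power2_eq_square using k x by (intro mult_mono) auto
  qed (use x k0 in auto)
  also have "\<dots> = 1152 / (real k * x)" using x pow(2)[symmetric] by simp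
  finally have t3: "192 * (real (\<kappa> * (\<kappa> ^ 6 + 1)) + 4) / (real k + 1)\<^sup>2 \<le> 1152 / (real k * x)" .
  have t4: "exp (- real (\<kappa> ^ 6) / (320 * 2 ^ ((\<gamma> + 1) div 2))) \<le> exp (- x / 40960)"
  proof -
    define p where "p = (2::real) ^ ((\<gamma> + 1) div 2)"
    have p0: "0 < p" by (simp add: p_def)
    have "p\<^sup>2 = 2 ^ ((\<gamma> + 1) div 2 * 2)" by (simp add: p_def power_mult)
    also have "\<dots> \<le> 2 ^ (\<gamma> + 1)" by (intro power_increasing) auto
    also have "\<dots> \<le> 1024 * x ^ 9" using two_gamma by simp
    \<comment> \<open>Raising the exponent to 10 makes the right-hand side a perfect square.\<close>
    also have "\<dots> \<le> 1024 * x ^ 10" using x by (intro mult_left_mono power_increasing) auto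
    also have "\<dots> = (32 * x ^ 5)\<^sup>2" by (simp add: power_mult_distrib power_mult[symmetric])
    finally have "p \<le> 32 * x ^ 5" by (rule power2_le_imp_le) (use x in simp)
    then have "x * (320 * p) \<le> x * (320 * (32 * x ^ 5))" using x by (intro mult_left_mono) auto
    also have "\<dots> = 10240 * x ^ 6" using pow(5) by (simp add: mult_ac)
    also have "\<dots> \<le> 40960 * x ^ 6" using x by simp
    finally have "x / 40960 \<le> x ^ 6 / (320 * p)" using p0 by (simp add: field_simps)
    then show ?thesis by (simp add: p_def x_def)
  qed
  have t5: "1152 * real (\<kappa> ^ 6) * 2 ^ \<gamma> / 2 ^ \<kappa> \<le> 1179648 * 2 * x ^ 15 / 2 ^ \<kappa>"
  proof (rule divide_right_mono)
    have "1152 * x ^ 6 * 2 ^ \<gamma> \<le> 1152 * x ^ 6 * (512 * x ^ 9)"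
      using two_gamma x by (intro mult_left_mono) auto
    then have "1152 * real (\<kappa> ^ 6) * 2 ^ \<gamma> \<le> 1152 * x ^ 6 * (512 * x ^ 9)"
      by (simp only: x_def of_nat_power)
    also have "\<dots> = 589824 * x ^ 15" using pow(4) by (simp add: mult_ac)
    also have "\<dots> \<le> 1179648 * 2 * x ^ 15" using x by simp
    finally show "1152 * real (\<kappa> ^ 6) * 2 ^ \<gamma> \<le> 1179648 * 2 * x ^ 15" .
  qed simp
  have "123904 / (real k * x) + 1152 / (real k * x) \<le> 200000 / (real k * x)"
    using k0 x by (simp add: add_divide_distrib[symmetric] divide_right_mono)
  with t2 t3 t4 t5 show ?thesis unfolding potential_bound_def x_def by linarith
qed

text \<open>\<open>\<kappa>\<close> is the integer part of the eighth root of \<open>k\<close>, so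
  \<open>k * \<kappa>\<close> is at least half of \<open>k powr (9 / 8)\<close>, an exponent above
  1.\<close>

lemma eventually_potential_bound:
  obtains C where "\<forall>\<^sub>F k in sequentially. \<exists>\<kappa> \<gamma> J. scales k \<kappa> \<gamma> J \<and> potential_bound k \<kappa> \<gamma> J \<le> C * real k powr (- 9 / 8)"
proof -
  let ?T = "\<lambda>\<kappa>::nat. 1 / 2 ^ \<kappa> + exp (- real \<kappa> / 40960) + 1179648 * 2 * real \<kappa> ^ 15 / 2 ^ \<kappa>"
  \<comment> \<open>The power 9 appears because \<open>k * \<kappa>\<close> is at most
    \<open>256 * \<kappa> ^ 9\<close>.\<close>
  have "(\<lambda>\<kappa>. real \<kappa> ^ 9 * ?T \<kappa>) \<longlonglongrightarrow> 0"
  proof -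
    have "(\<lambda>\<kappa>. real \<kappa> ^ 9 * (1 / 2 ^ \<kappa>)) \<longlonglongrightarrow> 0" by real_asymp
    moreover have "(\<lambda>\<kappa>. real \<kappa> ^ 9 * exp (- real \<kappa> / 40960)) \<longlonglongrightarrow> 0" by real_asymp
    moreover have "(\<lambda>\<kappa>. real \<kappa> ^ 9 * (1179648 * 2 * real \<kappa> ^ 15 / 2 ^ \<kappa>)) \<longlonglongrightarrow> 0" by real_asymp
    ultimately have "(\<lambda>\<kappa>. real \<kappa> ^ 9 * (1 / 2 ^ \<kappa>) + real \<kappa> ^ 9 * exp (- real \<kappa> / 40960) +
        real \<kappa> ^ 9 * (1179648 * 2 * real \<kappa> ^ 15 / 2 ^ \<kappa>)) \<longlonglongrightarrow> 0 + 0 + 0"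
      by (intro tendsto_add)
    then show ?thesis by (simp only: distrib_left add_0_right)
  qed
  then have "\<forall>\<^sub>F \<kappa> in sequentially. real \<kappa> ^ 9 * ?T \<kappa> < 1" by (rule order_tendstoD) simp
  then obtain K where K: "\<And>\<kappa>. K \<le> \<kappa> \<Longrightarrow> real \<kappa> ^ 9 * ?T \<kappa> < 1"
    by (auto simp: eventually_sequentially)
  have "\<exists>\<kappa> \<gamma> J. scales k \<kappa> \<gamma> J \<and> potential_bound k \<kappa> \<gamma> J \<le> 401024 * real k powr (- 9 / 8)"
    if k: "(max K 4 + 1) ^ 8 \<le> k" for k
  proof -
    define \<kappa> where "\<kappa> = (LEAST i. k < (i + 1) ^ 8)"
    have "k < (k + 1) ^ 8" using self_le_power[of "k + 1" 8] by linarith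
    then have up: "k < (\<kappa> + 1) ^ 8" unfolding \<kappa>_def by (rule LeastI)
    then have "(max K 4 + 1) ^ 8 < (\<kappa> + 1) ^ 8" using k by linarith
    then have big: "max K 4 < \<kappa>" using power_less_imp_less_base[of "max K 4 + 1" 8 "\<kappa> + 1"] by simp
    then obtain i where i: "\<kappa> = Suc i" by (cases \<kappa>) auto
    then have "\<not> k < (i + 1) ^ 8" using not_less_Least[of i "\<lambda>i. k < (i + 1) ^ 8"] unfolding \<kappa>_def by simp
    then have low: "\<kappa> ^ 8 \<le> k" using i by simp
    have \<kappa>4: "4 \<le> \<kappa>" using big by simp
    obtain \<gamma> where \<gamma>: "scales k \<kappa> \<gamma> (\<kappa> ^ 6)" "2 ^ \<gamma> \<le> 2 * (k + 1) * \<kappa>" "\<gamma> \<le> 9 * \<kappa> + 1"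
      by (rule scales_parameters[OF \<kappa>4 low up])
    have k0: "0 < real k" using low \<kappa>4 by (metis gr0I less_le_trans of_nat_0_less_iff zero_less_numeral zero_less_power)
    have kk: "real k powr (1 / 8) \<le> 2 * real \<kappa>"
    proof -
      have "k \<le> (2 * \<kappa>) ^ 8"
        using less_imp_le[OF up] power_mono[of "\<kappa> + 1" "2 * \<kappa>" 8] \<kappa>4 by linarith
      then have "real k \<le> real ((2 * \<kappa>) ^ 8)" by (simp only: of_nat_le_iff)
      then have "real k \<le> (2 * real \<kappa>) powr 8" using \<kappa>4 by (simp add: powr_numeral)
      then have "real k powr (1 / 8) \<le> ((2 * real \<kappa>) powr 8) powr (1 / 8)"
        by (intro powr_mono2) auto
      also have "\<dots> = 2 * real \<kappa>" unfolding powr_powr using \<kappa>4 by simp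
      finally show ?thesis .
    qed
    have inv: "1 / (real k * real \<kappa>) \<le> 2 * real k powr (- 9 / 8)"
    proof -
      have "real k powr (9 / 8) = real k powr (1 + 1 / 8)" by simp
      also have "\<dots> = real k * real k powr (1 / 8)" using k0 by (simp only: powr_add) simp
      also have "\<dots> \<le> real k * (2 * real \<kappa>)" using kk k0 by (intro mult_left_mono) auto
      finally have "real k powr (9 / 8) \<le> 2 * (real k * real \<kappa>)" by simp
      moreover have "0 < real k powr (9 / 8)" using k0 by simp
      ultimately have "1 / (real k * real \<kappa>) \<le> 2 / real k powr (9 / 8)"
        using k0 \<kappa>4 by (simp add: field_simps)
      also have "\<dots> = 2 * real k powr (- 9 / 8)" using powr_minus_divide[of "real k" "9 / 8"] by simp
      finally show ?thesis .
    qed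
    have "?T \<kappa> \<le> 512 / (real k * real \<kappa>)"
    proof -
      have "k \<le> (2 * \<kappa>) ^ 8"
        using less_imp_le[OF up] power_mono[of "\<kappa> + 1" "2 * \<kappa>" 8] \<kappa>4 by linarith
      then have "real k \<le> real ((2 * \<kappa>) ^ 8)" by (simp only: of_nat_le_iff)
      then have "real k \<le> 256 * real \<kappa> ^ 8" by (simp add: power_mult_distrib)
      then have "real k * real \<kappa> \<le> 256 * real \<kappa> ^ 8 * real \<kappa>" by (intro mult_right_mono) auto
      moreover have "256 * real \<kappa> ^ 8 * real \<kappa> = 256 * real \<kappa> ^ 9"
        using power_add[of "real \<kappa>" 8 1] by simp
      ultimately have "real k * real \<kappa> \<le> 256 * real \<kappa> ^ 9" by (simp only:)
      then have "real k * real \<kappa> * ?T \<kappa> \<le> 256 * real \<kappa> ^ 9 * ?T \<kappa>" by (intro mult_right_mono) auto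
      also have "\<dots> \<le> 512" using K[of \<kappa>] big by simp
      finally show ?thesis using k0 \<kappa>4 by (simp add: field_simps)
    qed
    then have "potential_bound k \<kappa> \<gamma> (\<kappa> ^ 6) \<le> 200000 / (real k * real \<kappa>) + 512 / (real k * real \<kappa>)"
      using potential_bound_le[OF \<kappa>4 low up \<gamma>(2,3)] by linarith
    also have "\<dots> = 200512 * (1 / (real k * real \<kappa>))" by (simp add: add_divide_distrib[symmetric])
    also have "\<dots> \<le> 200512 * (2 * real k powr (- 9 / 8))" by (intro mult_left_mono inv) simp
    finally show ?thesis using \<gamma>(1) by (intro exI[of _ \<kappa>] exI[of _ \<gamma>] exI[of _ "\<kappa> ^ 6"]) simp
  qed
  then show thesis by (intro that[of 401024]) (auto simp: eventually_sequentially)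
qed

section \<open>Finitely many visits to each vertex, and transience\<close>

context self_interacting_walk
begin

text \<open>Borel-Cantelli over the dyadic blocks, the hitting probabilities being summable in
  \<open>k\<close>.\<close>

lemma AE_eventually_not_block_hit: "AE \<omega> in M. \<forall>\<^sub>F k in sequentially. \<omega> \<notin> block_hit y k"
proof -
  obtain C where C: "\<forall>\<^sub>F k in sequentially. \<exists>\<kappa> \<gamma> J. scales k \<kappa> \<gamma> J \<and> potential_bound k \<kappa> \<gamma> J \<le> C * real k powr (- 9 / 8)"
    by (rule eventually_potential_bound)
  have "\<forall>\<^sub>F k in sequentially. norm (prob (block_hit y k)) \<le> C * real k powr (- 9 / 8)"
    using C
  proof eventually_elim
    case (elim k)
    then obtain \<kappa> \<gamma> J where "scales k \<kappa> \<gamma> J" "potential_bound k \<kappa> \<gamma> J \<le> C * real k powr (- 9 / 8)" by blast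
    then show ?case using prob_block_hit[of k \<kappa> \<gamma> J y] by simp
  qed
  moreover have "summable (\<lambda>k. C * real k powr (- 9 / 8))"
    by (intro summable_mult) (simp add: summable_real_powr_iff)
  ultimately have "summable (\<lambda>k. prob (block_hit y k))"
    by (rule summable_comparison_test_ev)
  then have "AE \<omega> in M. \<forall>\<^sub>F k in sequentially. \<omega> \<in> space M - block_hit y k"
    by (intro borel_cantelli_AE1) (auto simp: emeasure_eq_measure)
  then show ?thesis by (rule AE_mp) (auto intro!: AE_I2 elim!: eventually_mono)
qed

lemma visited_history: "W 0 \<omega> = 0 \<Longrightarrow> visited (history W t \<omega>) = (\<lambda>s. W s \<omega>) ` {..<t}"
  by (induction t) (simp_all add: sum_list_history lessThan_Suc)

text \<open>Each visit to \<open>y\<close> after the first is followed by a horizontal step, so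
  these visits happen at distinct horizontal times. The absence of late block hits bounds those
  times, which leaves only finitely many visits.\<close>

lemma finite_visits:
  assumes w: "\<omega> \<in> space M" "W 0 \<omega> = 0" and ev: "\<forall>\<^sub>F k in sequentially. \<omega> \<notin> block_hit y k"
  shows "finite {t. W t \<omega> = y}"
proof (cases "\<exists>t. W t \<omega> = y")
  case True
  define t0 where "t0 = (LEAST t. W t \<omega> = y)"
  have t0: "W t0 \<omega> = y" unfolding t0_def using True by (rule LeastI_ex)
  let ?h = "\<lambda>t. hclock (history W t \<omega>)"
  have mono: "mono ?h" by (intro mono_iff_le_Suc[THEN iffD2]) auto
  let ?V = "{t. W t \<omega> = y \<and> t0 < t}"
  have jump: "?h (Suc t) = Suc (?h t)" if "t \<in> ?V" for t
  proof -
    have "W t \<omega> \<in> (\<lambda>s. W s \<omega>) ` {..<t}" using that t0 by (intro image_eqI[of _ _ t0]) auto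
    then have "\<not> fresh (history W t \<omega>)"
      using w by (simp add: fresh_def sum_list_history visited_history)
    then show ?thesis by simp
  qed
  have inj: "inj_on ?h ?V"
  proof (rule linorder_inj_onI)
    fix t t' assume t: "t < t'" "t \<in> ?V"
    then have "?h (Suc t) \<le> ?h t'" using monoD[OF mono, of "Suc t" t'] by simp
    then show "?h t \<noteq> ?h t'" using jump[OF t(2)] by simp
  qed auto
  obtain K where K: "\<And>k. K \<le> k \<Longrightarrow> \<omega> \<notin> block_hit y k"
    using ev by (auto simp: eventually_sequentially)
  have "?h t < 2 ^ K" if "t \<in> ?V" for t
  proof (rule ccontr)
    assume big: "\<not> ?h t < 2 ^ K"
    define k where "k = (LEAST k. ?h t < 2 ^ (k + 1))"
    have "?h t < 2 ^ ?h t" by (rule less_exp)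
    also have "\<dots> \<le> 2 ^ (?h t + 1)" by simp
    finally have "?h t < 2 ^ (?h t + 1)" .
    then have up: "?h t < 2 ^ (k + 1)" unfolding k_def by (rule LeastI)
    have low: "2 ^ k \<le> ?h t"
    proof (cases k)
      case 0
      then have "(2::nat) ^ k = 1" by simp
      then show ?thesis using big one_le_power[of "2::nat" K] by linarith
    next
      case (Suc i)
      then have "\<not> ?h t < 2 ^ (i + 1)" using not_less_Least[of i "\<lambda>k. ?h t < 2 ^ (k + 1)"] unfolding k_def by simp
      then show ?thesis using Suc by simp
    qed
    have "(2::nat) ^ K < 2 ^ (k + 1)" using up big by linarith
    then have "K \<le> k" using power_less_imp_less_exp[of "2::nat" K "k + 1"] by simp
    moreover have "\<omega> \<in> block_hit y k"
      unfolding block_hit_def using w up low that by (auto simp: sum_list_history intro!: exI[of _ t])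
    ultimately show False using K by blast
  qed
  then have "?h ` ?V \<subseteq> {..<2 ^ K}" by auto
  then have "finite (?h ` ?V)" by (rule finite_subset) simp
  then have "finite ?V" using inj by (rule finite_imageD)
  moreover have "{t. W t \<omega> = y} \<subseteq> insert t0 ?V"
  proof
    fix t assume "t \<in> {t. W t \<omega> = y}"
    then have "W t \<omega> = y" "t0 \<le> t" unfolding t0_def by (auto intro: Least_le)
    then show "t \<in> insert t0 ?V" by auto
  qed
  ultimately show ?thesis by (meson finite_insert finite_subset)
qed simp

lemma AE_finite_visits: "AE \<omega> in M. \<forall>y. finite {t. W t \<omega> = y}"
proof -
  have "AE \<omega> in M. \<forall>y. \<forall>\<^sub>F k in sequentially. \<omega> \<notin> block_hit y k"
    unfolding AE_all_countable using AE_eventually_not_block_hit by blast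
  then show ?thesis using start AE_space
    by eventually_elim (auto intro: finite_visits)
qed

end

lemma finite_norm_real_site_le: "finite {v. norm (real_site v) \<le> B}"
proof -
  let ?I = "{- \<lceil>\<bar>B\<bar>\<rceil>..\<lceil>\<bar>B\<bar>\<rceil>}"
  have "{v. norm (real_site v) \<le> B} \<subseteq> ?I \<times> ?I \<times> ?I"
  proof
    fix v :: site assume "v \<in> {v. norm (real_site v) \<le> B}"
    moreover obtain a b c where v: "v = (a, b, c)" by (cases v)
    ultimately have n: "norm (real_of_int a, real_of_int b, real_of_int c) \<le> B" by (simp add: real_site_def)
    have "\<bar>real_of_int a\<bar> \<le> B" "norm (real_of_int b, real_of_int c) \<le> B"
      using norm_fst_le[of "real_of_int a" "(real_of_int b, real_of_int c)"]
        norm_snd_le[of "(real_of_int b, real_of_int c)" "real_of_int a"] n by auto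
    moreover from this have "\<bar>real_of_int b\<bar> \<le> B" "\<bar>real_of_int c\<bar> \<le> B"
      using norm_fst_le[of "real_of_int b" "real_of_int c"]
        norm_snd_le[of "real_of_int c" "real_of_int b"] by auto
    moreover have "i \<in> ?I" if "\<bar>real_of_int i\<bar> \<le> B" for i
    proof -
      have "\<bar>real_of_int i\<bar> \<le> of_int \<lceil>\<bar>B\<bar>\<rceil>" using that le_of_int_ceiling[of "\<bar>B\<bar>"] by linarith
      then show ?thesis by (simp add: abs_le_iff flip: of_int_abs)
    qed
    ultimately show "v \<in> ?I \<times> ?I \<times> ?I" unfolding v by blast
  qed
  then show ?thesis by (rule finite_subset) auto
qed

theorem theorem1p1:
  fixes M :: "'a measure" and W :: "nat \<Rightarrow> 'a \<Rightarrow> int \<times> int \<times> int"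
  assumes "self_interacting_walk M W"
  shows "AE \<omega> in M. filterlim (\<lambda>t. norm (real_site (W t \<omega>))) at_top sequentially"
proof -
  interpret self_interacting_walk M W by (rule assms)
  show ?thesis using AE_finite_visits
  proof eventually_elim
    case (elim \<omega>)
    show ?case unfolding filterlim_at_top
    proof
      fix B
      \<comment> \<open>A ball contains finitely many sites, and each of them is visited finitely
        often.\<close>
      have "{t. \<not> B \<le> norm (real_site (W t \<omega>))} \<subseteq> (\<Union>y\<in>{v. norm (real_site v) \<le> B}. {t. W t \<omega> = y})"
        by auto
      moreover have "finite (\<Union>y\<in>{v. norm (real_site v) \<le> B}. {t. W t \<omega> = y})"
        using elim finite_norm_real_site_le by blast
      ultimately have "finite {t. \<not> B \<le> norm (real_site (W t \<omega>))}" by (rule finite_subset)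
      then show "\<forall>\<^sub>F t in sequentially. B \<le> norm (real_site (W t \<omega>))"
        by (simp add: eventually_cofinite flip: cofinite_eq_sequentially)
    qed
  qed
qed

end
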